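(* For every irreducible smooth representation $\tau \in \widehat{K}$, \[\dim \mathrm{Hom}_{K_{n-1,1}}\left(1,\tau|_{K_{n-1,1}}\right) = \begin{cases} 1 & \text{if } \tau = \tau_{\chi,m} \text{ for some } \chi \in \widehat{\mathcal{O}^{\times}} \text{ and } m \geq c(\chi), \\ 0 & \text{otherwise.}\end{cases}\] In particular, for every $\chi \in \widehat{\mathcal{O}^{\times}}$ and $m \geq c(\chi)$, the subspace \[\mathcal{H}_{\chi,m}(S^{n-1})^{K_{n-1,1}} = \{f \in \mathcal{H}_{\chi,m}(S^{n-1}) : f(xk') = f(x) \text{ for all } x \in S^{n-1} \text{ and } k' \in K_{n-1,1}\}\] of $K_{n-1,1}$-invariant functions in $\mathcal{H}_{\chi,m}(S^{n-1})$ is one-dimensional.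
   Context: Let $F$ be a nonarchimedean local field with ring of integers $\mathcal{O}$, maximal ideal $\mathfrak{p}$, uniformiser $\varpi$, residue field of order $q$, and absolute value normalised by $|\varpi| = q^{-1}$. Fix $n \geq 2$ and let $K = \mathrm{GL}_n(\mathcal{O})$ with Haar probability measure $dk$. Let $\widehat{K}$ be the set of equivalence classes of irreducible smooth representations of $K$. Let \[K_{n-1,1} = \left\{\begin{pmatrix} a & b \\ 0 & 1\end{pmatrix} \in K : a \in \mathrm{GL}_{n-1}(\mathcal{O}),\ b \in \mathrm{Mat}_{(n-1)\times 1}(\mathcal{O})\right\}.\] Let $S^{n-1} = \{x \in F^n : \max\{|x_1|,\ldots,|x_n|\} = 1\}$ (row vectors), on which $K$ acts by $k \cdot x = xk$, and let $e_n = (0,\ldots,0,1)$. $C^{\infty}(S^{n-1})$ is the space of locally constant functions $f : S^{n-1} \to \mathbb{C}$, on which $K$ acts by right translation, with inner product $\langle f_1,f_2\rangle = \int_K f_1(e_n k)\overline{f_2(e_n k)}\,dk$. For $m \geq 0$, $K(\mathfrak{p}^m) = \{k \in K : k - 1_n \in \mathrm{Mat}_{n\times n}(\mathfrak{p}^m)\}$. $\widehat{\mathcal{O}^{\times}}$ is the set of continuous characters $\chi : \mathcal{O}^{\times} \to \mathbb{C}^{\times}$. The conductor exponent $c(\chi)$ is the least nonnegative integer $m$ such that $\chi$ is trivial on $1+\mathfrak{p}^m$ (on $\mathcal{O}^{\times}$ if $m=0$). Let $C^{\infty}(S^{n-1})_{\chi}^{K(\mathfrak{p}^m)}$ be the space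 of $f \in C^{\infty}(S^{n-1})$ with $f(xk) = f(x)$ for all $k \in K(\mathfrak{p}^m)$ and $f(ax) = \chi(a) f(x)$ for all $a \in \mathcal{O}^{\times}$. For $m \geq c(\chi)$, $\mathcal{H}_{\chi,m}(S^{n-1})$ is $C^{\infty}(S^{n-1})_{\chi}^{K(\mathfrak{p}^{c(\chi)})}$ if $m = c(\chi)$, and the orthogonal complement of $C^{\infty}(S^{n-1})_{\chi}^{K(\mathfrak{p}^{m-1})}$ in $C^{\infty}(S^{n-1})_{\chi}^{K(\mathfrak{p}^m)}$ if $m > c(\chi)$. It is an irreducible finite-dimensional $K$-module, and $\tau_{\chi,m} \in \widehat{K}$ denotes the representation of $K$ on $\mathcal{H}_{\chi,m}(S^{n-1})$ by right translations. *)

theory Defs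
  imports "HOL-Probability.Probability" "HOL-Library.Function_Algebras"
begin

section \<open>Nonarchimedean local fields\<close>

class metric_field = field + complete_space
begin

definition absv :: "'a \<Rightarrow> real" where
  "absv x = dist x 0"

definition int_ring :: "'a set" where
  "int_ring = {x. absv x \<le> 1}"

definition max_ideal :: "'a set" where
  "max_ideal = {x. absv x < 1}"

definition residue_field :: "'a set set" where
  "residue_field = int_ring // {(x, y). x \<in> int_ring \<and> y \<in> int_ring \<and> x - y \<in> max_ideal}"

definition uniformiser :: "'a \<Rightarrow> bool" where
  "uniformiser w \<longleftrightarrow> max_ideal = (\<lambda>y. w * y) ` int_ring"

end

text \<open>The distance of the type is the one induced by the absolute value, so that topology,
  completeness and Borel sets are those of the library.  A nonzero generator of the maximal ideal
  makes the absolute value nontrivial and discrete; the last equation is the normalisation.\<close>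

class nonarch_local_field = metric_field +
  assumes dist_eq_absv: "dist x y = absv (x - y)"
    and absv_mult: "absv (x * y) = absv x * absv y"
    and absv_ultrametric: "absv (x + y) \<le> max (absv x) (absv y)"
    and finite_residue_field: "finite residue_field"
    and normalised_uniformiser:
      "\<exists>w. w \<noteq> 0 \<and> uniformiser w \<and> absv w = 1 / real (card residue_field)"

definition int_units :: "'a::nonarch_local_field set" where
  "int_units = {x \<in> int_ring. \<exists>y\<in>int_ring. x * y = 1}"

definition max_ideal_pow :: "nat \<Rightarrow> 'a::nonarch_local_field set" where
  "max_ideal_pow m = {w ^ m * y | w y. uniformiser w \<and> y \<in> int_ring}"


section \<open>The groups\<close>

type_synonym ('a, 'n) sqmat = "'a ^ 'n ^ 'n"

definition GL_int :: "('a::nonarch_local_field, 'n::finite) sqmat set" where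
  "GL_int = {k. (\<forall>i j. k $ i $ j \<in> int_ring) \<and>
     (\<exists>l. (\<forall>i j. l $ i $ j \<in> int_ring) \<and> k ** l = mat 1 \<and> l ** k = mat 1)}"

definition GL_cong :: "nat \<Rightarrow> ('a::nonarch_local_field, 'n::finite) sqmat set" where
  "GL_cong m = {k \<in> GL_int. \<forall>i j. (k - mat 1) $ i $ j \<in> max_ideal_pow m}"

text \<open>The coordinates are ordered by the linear order of the finite index type.\<close>

definition last_index :: "'n::{finite,linorder}" where
  "last_index = Max UNIV"

definition e_last :: "('a::nonarch_local_field, 'n::{finite,linorder}) vec" where
  "e_last = axis last_index 1"

text \<open>The matrices in \<open>GL_int\<close> with last row \<open>(0, \<dots>, 0, 1)\<close>.  The upper left block of such a
  matrix is automatically invertible over the ring of integers: see \<open>GL_mirabolic_block\<close>.\<close>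

definition GL_mirabolic :: "('a::nonarch_local_field, 'n::{finite,linorder}) sqmat set" where
  "GL_mirabolic = {k \<in> GL_int. k $ last_index = e_last}"

lemma GL_mirabolic_block:
  fixes k :: "('a::nonarch_local_field, 'n::{finite,linorder}) sqmat"
  assumes "k \<in> GL_mirabolic"
  shows "\<exists>l::('a, 'n) sqmat. (\<forall>i j. l $ i $ j \<in> int_ring) \<and>
    (\<forall>i\<in>-{last_index}. \<forall>j\<in>-{last_index}.
       (\<Sum>r\<in>-{last_index}. k $ i $ r * l $ r $ j) = (if i = j then 1 else 0) \<and>
       (\<Sum>r\<in>-{last_index}. l $ i $ r * k $ r $ j) = (if i = j then 1 else 0))"
proof -
  from assms obtain l :: "('a, 'n) sqmat" where l: "\<forall>i j. l $ i $ j \<in> int_ring"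
      "k ** l = mat 1" "l ** k = mat 1" and last: "k $ last_index = e_last"
    by (auto simp: GL_mirabolic_def GL_int_def)
  have split: "(\<Sum>r\<in>UNIV. f r) = f last_index + (\<Sum>r\<in>-{last_index}. f r)" for f :: "'n \<Rightarrow> 'a"
    by (subst sum.remove[of _ last_index]) (auto simp: Compl_eq_Diff_UNIV)
  have kl: "(\<Sum>r\<in>UNIV. k $ i $ r * l $ r $ j) = (if i = j then 1 else 0)" for i j
    using arg_cong[OF l(2), of "\<lambda>A. A $ i $ j"] by (simp add: matrix_matrix_mult_def mat_def)
  have lk: "(\<Sum>r\<in>UNIV. l $ i $ r * k $ r $ j) = (if i = j then 1 else 0)" for i j
    using arg_cong[OF l(3), of "\<lambda>A. A $ i $ j"] by (simp add: matrix_matrix_mult_def mat_def)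
  have k0: "k $ last_index $ j = (if j = last_index then 1 else 0)" for j
    by (simp add: last e_last_def axis_def)
  have "(\<Sum>r\<in>-{last_index}. k $ last_index $ r * l $ r $ j) = 0" for j
    by (rule sum.neutral) (simp add: k0)
  then have l0: "l $ last_index $ j = (if j = last_index then 1 else 0)" for j
    using kl[of last_index j] by (simp add: split k0 eq_commute)
  show ?thesis
  proof (intro exI[of _ l] conjI ballI)
    show "\<forall>i j. l $ i $ j \<in> int_ring" by (rule l(1))
  next
    fix i j :: 'n assume "i \<in> -{last_index}" and "j \<in> -{last_index}"
    then show "(\<Sum>r\<in>-{last_index}. k $ i $ r * l $ r $ j) = (if i = j then 1 else 0)"
      and "(\<Sum>r\<in>-{last_index}. l $ i $ r * k $ r $ j) = (if i = j then 1 else 0)"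
      using kl[of i j] lk[of i j] by (simp_all add: split k0 l0)
  qed
qed

definition haar_prob_measure :: "('a::nonarch_local_field, 'n::finite) sqmat measure \<Rightarrow> bool" where
  "haar_prob_measure M \<longleftrightarrow>
     prob_space M \<and> sets M = sets (restrict_space borel GL_int) \<and>
     (\<forall>k\<in>GL_int. distr M M (\<lambda>x. k ** x) = M \<and> distr M M (\<lambda>x. x ** k) = M)"


section \<open>Complex representations\<close>

text \<open>The space is a linear subspace of the ambient type; the action matters only for group
  elements of the acting group and vectors of the space.\<close>

record ('g, 'v) rep =
  rspace :: "'v set"
  rscale :: "complex \<Rightarrow> 'v \<Rightarrow> 'v"
  ract :: "'g \<Rightarrow> 'v \<Rightarrow> 'v"

definition is_rep ::
    "('a::nonarch_local_field, 'n::finite) sqmat set \<Rightarrow> (('a, 'n) sqmat, 'v::ab_group_add) rep \<Rightarrow> bool" where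
  "is_rep G \<rho> \<longleftrightarrow>
     vector_space (rscale \<rho>) \<and> module.subspace (rscale \<rho>) (rspace \<rho>) \<and>
     (\<forall>g\<in>G. \<forall>v\<in>rspace \<rho>. ract \<rho> g v \<in> rspace \<rho>) \<and>
     (\<forall>g\<in>G. \<forall>v\<in>rspace \<rho>. \<forall>w\<in>rspace \<rho>. ract \<rho> g (v + w) = ract \<rho> g v + ract \<rho> g w) \<and>
     (\<forall>g\<in>G. \<forall>c. \<forall>v\<in>rspace \<rho>. ract \<rho> g (rscale \<rho> c v) = rscale \<rho> c (ract \<rho> g v)) \<and>
     (\<forall>v\<in>rspace \<rho>. ract \<rho> (mat 1) v = v) \<and>
     (\<forall>g\<in>G. \<forall>h\<in>G. \<forall>v\<in>rspace \<rho>. ract \<rho> (g ** h) v = ract \<rho> g (ract \<rho> h v))"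

definition smooth_rep ::
    "('a::nonarch_local_field, 'n::finite) sqmat set \<Rightarrow> (('a, 'n) sqmat, 'v::ab_group_add) rep \<Rightarrow> bool" where
  "smooth_rep G \<rho> \<longleftrightarrow> is_rep G \<rho> \<and>
     (\<forall>v\<in>rspace \<rho>. openin (top_of_set G) {g \<in> G. ract \<rho> g v = v})"

definition irreducible_rep ::
    "('a::nonarch_local_field, 'n::finite) sqmat set \<Rightarrow> (('a, 'n) sqmat, 'v::ab_group_add) rep \<Rightarrow> bool" where
  "irreducible_rep G \<rho> \<longleftrightarrow> is_rep G \<rho> \<and> rspace \<rho> \<noteq> {0} \<and>
     (\<forall>W. module.subspace (rscale \<rho>) W \<and> W \<subseteq> rspace \<rho> \<and> (\<forall>g\<in>G. \<forall>w\<in>W. ract \<rho> g w \<in> W)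
        \<longrightarrow> W = {0} \<or> W = rspace \<rho>)"

text \<open>Maps are normalised to be zero outside the source space, so that each homomorphism is
  represented by exactly one function and the space of homomorphisms has the right dimension.\<close>

definition rep_Hom :: "'g set \<Rightarrow> ('g, 'u::ab_group_add) rep \<Rightarrow> ('g, 'v::ab_group_add) rep
    \<Rightarrow> ('u \<Rightarrow> 'v) set" where
  "rep_Hom G \<rho> \<sigma> = {T.
     (\<forall>v\<in>rspace \<rho>. T v \<in> rspace \<sigma>) \<and> (\<forall>v. v \<notin> rspace \<rho> \<longrightarrow> T v = 0) \<and>
     (\<forall>v\<in>rspace \<rho>. \<forall>w\<in>rspace \<rho>. T (v + w) = T v + T w) \<and>
     (\<forall>c. \<forall>v\<in>rspace \<rho>. T (rscale \<rho> c v) = rscale \<sigma> c (T v)) \<and>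
     (\<forall>g\<in>G. \<forall>v\<in>rspace \<rho>. T (ract \<rho> g v) = ract \<sigma> g (T v))}"

definition rep_equiv ::
    "'g set \<Rightarrow> ('g, 'u::ab_group_add) rep \<Rightarrow> ('g, 'v::ab_group_add) rep \<Rightarrow> bool" where
  "rep_equiv G \<rho> \<sigma> \<longleftrightarrow> (\<exists>T\<in>rep_Hom G \<rho> \<sigma>. bij_betw T (rspace \<rho>) (rspace \<sigma>))"

definition trivial_rep :: "('g, complex) rep" where
  "trivial_rep = \<lparr>rspace = UNIV, rscale = (*), ract = (\<lambda>g z. z)\<rparr>"

definition fun_scale :: "(complex \<Rightarrow> 'v \<Rightarrow> 'v) \<Rightarrow> complex \<Rightarrow> ('x \<Rightarrow> 'v) \<Rightarrow> ('x \<Rightarrow> 'v)" where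
  "fun_scale s c f = (\<lambda>x. s c (f x))"

lemma vector_space_fun_scale:
  fixes s :: "complex \<Rightarrow> 'v::ab_group_add \<Rightarrow> 'v"
  assumes "vector_space s"
  shows "vector_space (fun_scale s :: complex \<Rightarrow> ('x \<Rightarrow> 'v) \<Rightarrow> ('x \<Rightarrow> 'v))"
proof -
  interpret vector_space s by (rule assms)
  show ?thesis
    by unfold_locales
      (auto simp: fun_scale_def fun_eq_iff scale_right_distrib scale_left_distrib)
qed

lemma vector_space_complex: "vector_space ((*) :: complex \<Rightarrow> complex \<Rightarrow> complex)"
  by unfold_locales (auto simp: algebra_simps)

text \<open>The first conjunct is needed because \<open>vector_space.dim\<close> is \<open>0\<close> on spaces of
  infinite dimension.\<close>

definition has_dim :: "(complex \<Rightarrow> 'v::ab_group_add \<Rightarrow> 'v) \<Rightarrow> 'v set \<Rightarrow> nat \<Rightarrow> bool" where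
  "has_dim s W d \<longleftrightarrow> (\<exists>B. finite B \<and> module.span s B = W) \<and> vector_space.dim s W = d"


section \<open>Functions on the sphere\<close>

definition sphere_int :: "('a::nonarch_local_field ^ 'n) set" where
  "sphere_int = {x. Max (range (\<lambda>i. absv (x $ i))) = 1}"

text \<open>Functions on the sphere are extended by zero to all row vectors; \<open>x v* k\<close> is the product of
  the row vector \<open>x\<close> with the matrix \<open>k\<close>.\<close>

definition smooth_fun :: "('a::nonarch_local_field ^ 'n \<Rightarrow> complex) set" where
  "smooth_fun = {f. (\<forall>x. x \<notin> sphere_int \<longrightarrow> f x = 0) \<and>
     (\<forall>x\<in>sphere_int. \<exists>U. open U \<and> x \<in> U \<and> (\<forall>y\<in>U \<inter> sphere_int. f y = f x))}"

definition smooth_fun_inner :: "('a::nonarch_local_field, 'n::{finite,linorder}) sqmat measure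
    \<Rightarrow> (('a, 'n) vec \<Rightarrow> complex) \<Rightarrow> (('a, 'n) vec \<Rightarrow> complex) \<Rightarrow> complex" where
  "smooth_fun_inner dk f g = (\<integral>k. f (e_last v* k) * cnj (g (e_last v* k)) \<partial>dk)"

text \<open>Only the values of a character on the units matter.\<close>

definition unit_character :: "('a::nonarch_local_field \<Rightarrow> complex) \<Rightarrow> bool" where
  "unit_character \<psi> \<longleftrightarrow> continuous_on int_units \<psi> \<and>
     (\<forall>a\<in>int_units. \<psi> a \<noteq> 0) \<and>
     (\<forall>a\<in>int_units. \<forall>b\<in>int_units. \<psi> (a * b) = \<psi> a * \<psi> b)"

definition conductor_exp :: "('a::nonarch_local_field \<Rightarrow> complex) \<Rightarrow> nat" where
  "conductor_exp \<psi> = (LEAST m. \<forall>a \<in> (if m = 0 then int_units else {1 + y | y. y \<in> max_ideal_pow m}).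
     \<psi> a = 1)"

definition smooth_fun_level :: "('a::nonarch_local_field \<Rightarrow> complex) \<Rightarrow> nat
    \<Rightarrow> ('a ^ 'n \<Rightarrow> complex) set" where
  "smooth_fun_level \<psi> m = {f \<in> smooth_fun.
     (\<forall>x\<in>sphere_int. \<forall>k\<in>GL_cong m. f (x v* k) = f x) \<and>
     (\<forall>x\<in>sphere_int. \<forall>a\<in>int_units. f (a *s x) = \<psi> a * f x)}"

text \<open>Meaningful for \<open>m \<ge> conductor_exp \<psi>\<close> only.\<close>

definition harmonic_space :: "('a::nonarch_local_field, 'n::{finite,linorder}) sqmat measure
    \<Rightarrow> ('a \<Rightarrow> complex) \<Rightarrow> nat \<Rightarrow> (('a, 'n) vec \<Rightarrow> complex) set" where
  "harmonic_space dk \<psi> m =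
     (if m = conductor_exp \<psi> then smooth_fun_level \<psi> m
      else {f \<in> smooth_fun_level \<psi> m. \<forall>g\<in>smooth_fun_level \<psi> (m - 1). smooth_fun_inner dk f g = 0})"

definition harmonic_rep :: "('a::nonarch_local_field, 'n::{finite,linorder}) sqmat measure
    \<Rightarrow> ('a \<Rightarrow> complex) \<Rightarrow> nat \<Rightarrow> (('a, 'n) sqmat, ('a, 'n) vec \<Rightarrow> complex) rep" where
  "harmonic_rep dk \<psi> m =
     \<lparr>rspace = harmonic_space dk \<psi> m, rscale = fun_scale (*), ract = (\<lambda>k f x. f (x v* k))\<rparr>"

end

theory Submission
  imports Defs
begin

text \<open>A mirabolic-invariant function with central character \<open>\<psi>\<close> is determined by its values on
  the orbits, which are classified by the size of the coordinates other than the last one.  In the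
  harmonic space of level \<open>m\<close> all these values are multiples of the value at \<open>e_last\<close>, because
  harmonicity for \<open>m\<close> above the conductor exponent means that the averages over \<open>GL_cong (m - 1)\<close>
  vanish.  So the invariants are one-dimensional, spanned by a combination of the indicator-like
  function of a polar cap and its average.

  Conversely, let \<open>\<tau>\<close> be smooth and irreducible with a nonzero mirabolic-fixed vector, let \<open>\<psi>\<close> be
  its central character and \<open>m\<close> the least level with \<open>GL_cong m\<close> acting trivially.  Frobenius
  reciprocity gives an intertwiner from the functions of level \<open>m\<close> and central character \<open>\<psi>\<close> to
  \<open>\<tau>\<close>; it kills level \<open>m - 1\<close> and is nonzero on the zonal harmonic function.  Every nonzero
  submodule of the harmonic space contains that function (translate and average over the mirabolic
  group), so the intertwiner is injective on the harmonic space, and it is surjective by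
  irreducibility.\<close>

section \<open>The absolute value\<close>

text \<open>Everything of level m sees a matrix only modulo the m-th power of the maximal ideal, so
  Haar integrals, group averages and the intertwiner all become sums over finitely many classes. The
  sums stay undivided; the number of classes appears as an explicit nonzero factor. The conductor
  exponent is where the hierarchy starts: if \<open>\<psi> a \<noteq> 1\<close> for a unit a
  congruent to 1 modulo the n-th power, then x and a x are congruent, and a
  \<open>\<psi>\<close>-equivariant function of level n must vanish. Hence two mechanisms act off
  the polar cap: equivariance at the bottom level, orthogonality above it. The space of
  \<open>\<tau>\<close> is an arbitrary complex vector space, so an eigenvalue of a central element
  has to be produced before irreducibility can turn it into a scalar. Smoothness supplies it: some
  congruence subgroup acts trivially, so scalar matrices move a vector periodically. The bound
  \<open>CARD('n) \<ge> 2\<close> gives a direction in which \<open>e_last\<close> can leave a cap,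
  which keeps the zonal functions nonzero.\<close>

lemma absv_0 [simp]: "absv (0::'a::nonarch_local_field) = 0"
  by (simp add: absv_def)

lemma absv_nonneg [simp]: "0 \<le> absv (x::'a::nonarch_local_field)"
  by (simp add: absv_def)

lemma absv_eq_0_iff [simp]: "absv (x::'a::nonarch_local_field) = 0 \<longleftrightarrow> x = 0"
  by (simp add: absv_def)

lemma absv_pos_iff [simp]: "0 < absv (x::'a::nonarch_local_field) \<longleftrightarrow> x \<noteq> 0"
  by (simp add: absv_def)

lemma absv_1 [simp]: "absv (1::'a::nonarch_local_field) = 1"
  using absv_mult[of 1 "1::'a"] absv_eq_0_iff[of "1::'a"] by simp

lemma absv_minus [simp]: "absv (- x) = absv (x::'a::nonarch_local_field)"
  using dist_eq_absv[of 0 x] by (simp add: absv_def dist_commute)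

lemma absv_minus_commute: "absv (x - y) = absv (y - x :: 'a::nonarch_local_field)"
  using absv_minus[of "x - y"] by simp

lemma absv_power: "absv (x ^ n) = absv (x::'a::nonarch_local_field) ^ n"
  by (induction n) (simp_all add: absv_mult)

lemma absv_divide: "absv (x / y) = absv x / absv (y::'a::nonarch_local_field)"
proof (cases "y = 0")
  case False
  then have "absv (x / y) * absv y = absv x"
    by (simp flip: absv_mult)
  with False show ?thesis
    by (simp add: field_simps)
qed simp

lemma absv_add_le:
  assumes "absv x \<le> c" "absv y \<le> c"
  shows "absv (x + y :: 'a::nonarch_local_field) \<le> c"
  using absv_ultrametric[of x y] assms by linarith

lemma absv_diff_le:
  assumes "absv x \<le> c" "absv y \<le> c"
  shows "absv (x - y :: 'a::nonarch_local_field) \<le> c"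
  using absv_add_le[of x c "- y"] assms by simp

lemma absv_diff_trans:
  assumes "absv (x - y) \<le> c" "absv (y - z) \<le> c"
  shows "absv (x - z :: 'a::nonarch_local_field) \<le> c"
  using absv_add_le[OF assms] by simp

lemma absv_le_of_diff:
  assumes "absv (x - y) \<le> c" "absv y \<le> c"
  shows "absv (x :: 'a::nonarch_local_field) \<le> c"
  using absv_add_le[OF assms] by simp

text \<open>Isosceles triangles: in an ultrametric, a perturbation smaller than y cannot change the
  size of y.\<close>

lemma absv_eq_of_diff_less:
  assumes "absv (x - y) < absv y"
  shows "absv (x :: 'a::nonarch_local_field) = absv y"
proof (rule antisym)
  show "absv x \<le> absv y"
    using absv_le_of_diff[of x y "absv y"] assms by simp
  show "absv y \<le> absv x"
    using absv_ultrametric[of "y - x" x] assms absv_minus_commute[of x y] by auto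
qed

lemma absv_sum_le:
  assumes "\<And>i. i \<in> A \<Longrightarrow> absv (f i) \<le> c" "0 \<le> c"
  shows "absv (\<Sum>i\<in>A. f i :: 'a::nonarch_local_field) \<le> c"
  using assms by (induction A rule: infinite_finite_induct) (auto intro: absv_add_le)

lemma absv_mult_le:
  assumes "absv x \<le> 1" "absv y \<le> c"
  shows "absv (x * y :: 'a::nonarch_local_field) \<le> c"
  using mult_mono[OF assms] by (simp add: absv_mult)

lemma int_units_iff: "a \<in> int_units \<longleftrightarrow> absv (a::'a::nonarch_local_field) = 1"
proof
  assume "a \<in> int_units"
  then obtain b where "absv a \<le> 1" "absv b \<le> 1" "a * b = 1"
    by (auto simp: int_units_def int_ring_def)
  then have "absv b \<le> 1" "absv a \<le> 1" "absv a * absv b = 1"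
    by (simp_all flip: absv_mult)
  moreover from this have "absv a * absv b \<le> absv a"
    by (intro mult_left_le) auto
  ultimately show "absv a = 1" by linarith
next
  assume a: "absv a = 1"
  then have "a \<noteq> 0" by auto
  with a have "absv (1 / a) \<le> 1" "a * (1 / a) = 1"
    by (simp_all add: absv_divide)
  moreover have "a \<in> int_ring"
    using a by (simp add: int_ring_def)
  ultimately show "a \<in> int_units"
    unfolding int_units_def int_ring_def by blast
qed

section \<open>Uniformisers, discreteness of the absolute value, residues\<close>

definition unif :: "'a::nonarch_local_field" where
  "unif = (SOME w. w \<noteq> 0 \<and> uniformiser w)"

lemma unif_nonzero: "(unif::'a::nonarch_local_field) \<noteq> 0"
  and uniformiser_unif: "uniformiser (unif::'a)"
proof -
  have "\<exists>w::'a. w \<noteq> 0 \<and> uniformiser w"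
    using normalised_uniformiser by blast
  from someI_ex[OF this] show "(unif::'a) \<noteq> 0" "uniformiser (unif::'a)"
    by (auto simp: unif_def)
qed

lemma absv_unif_pos [simp]: "0 < absv (unif::'a::nonarch_local_field)"
  by (simp add: unif_nonzero)

text \<open>The maximal ideal is w times the unit ball, so no absolute value lies strictly between
  \<open>absv w\<close> and 1. This is how discreteness enters.\<close>

lemma uniformiserD:
  fixes w x :: "'a::nonarch_local_field"
  assumes "uniformiser w"
  shows "absv w < 1" "absv x < 1 \<Longrightarrow> absv x \<le> absv w"
proof -
  have w: "{x. absv x < 1} = (\<lambda>y. w * y) ` {x. absv x \<le> 1}"
    using assms by (simp add: uniformiser_def max_ideal_def int_ring_def)
  have "w * 1 \<in> (\<lambda>y. w * y) ` {x. absv x \<le> 1}"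
    by (rule imageI) simp
  then show "absv w < 1"
    unfolding w[symmetric] by simp
  assume "absv x < 1"
  then have "x \<in> (\<lambda>y. w * y) ` {x. absv x \<le> 1}"
    unfolding w[symmetric] by simp
  then obtain y where "x = w * y" "absv y \<le> 1" by auto
  then show "absv x \<le> absv w"
    using mult_left_le[of "absv y" "absv w"] by (simp add: absv_mult)
qed

lemma absv_unif_less_1 [simp]: "absv (unif::'a::nonarch_local_field) < 1"
  by (rule uniformiserD(1)[OF uniformiser_unif])

lemma absv_unif_power_le_1 [simp]: "absv (unif::'a::nonarch_local_field) ^ m \<le> 1"
  by (intro power_le_one) (auto intro: less_imp_le)

lemma absv_unif_power_nonneg [simp]: "0 \<le> absv (unif::'a::nonarch_local_field) ^ m"
  by simp

lemma absv_unif_power_antimono: "m \<le> n \<Longrightarrow> absv (unif::'a::nonarch_local_field) ^ n \<le> absv (unif::'a) ^ m"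
  by (rule power_decreasing) (auto intro: less_imp_le)

text \<open>Makes the choice behind \<open>unif\<close> immaterial.\<close>

lemma absv_uniformiser:
  assumes "uniformiser (w::'a::nonarch_local_field)"
  shows "absv w = absv (unif::'a)"
  using uniformiserD[OF assms] uniformiserD[OF uniformiser_unif] by (meson antisym)

text \<open>The definition lets the uniformiser vary with the element; since all uniformisers have
  the same size, the set is still a ball. All later congruences are phrased through this
  ball.\<close>

lemma mem_max_ideal_pow_iff:
  "x \<in> max_ideal_pow m \<longleftrightarrow> absv (x::'a::nonarch_local_field) \<le> absv (unif::'a) ^ m"
proof
  assume "x \<in> max_ideal_pow m"
  then obtain w y where "x = w ^ m * y" "uniformiser w" "absv y \<le> 1"
    by (auto simp: max_ideal_pow_def int_ring_def)
  then show "absv x \<le> absv (unif::'a) ^ m"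
    using mult_left_le[of "absv y" "absv (unif::'a) ^ m"]
    by (simp add: absv_mult absv_power absv_uniformiser)
next
  assume "absv x \<le> absv (unif::'a) ^ m"
  then have "x = unif ^ m * (x / unif ^ m)" "x / unif ^ m \<in> int_ring"
    by (auto simp: int_ring_def absv_divide absv_power unif_nonzero)
  then show "x \<in> max_ideal_pow m"
    unfolding max_ideal_pow_def using uniformiser_unif by blast
qed

text \<open>Discreteness at scale m, by applying \<open>uniformiserD\<close> to the quotient of
  \<open>unif ^ Suc m\<close> by x.\<close>

lemma absv_unif_power_Suc_less_imp_le:
  assumes "absv (unif::'a) ^ Suc m < absv (x::'a::nonarch_local_field)"
  shows "absv (unif::'a) ^ m \<le> absv x"
proof -
  have "x \<noteq> 0"
    using assms by (auto simp: zero_less_power order.strict_iff_not)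
  have "absv (unif ^ Suc m / x) < 1"
    using assms \<open>x \<noteq> 0\<close> by (simp add: absv_divide absv_power absv_mult)
  then have "absv (unif ^ Suc m / x) \<le> absv (unif::'a)"
    by (rule uniformiserD(2)[OF uniformiser_unif])
  then show ?thesis
    using \<open>x \<noteq> 0\<close> absv_unif_pos[where 'a='a]
    by (simp add: absv_divide absv_power absv_mult pos_divide_le_eq del: absv_unif_pos)
qed

lemma absv_unif_power_less_1 [simp]: "0 < m \<Longrightarrow> absv (unif::'a::nonarch_local_field) ^ m < 1"
  by (simp add: power_less_one_iff)

lemma ex_absv_unif_power_less:
  assumes "0 < e"
  shows "\<exists>m>0. absv (unif::'a::nonarch_local_field) ^ m < e"
proof -
  obtain n where "absv (unif::'a) ^ n < e"
    using real_arch_pow_inv[OF assms absv_unif_less_1] by blast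
  then have "absv (unif::'a) ^ Suc n < e"
    using absv_unif_power_antimono[of n "Suc n", where 'a='a] by linarith
  then show ?thesis by blast
qed

text \<open>Digit expansions: finiteness of the residue field gives finitely many digits S, and each
  induction step appends one digit, scaled by \<open>unif ^ m\<close>.\<close>

lemma ex_finite_residues:
  "\<exists>R::'a::nonarch_local_field set. finite R \<and> (\<forall>x. absv x \<le> 1 \<longrightarrow> (\<exists>r\<in>R. absv (x - r) \<le> absv (unif::'a) ^ m))"
proof (induction m)
  case 0
  show ?case by (rule exI[of _ "{0}"]) simp
next
  case (Suc m)
  then obtain R :: "'a set" where R: "finite R"
    "\<And>x. absv x \<le> 1 \<Longrightarrow> \<exists>r\<in>R. absv (x - r) \<le> absv (unif::'a) ^ m" by blast
  define S where "S = (\<lambda>C. SOME y::'a. y \<in> C) ` residue_field"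
  have S: "\<exists>s\<in>S. absv (x - s) \<le> absv (unif::'a)" if x: "absv x \<le> 1" for x :: 'a
  proof -
    define rel where "rel = {(x, y). x \<in> int_ring \<and> y \<in> int_ring \<and> x - y \<in> (max_ideal::'a set)}"
    define C where "C = rel `` {x}"
    have xI: "x \<in> int_ring" using x by (simp add: int_ring_def)
    then have "C \<in> residue_field"
      unfolding residue_field_def C_def rel_def by (intro quotientI)
    then have S: "(SOME y. y \<in> C) \<in> S" by (simp add: S_def)
    have "x \<in> C" using xI by (simp add: C_def rel_def max_ideal_def)
    then have "(SOME y. y \<in> C) \<in> C" by (rule someI)
    moreover have "\<And>y. y \<in> C \<Longrightarrow> absv (x - y) < 1" by (simp add: C_def rel_def max_ideal_def)
    ultimately have "absv (x - (SOME y. y \<in> C)) < 1" by blast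
    with S show ?thesis
      using uniformiserD(2)[OF uniformiser_unif] by blast
  qed
  have "finite S" by (simp add: S_def finite_residue_field)
  define R' where "R' = (\<lambda>(r, s). r + unif ^ m * s) ` (R \<times> S)"
  have "\<exists>r\<in>R'. absv (x - r) \<le> absv (unif::'a) ^ Suc m" if x: "absv x \<le> 1" for x :: 'a
  proof -
    obtain r where r: "r \<in> R" "absv (x - r) \<le> absv (unif::'a) ^ m" using R x by blast
    then have "absv ((x - r) / unif ^ m) \<le> 1"
      by (simp add: absv_divide absv_power divide_le_eq_1 unif_nonzero)
    then obtain s where s: "s \<in> S" "absv ((x - r) / unif ^ m - s) \<le> absv (unif::'a)"
      using S by blast
    have "unif ^ m * ((x - r) / unif ^ m) = x - r"
      by (simp add: unif_nonzero)
    then have "x - (r + unif ^ m * s) = unif ^ m * ((x - r) / unif ^ m - s)"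
      by (simp only: right_diff_distrib) (simp add: algebra_simps)
    then have "absv (x - (r + unif ^ m * s)) \<le> absv (unif::'a) ^ Suc m"
      using mult_left_mono[OF s(2), of "absv (unif::'a) ^ m"] by (simp add: absv_mult absv_power mult.commute)
    moreover have "r + unif ^ m * s \<in> R'"
      using r s by (force simp: R'_def)
    ultimately show ?thesis by blast
  qed
  moreover have "finite R'" using R \<open>finite S\<close> by (simp add: R'_def)
  ultimately show ?case by blast
qed


section \<open>Congruences and integral matrices\<close>

definition vcong :: "nat \<Rightarrow> 'a::nonarch_local_field ^ 'n \<Rightarrow> 'a ^ 'n \<Rightarrow> bool" where
  "vcong m x y \<longleftrightarrow> (\<forall>i. absv (x $ i - y $ i) \<le> absv (unif::'a) ^ m)"

text \<open>Row by row, because row i of a product \<open>g ** k\<close> is row i of g acted on by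
  k; facts about vectors then transfer to matrices.\<close>

definition mcong :: "nat \<Rightarrow> ('a::nonarch_local_field, 'n::finite) sqmat \<Rightarrow> ('a, 'n) sqmat \<Rightarrow> bool" where
  "mcong m k l \<longleftrightarrow> (\<forall>i. vcong m (k $ i) (l $ i))"

lemma vcong_refl [simp]: "vcong m x x"
  by (simp add: vcong_def)

lemma vcong_sym: "vcong m x y \<Longrightarrow> vcong m y x"
  by (simp add: vcong_def absv_minus_commute)

lemma vcong_trans: "vcong m x y \<Longrightarrow> vcong m y z \<Longrightarrow> vcong m x z"
  unfolding vcong_def by (meson absv_diff_trans)

lemma vcong_mono: "vcong n x (y::'a::nonarch_local_field^'n) \<Longrightarrow> m \<le> n \<Longrightarrow> vcong m x y"
  unfolding vcong_def by (meson absv_unif_power_antimono order_trans)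

lemma mcong_refl [simp]: "mcong m k k"
  by (simp add: mcong_def)

lemma mcong_sym: "mcong m k l \<Longrightarrow> mcong m l k"
  by (simp add: mcong_def vcong_sym)

lemma mcong_trans: "mcong m k l \<Longrightarrow> mcong m l h \<Longrightarrow> mcong m k h"
  unfolding mcong_def by (meson vcong_trans)

lemma GL_int_entry: "k \<in> GL_int \<Longrightarrow> absv (k $ i $ j) \<le> 1"
  by (simp add: GL_int_def int_ring_def)

lemma vcong_vector_matrix_mult:
  fixes x y :: "'a::nonarch_local_field ^ 'n::finite"
  assumes "vcong m x y" "k \<in> GL_int"
  shows "vcong m (x v* k) (y v* k)"
proof -
  have "(x v* k) $ j - (y v* k) $ j = (\<Sum>i\<in>UNIV. k $ i $ j * (x $ i - y $ i))" for j
    by (simp add: vector_matrix_mult_def sum_subtractf algebra_simps)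
  then show ?thesis
    using assms by (auto simp: vcong_def GL_int_entry intro!: absv_sum_le absv_mult_le)
qed

lemma vcong_vector_matrix_mult_right:
  fixes x :: "'a::nonarch_local_field ^ 'n::finite"
  assumes "\<And>i. absv (x $ i) \<le> 1" "mcong m k l"
  shows "vcong m (x v* k) (x v* l)"
proof -
  have "(x v* k) $ j - (x v* l) $ j = (\<Sum>i\<in>UNIV. x $ i * (k $ i $ j - l $ i $ j))" for j
    by (simp add: vector_matrix_mult_def sum_subtractf algebra_simps)
  then show ?thesis
    using assms by (auto simp: vcong_def mcong_def intro!: absv_sum_le absv_mult_le)
qed

lemma matrix_mult_row: "(g ** k) $ i = (g $ i) v* k"
  by (simp add: matrix_matrix_mult_def vector_matrix_mult_def vec_eq_iff)

lemma mcong_mult_right: "mcong m g h \<Longrightarrow> k \<in> GL_int \<Longrightarrow> mcong m (g ** k) (h ** k)"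
  by (simp add: mcong_def matrix_mult_row vcong_vector_matrix_mult)

lemma mcong_mult_left: "mcong m g h \<Longrightarrow> k \<in> GL_int \<Longrightarrow> mcong m (k ** g) (k ** h)"
  by (subst mcong_def) (simp add: matrix_mult_row vcong_vector_matrix_mult_right GL_int_entry)

section \<open>The group of integral matrices and its subgroups\<close>

lemma GL_int_inverse:
  assumes "k \<in> GL_int"
  shows "matrix_inv k \<in> GL_int" "k ** matrix_inv k = mat 1" "matrix_inv k ** k = mat 1"
proof -
  obtain l where l: "\<forall>i j. l $ i $ j \<in> int_ring" "k ** l = mat 1" "l ** k = mat 1"
    using assms unfolding GL_int_def by blast
  have *: "k ** matrix_inv k = mat 1 \<and> matrix_inv k ** k = mat 1"
    unfolding matrix_inv_def by (rule someI[of _ l]) (simp add: l)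
  then show "k ** matrix_inv k = mat 1" "matrix_inv k ** k = mat 1" by simp_all
  \<comment> \<open>\<open>matrix_inv\<close> is chosen among all inverses over the field;
    uniqueness identifies it with the integral inverse l.\<close>
  have "matrix_inv k = matrix_inv k ** (k ** l)"
    by (simp add: l(2))
  also have "\<dots> = l"
    by (simp add: matrix_mul_assoc *)
  finally have "matrix_inv k = l" .
  then have "\<forall>i j. matrix_inv k $ i $ j \<in> int_ring"
    using l(1) by simp
  moreover have "\<forall>i j. k $ i $ j \<in> int_ring"
    using assms by (simp add: GL_int_def)
  ultimately show "matrix_inv k \<in> GL_int"
    unfolding GL_int_def using * by (intro CollectI conjI exI[of _ k]) simp_all
qed

lemma matrix_inv_unique_GL:
  fixes k l :: "('a::nonarch_local_field, 'n::finite) sqmat"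
  assumes "k \<in> GL_int" "k ** l = mat 1"
  shows "l = matrix_inv k"
proof -
  have "matrix_inv k ** (k ** l) = l"
    by (simp add: matrix_mul_assoc GL_int_inverse[OF assms(1)])
  then show ?thesis
    by (simp add: assms(2))
qed

lemma GL_int_mult:
  assumes "g \<in> GL_int" "h \<in> GL_int"
  shows "g ** h \<in> GL_int"
proof -
  have entries: "absv ((g ** h) $ i $ j) \<le> 1" if "g \<in> GL_int" "h \<in> GL_int"
    for g h :: "('a, 'b) sqmat" and i j
    using that by (auto simp: matrix_matrix_mult_def GL_int_entry intro!: absv_sum_le absv_mult_le)
  let ?l = "matrix_inv h ** matrix_inv g"
  have "g ** h ** ?l = g ** (h ** matrix_inv h) ** matrix_inv g"
    by (simp add: matrix_mul_assoc)
  moreover have "?l ** (g ** h) = matrix_inv h ** (matrix_inv g ** g) ** h"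
    by (simp add: matrix_mul_assoc)
  ultimately have "g ** h ** ?l = mat 1" "?l ** (g ** h) = mat 1"
    using assms by (simp_all add: GL_int_inverse)
  moreover have "absv (?l $ i $ j) \<le> 1" for i j
    using assms by (intro entries GL_int_inverse)
  ultimately show ?thesis
    using entries[OF assms] by (auto simp: GL_int_def int_ring_def)
qed

lemma mat_1_entry: "(mat 1 :: ('a::nonarch_local_field, 'n::finite) sqmat) $ i = axis i 1"
  by (simp add: mat_def axis_def vec_eq_iff eq_commute)

lemma mat_1_GL_int [simp]: "(mat 1 :: ('a::nonarch_local_field, 'b::finite) sqmat) \<in> GL_int"
proof -
  have "\<forall>i j. (mat 1 :: ('a, 'b) sqmat) $ i $ j \<in> int_ring"
    by (simp add: mat_def int_ring_def)
  then show ?thesis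
    unfolding GL_int_def by (intro CollectI conjI exI[of _ "mat 1"]) simp_all
qed

lemma GL_int_inverse_cancel:
  assumes "k \<in> GL_int"
  shows "matrix_inv k ** (k ** g) = g" "k ** (matrix_inv k ** g) = g"
    "g ** k ** matrix_inv k = g" "g ** matrix_inv k ** k = g"
proof -
  show "matrix_inv k ** (k ** g) = g" "k ** (matrix_inv k ** g) = g"
    by (simp_all add: matrix_mul_assoc GL_int_inverse[OF assms])
  show "g ** k ** matrix_inv k = g" "g ** matrix_inv k ** k = g"
    by (simp_all add: GL_int_inverse[OF assms] flip: matrix_mul_assoc)
qed

lemma GL_int_vector_cancel:
  assumes "k \<in> GL_int"
  shows "x v* k v* matrix_inv k = x" "x v* matrix_inv k v* k = x"
  using GL_int_inverse[OF assms] by (simp_all add: vector_matrix_mul_assoc)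

lemma matrix_inv_mult:
  assumes "g \<in> GL_int" "h \<in> GL_int"
  shows "matrix_inv (g ** h) = matrix_inv h ** matrix_inv g"
  using assms
  by (intro matrix_inv_unique_GL[symmetric] GL_int_mult)
    (simp_all add: matrix_mul_assoc GL_int_inverse_cancel GL_int_inverse)

lemma mcong_mult_left_iff:
  "k \<in> GL_int \<Longrightarrow> mcong m (k ** g) (k ** h) \<longleftrightarrow> mcong m g h"
  using mcong_mult_left[of m "k ** g" "k ** h" "matrix_inv k"]
  by (auto simp: GL_int_inverse_cancel GL_int_inverse mcong_mult_left)

lemma mcong_mult_right_iff:
  "k \<in> GL_int \<Longrightarrow> mcong m (g ** k) (h ** k) \<longleftrightarrow> mcong m g h"
  using mcong_mult_right[of m "g ** k" "h ** k" "matrix_inv k"]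
  by (auto simp: GL_int_inverse_cancel GL_int_inverse mcong_mult_right)

lemma GL_cong_iff: "k \<in> GL_cong m \<longleftrightarrow> k \<in> GL_int \<and> mcong m k (mat 1)"
  by (simp add: GL_cong_def mcong_def vcong_def mem_max_ideal_pow_iff)

lemma GL_cong_0: "GL_cong 0 = GL_int"
proof -
  have "absv (k $ i $ j - mat 1 $ i $ j) \<le> 1" if "k \<in> GL_int" for k :: "('a, 'b) sqmat" and i j
    using that by (intro absv_diff_le) (simp_all add: GL_int_entry)
  then show ?thesis
    by (auto simp: GL_cong_iff mcong_def vcong_def)
qed

text \<open>Identifies congruence classes inside \<open>GL_int\<close> with cosets of
  \<open>GL_cong m\<close>, so that entrywise estimates can replace coset arithmetic.\<close>

lemma mcong_iff_GL_cong:
  assumes "g \<in> GL_int" "h \<in> GL_int"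
  shows "mcong m g h \<longleftrightarrow> matrix_inv g ** h \<in> GL_cong m"
  using assms mcong_mult_left_iff[of "matrix_inv g" m h g]
  by (auto simp: GL_cong_iff GL_int_mult GL_int_inverse intro: mcong_sym)

definition GL_subgroup :: "('a::nonarch_local_field, 'n::finite) sqmat set \<Rightarrow> bool" where
  "GL_subgroup G \<longleftrightarrow> G \<subseteq> GL_int \<and> mat 1 \<in> G \<and> (\<forall>g\<in>G. \<forall>h\<in>G. g ** h \<in> G) \<and> (\<forall>g\<in>G. matrix_inv g \<in> G)"

lemma GL_subgroup_GL_int: "GL_subgroup GL_int"
  by (simp add: GL_subgroup_def GL_int_mult GL_int_inverse)

lemma GL_subgroup_GL_cong: "GL_subgroup (GL_cong m)"
  unfolding GL_subgroup_def
proof (intro conjI ballI)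
  fix g :: "('a, 'b) sqmat" assume g: "g \<in> GL_cong m"
  then have gG: "g \<in> GL_int" "mcong m g (mat 1)" by (simp_all add: GL_cong_iff)
  then have "mcong m (matrix_inv g ** g) (matrix_inv g ** mat 1)"
    by (intro mcong_mult_left GL_int_inverse)
  then show "matrix_inv g \<in> GL_cong m"
    using gG by (simp add: GL_cong_iff GL_int_inverse mcong_sym)
  fix h :: "('a, 'b) sqmat" assume "h \<in> GL_cong m"
  then have h: "h \<in> GL_int" "mcong m h (mat 1)" by (simp_all add: GL_cong_iff)
  then have "mcong m (g ** h) (mat 1 ** h)"
    using gG by (intro mcong_mult_right)
  then show "g ** h \<in> GL_cong m"
    using gG h by (auto simp: GL_cong_iff GL_int_mult intro: mcong_trans)
qed (auto simp: GL_cong_iff)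

text \<open>Normality makes averages over \<open>GL_cong m\<close> commute with translations and
  makes its fixed vectors a subrepresentation.\<close>

lemma GL_cong_conj:
  assumes "k \<in> GL_int" "g \<in> GL_cong m"
  shows "matrix_inv k ** g ** k \<in> GL_cong m"
proof -
  have "mcong m (matrix_inv k ** g ** k) (matrix_inv k ** mat 1 ** k)"
    using assms by (intro mcong_mult_right mcong_mult_left) (auto simp: GL_cong_iff GL_int_inverse)
  then show ?thesis
    using assms by (simp add: GL_cong_iff GL_int_mult GL_int_inverse)
qed

lemma e_last_mult: "e_last v* k = k $ last_index"
  by (simp add: e_last_def mat_1_entry[symmetric] flip: matrix_mult_row)

lemma GL_mirabolic_iff: "k \<in> GL_mirabolic \<longleftrightarrow> k \<in> GL_int \<and> e_last v* k = e_last"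
  by (simp add: GL_mirabolic_def e_last_mult)

lemma GL_subgroup_GL_mirabolic: "GL_subgroup GL_mirabolic"
  unfolding GL_subgroup_def
proof (intro conjI ballI)
  fix g :: "('a, 'b::{finite,linorder}) sqmat" assume "g \<in> GL_mirabolic"
  then show "matrix_inv g \<in> GL_mirabolic"
    using GL_int_vector_cancel(1)[of g e_last] by (simp add: GL_mirabolic_iff GL_int_inverse)
qed (auto simp: GL_mirabolic_iff GL_int_mult simp flip: vector_matrix_mul_assoc)

section \<open>The unit sphere of row vectors\<close>

lemma sphere_int_iff:
  fixes x :: "'a::nonarch_local_field ^ 'n::finite"
  shows "x \<in> sphere_int \<longleftrightarrow> (\<forall>i. absv (x $ i) \<le> 1) \<and> (\<exists>i. absv (x $ i) = 1)"
proof -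
  have "Max (range (\<lambda>i. absv (x $ i))) = 1 \<longleftrightarrow>
      1 \<in> range (\<lambda>i. absv (x $ i)) \<and> (\<forall>a\<in>range (\<lambda>i. absv (x $ i)). a \<le> 1)"
    by (rule Max_eq_iff) simp_all
  moreover have "1 \<in> range (\<lambda>i. absv (x $ i)) \<longleftrightarrow> (\<exists>i. absv (x $ i) = 1)"
    by (metis rangeE rangeI)
  ultimately show ?thesis
    by (simp add: sphere_int_def conj_commute)
qed

lemma sphere_int_mult:
  assumes "x \<in> sphere_int" "k \<in> GL_int"
  shows "x v* k \<in> sphere_int"
proof -
  have *: "absv ((x v* k) $ j) \<le> 1" for j
    using assms by (auto simp: vector_matrix_mult_def sphere_int_iff GL_int_entry
        intro!: absv_sum_le absv_mult_le)
  have "\<exists>j. \<not> absv ((x v* k) $ j) < 1"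
  proof (rule ccontr)
    assume "\<nexists>j. \<not> absv ((x v* k) $ j) < 1"
    \<comment> \<open>A vector without unit coordinates is zero modulo the maximal ideal;
      multiplying by the inverse matrix would make x zero there as well.\<close>
    then have "vcong 1 (x v* k) 0"
      by (auto simp: vcong_def intro: uniformiserD(2)[OF uniformiser_unif])
    then have "vcong 1 (x v* k v* matrix_inv k) (0 v* matrix_inv k)"
      using assms by (intro vcong_vector_matrix_mult GL_int_inverse)
    then have "vcong 1 x 0"
      using assms by (simp add: GL_int_vector_cancel)
    moreover obtain i where "absv (x $ i) = 1"
      using assms(1) by (auto simp: sphere_int_iff)
    ultimately have "1 \<le> absv (unif::'a)"
      unfolding vcong_def by (metis diff_zero power_one_right zero_index)
    then show False
      using absv_unif_less_1[where 'a='a] by linarith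
  qed
  then obtain j where "1 \<le> absv ((x v* k) $ j)"
    by (auto simp: not_less)
  with * have "absv ((x v* k) $ j) = 1"
    by (intro antisym) auto
  with * show ?thesis
    unfolding sphere_int_iff by blast
qed

lemma sphere_int_mult_iff: "k \<in> GL_int \<Longrightarrow> x v* k \<in> sphere_int \<longleftrightarrow> x \<in> sphere_int"
  using sphere_int_mult[of "x v* k" "matrix_inv k"]
  by (auto simp: GL_int_vector_cancel GL_int_inverse sphere_int_mult)

lemma e_last_sphere [simp]:
  "(e_last :: ('a::nonarch_local_field, 'b::{finite,linorder}) vec) \<in> sphere_int"
proof -
  have "absv ((e_last :: ('a, 'b) vec) $ i) \<le> 1" for i
    by (simp add: e_last_def axis_def)
  moreover have "absv ((e_last :: ('a, 'b) vec) $ last_index) = 1"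
    by (simp add: e_last_def axis_def)
  ultimately show ?thesis
    unfolding sphere_int_iff by blast
qed

lemma sphere_int_smult_iff:
  "absv a = 1 \<Longrightarrow> a *s x \<in> sphere_int \<longleftrightarrow> x \<in> sphere_int"
  by (simp add: sphere_int_iff absv_mult)

section \<open>Orbits of row vectors\<close>

text \<open>The identity with u added to row i. It moves x by \<open>(x $ i) *s u\<close>, so a
  large coordinate of x serves as a pivot for reaching nearby points.\<close>

definition row_add :: "'n::finite \<Rightarrow> ('a::nonarch_local_field, 'n) vec \<Rightarrow> ('a, 'n) sqmat" where
  "row_add i u = (\<chi> j. axis j 1 + (if j = i then u else 0))"

lemma vector_matrix_mult_row_add: "x v* row_add i u = x + (x $ i) *s u"
proof -
  have "(\<Sum>j\<in>UNIV. x $ j * row_add i u $ j $ l) = x $ l + x $ i * u $ l" for l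
  proof -
    have "(\<Sum>j\<in>UNIV. x $ j * row_add i u $ j $ l) =
        (\<Sum>j\<in>UNIV. if l = j then x $ j else 0) + (\<Sum>j\<in>UNIV. if j = i then x $ j * u $ l else 0)"
      unfolding sum.distrib[symmetric]
      by (intro sum.cong) (auto simp: row_add_def axis_def algebra_simps)
    then show ?thesis by simp
  qed
  then show ?thesis
    by (simp add: vec_eq_iff vector_matrix_mult_def)
qed

lemma row_add_mult: "row_add i u ** row_add i v = row_add i (u + (1 + u $ i) *s v)"
  by (simp add: vec_eq_iff matrix_mult_row vector_matrix_mult_row_add)
    (auto simp: row_add_def axis_def algebra_simps)

lemma row_add_0: "row_add i 0 = mat 1"
  by (simp add: vec_eq_iff row_add_def mat_1_entry)

lemma row_add_GL_int:
  assumes "\<And>l. absv (u $ l) \<le> 1" "absv (1 + u $ i) = 1"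
  shows "row_add i u \<in> GL_int"
proof -
  \<comment> \<open>The determinant is \<open>1 + u $ i\<close>; v solves the equation that makes
    the product in \<open>row_add_mult\<close> the identity.\<close>
  define v where "v = (- (1 / (1 + u $ i))) *s u"
  have nz: "1 + u $ i \<noteq> 0" using assms(2) by auto
  have entries: "absv (row_add i u $ j $ l) \<le> 1" if "\<And>l. absv (u $ l) \<le> 1" for u j l
    using that by (auto simp: row_add_def axis_def intro: absv_add_le)
  have "absv (v $ l) \<le> 1" for l
    using assms by (simp add: v_def absv_mult absv_divide)
  then have ent: "\<forall>j l. row_add i v $ j $ l \<in> int_ring" "\<forall>j l. row_add i u $ j $ l \<in> int_ring"
    unfolding int_ring_def by (intro allI CollectI entries; simp add: assms(1))+
  have "u + (1 + u $ i) *s v = 0"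
    using nz by (simp add: v_def vec_eq_iff)
  moreover have "v + (1 + v $ i) *s u = 0"
  proof -
    have "1 + v $ i = 1 / (1 + u $ i)"
      using nz by (simp add: v_def field_simps)
    then show ?thesis by (simp add: v_def vec_eq_iff)
  qed
  ultimately show ?thesis
    using ent unfolding GL_int_def
    by (intro CollectI conjI exI[of _ "row_add i v"]) (simp_all add: row_add_mult row_add_0)
qed

text \<open>The pivot forces \<open>u = (y - x) / x $ i\<close>. Equal sizes at i make the
  determinant a unit, and the bound c measures how close the matrix is to the identity.\<close>

lemma ex_row_add:
  assumes "x $ i \<noteq> 0" "absv (y $ i) = absv (x $ i)" "\<And>l. absv (y $ l - x $ l) \<le> c * absv (x $ i)" "c \<le> 1"
  shows "\<exists>u. row_add i u \<in> GL_int \<and> x v* row_add i u = y \<and> (\<forall>l. absv (u $ l) \<le> c)"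
proof (intro exI[of _ "(1 / x $ i) *s (y - x)"] conjI allI)
  show u: "absv (((1 / x $ i) *s (y - x)) $ l) \<le> c" for l
  proof -
    have "((1 / x $ i) *s (y - x)) $ l = (y $ l - x $ l) / x $ i"
      by (simp add: diff_divide_distrib)
    then show ?thesis
      using assms(1) assms(3)[of l] by (simp only: absv_divide) (simp add: pos_divide_le_eq)
  qed
  have "1 + ((1 / x $ i) *s (y - x)) $ i = y $ i / x $ i"
    using assms(1) by (simp add: field_simps)
  then have "absv (1 + ((1 / x $ i) *s (y - x)) $ i) = 1"
    using assms(1,2) by (simp add: absv_divide)
  then show "row_add i ((1 / x $ i) *s (y - x)) \<in> GL_int"
    using u assms(4) by (intro row_add_GL_int) (auto intro: order_trans)
  show "x v* row_add i ((1 / x $ i) *s (y - x)) = y"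
    using assms(1) by (simp add: vector_matrix_mult_row_add vec_eq_iff)
qed

text \<open>For \<open>I = UNIV\<close> and \<open>t = 1\<close> this is transitivity on the sphere; for \<open>I = - {last_index}\<close>
  it describes the orbits of the mirabolic group.\<close>

lemma ex_GL_int_transport:
  fixes x y :: "('a::nonarch_local_field, 'n::finite) vec"
  assumes "0 < t" "i \<in> I" "absv (x $ i) = t" "j \<in> I" "absv (y $ j) = t"
    and x: "\<And>l. l \<in> I \<Longrightarrow> absv (x $ l) \<le> t" and y: "\<And>l. l \<in> I \<Longrightarrow> absv (y $ l) \<le> t"
    and xy: "\<And>l. l \<notin> I \<Longrightarrow> absv (x $ l - y $ l) \<le> t"
  shows "\<exists>k\<in>GL_int. x v* k = y \<and> (\<forall>l. l \<notin> I \<longrightarrow> k $ l = axis l 1)"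
proof -
  \<comment> \<open>The pivots i and j may differ. The intermediate z has size t at both, so one row
    operation at i leads from x to z and one at j from z to y; rows outside I stay those of the
    identity.\<close>
  define z :: "('a, 'n) vec" where "z = (\<chi> l. if l \<in> I then x $ i else x $ l)"
  have "x $ i \<noteq> 0" "z $ j \<noteq> 0" "absv (z $ i) = t" "absv (z $ j) = t"
    using assms by (auto simp: z_def)
  moreover have "absv (z $ l - x $ l) \<le> t" for l
    using assms x by (auto simp: z_def intro: absv_diff_le)
  moreover have "absv (y $ l - z $ l) \<le> t" for l
    using assms y xy[of l] by (auto simp: z_def absv_minus_commute intro: absv_diff_le)
  ultimately obtain u v where u: "row_add i u \<in> GL_int" "x v* row_add i u = z"
    and v: "row_add j v \<in> GL_int" "z v* row_add j v = y"
    using ex_row_add[of x i z 1] ex_row_add[of z j y 1] assms by (auto simp: absv_minus_commute)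
  let ?k = "row_add i u ** row_add j v"
  have "?k $ l = axis l 1" if "l \<notin> I" for l
  proof -
    have "l \<noteq> i" "l \<noteq> j" using that assms by auto
    then show ?thesis
      by (auto simp: matrix_mult_row vector_matrix_mult_row_add) (auto simp: row_add_def axis_def)
  qed
  moreover have "?k \<in> GL_int" "x v* ?k = y"
    using u v by (simp_all add: GL_int_mult flip: vector_matrix_mul_assoc)
  ultimately show ?thesis by blast
qed

lemma sphere_int_transitive:
  assumes "x \<in> sphere_int" "y \<in> sphere_int"
  shows "\<exists>k\<in>GL_int. x v* k = y"
proof -
  obtain i j where "absv (x $ i) = 1" "absv (y $ j) = 1"
    using assms by (auto simp: sphere_int_iff)
  with ex_GL_int_transport[of 1 i UNIV x j y] show ?thesis
    using assms by (auto simp: sphere_int_iff)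
qed

text \<open>For \<open>m > 0\<close> a unit coordinate of x remains a unit in y, so one row
  operation at that pivot suffices. For \<open>m = 0\<close> this can fail, and transitivity of the
  full group takes over.\<close>

lemma GL_cong_transitive:
  fixes x y :: "('a::nonarch_local_field, 'n::finite) vec"
  assumes "x \<in> sphere_int" "y \<in> sphere_int" "vcong m x y"
  shows "\<exists>k\<in>GL_cong m. x v* k = y"
proof (cases "m = 0")
  case True
  with sphere_int_transitive[OF assms(1,2)] show ?thesis by (simp add: GL_cong_0)
next
  case False
  obtain i where i: "absv (x $ i) = 1"
    using assms by (auto simp: sphere_int_iff)
  have d: "absv (y $ l - x $ l) \<le> absv (unif::'a) ^ m" for l
    using assms(3) by (simp add: vcong_def absv_minus_commute)
  have "absv (y $ i - x $ i) < absv (x $ i)"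
    using d[of i] i absv_unif_power_less_1[of m, where 'a='a] False by linarith
  then have "absv (y $ i) = absv (x $ i)"
    by (rule absv_eq_of_diff_less)
  then obtain u where u: "row_add i u \<in> GL_int" "x v* row_add i u = y"
      "\<And>l. absv (u $ l) \<le> absv (unif::'a) ^ m"
  proof -
    have "x $ i \<noteq> 0" using i by auto
    then show thesis
      using that ex_row_add[of x i y "absv (unif::'a) ^ m"] d i \<open>absv (y $ i) = absv (x $ i)\<close>
      by auto
  qed
  have "mcong m (row_add i u) (mat 1)"
    using u(3) by (auto simp: mcong_def vcong_def row_add_def mat_1_entry)
  with u show ?thesis by (auto simp: GL_cong_iff)
qed

lemma GL_mirabolic_transitive:
  fixes x y :: "('a::nonarch_local_field, 'n::{finite,linorder}) vec"
  assumes "0 < t" "i \<noteq> last_index" "absv (x $ i) = t" "j \<noteq> last_index" "absv (y $ j) = t"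
    and "\<And>l. l \<noteq> last_index \<Longrightarrow> absv (x $ l) \<le> t" "\<And>l. l \<noteq> last_index \<Longrightarrow> absv (y $ l) \<le> t"
    and "absv (x $ last_index - y $ last_index) \<le> t"
  shows "\<exists>k\<in>GL_mirabolic. x v* k = y"
  using ex_GL_int_transport[of t i "- {last_index}" x j y] assms
  by (auto simp: GL_mirabolic_def e_last_def)


section \<open>Sums over coset representatives\<close>

text \<open>A choice per congruence class that works for any set of matrices, so sums over
  \<open>GL_int\<close>, \<open>GL_cong n\<close> and \<open>GL_mirabolic\<close> share one
  theory.\<close>

definition coset_rep :: "nat \<Rightarrow> ('a::nonarch_local_field, 'n::finite) sqmat set \<Rightarrow> ('a, 'n) sqmat \<Rightarrow> ('a, 'n) sqmat" where
  "coset_rep m G g = (SOME h. h \<in> G \<and> mcong m g h)"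

definition coset_reps :: "nat \<Rightarrow> ('a::nonarch_local_field, 'n::finite) sqmat set \<Rightarrow> ('a, 'n) sqmat set" where
  "coset_reps m G = coset_rep m G ` G"

lemma coset_rep:
  assumes "g \<in> G"
  shows "coset_rep m G g \<in> coset_reps m G" "coset_rep m G g \<in> G" "mcong m g (coset_rep m G g)"
proof -
  have "coset_rep m G g \<in> G \<and> mcong m g (coset_rep m G g)"
    unfolding coset_rep_def by (rule someI[of _ g]) (simp add: assms)
  then show "coset_rep m G g \<in> G" "mcong m g (coset_rep m G g)" by auto
  show "coset_rep m G g \<in> coset_reps m G" by (simp add: coset_reps_def assms)
qed

lemma coset_rep_cong:
  assumes "mcong m g h"
  shows "coset_rep m G g = coset_rep m G h"
proof -
  have "mcong m g x \<longleftrightarrow> mcong m h x" for x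
    using assms by (meson mcong_sym mcong_trans)
  then show ?thesis by (simp add: coset_rep_def)
qed

lemma coset_reps_subset: "coset_reps m G \<subseteq> G"
  using coset_rep(2)[of _ G m] by (auto simp: coset_reps_def)

lemma coset_reps_eqI:
  assumes "r \<in> coset_reps m G" "s \<in> coset_reps m G" "mcong m r s"
  shows "r = s"
proof -
  obtain g h where gh: "g \<in> G" "r = coset_rep m G g" "h \<in> G" "s = coset_rep m G h"
    using assms by (auto simp: coset_reps_def)
  then have "mcong m g r" "mcong m h s"
    using coset_rep(3)[of g G m] coset_rep(3)[of h G m] by auto
  with assms(3) have "mcong m g h"
    by (meson mcong_sym mcong_trans)
  with gh coset_rep_cong show ?thesis by blast
qed

text \<open>Each entry has finitely many residues, and the representative depends only on the
  residue pattern \<open>N g\<close>.\<close>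

lemma finite_coset_reps:
  fixes G :: "('a::nonarch_local_field, 'n::finite) sqmat set"
  assumes "G \<subseteq> GL_int"
  shows "finite (coset_reps m G)"
proof -
  obtain R :: "'a set" where R: "finite R" "\<And>x. absv x \<le> 1 \<Longrightarrow> \<exists>r\<in>R. absv (x - r) \<le> absv (unif::'a) ^ m"
    using ex_finite_residues[where 'a='a] by blast
  then obtain f where f: "\<And>x. absv x \<le> 1 \<Longrightarrow> f x \<in> R \<and> absv (x - f x) \<le> absv (unif::'a) ^ m"
    by metis
  define N where "N g = (\<lambda>p. f (g $ fst p $ snd p))" for g :: "('a, 'n) sqmat"
  have "N ` G \<subseteq> Pi\<^sub>E UNIV (\<lambda>_. R)"
    using assms f by (auto simp: N_def GL_int_entry subset_iff)
  then have fin: "finite (N ` G)"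
    by (rule finite_subset) (simp add: finite_PiE R(1))
  have "coset_rep m G g = coset_rep m G h" if "g \<in> G" "h \<in> G" "N g = N h" for g h
  proof (rule coset_rep_cong)
    have "f (g $ i $ j) = f (h $ i $ j)" for i j
      using fun_cong[OF that(3), of "(i, j)"] by (simp add: N_def)
    moreover have "absv (g $ i $ j - f (g $ i $ j)) \<le> absv (unif::'a) ^ m"
        "absv (h $ i $ j - f (h $ i $ j)) \<le> absv (unif::'a) ^ m" for i j
      using that assms f by (auto simp: GL_int_entry subset_iff)
    ultimately show "mcong m g h"
      unfolding mcong_def vcong_def by (metis absv_diff_trans absv_minus_commute)
  qed
  then have "coset_rep m G g = coset_rep m G (inv_into G N (N g))" if "g \<in> G" for g
    using that by (metis f_inv_into_f imageI inv_into_into)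
  then have "coset_reps m G \<subseteq> (\<lambda>n. coset_rep m G (inv_into G N n)) ` N ` G"
    unfolding coset_reps_def by blast
  then show ?thesis
    using fin by (meson finite_imageI finite_subset)
qed

lemma card_coset_reps_pos:
  assumes "GL_subgroup G"
  shows "0 < card (coset_reps m G)"
  using assms finite_coset_reps[of G m] coset_rep(1)[of "mat 1" G m]
  by (auto simp: GL_subgroup_def card_gt_0_iff)

text \<open>By \<open>pc\<close> the map p induces an injection on the finite set of
  representatives, hence a permutation; F does not notice the replacement of \<open>p r\<close> by
  its representative.\<close>

lemma sum_coset_reps_reindex:
  assumes "G \<subseteq> GL_int" and p: "\<And>g. g \<in> G \<Longrightarrow> p g \<in> G"
    and pc: "\<And>g h. g \<in> G \<Longrightarrow> h \<in> G \<Longrightarrow> mcong m (p g) (p h) \<Longrightarrow> mcong m g h"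
    and F: "\<And>g h. g \<in> G \<Longrightarrow> h \<in> G \<Longrightarrow> mcong m g h \<Longrightarrow> F g = F h"
  shows "(\<Sum>r\<in>coset_reps m G. F (p r)) = (\<Sum>r\<in>coset_reps m G. F r)"
proof -
  let ?R = "coset_reps m G" and ?s = "\<lambda>r. coset_rep m G (p r)"
  have RG: "r \<in> G" if "r \<in> ?R" for r
    using that coset_reps_subset by blast
  have "inj_on ?s ?R"
  proof (rule inj_onI)
    fix r r' assume r: "r \<in> ?R" "r' \<in> ?R" "?s r = ?s r'"
    then have "mcong m (p r) (p r')"
      using coset_rep(3)[of "p r" G m] coset_rep(3)[of "p r'" G m] RG p
      by (metis mcong_sym mcong_trans)
    then show "r = r'"
      using r pc RG by (intro coset_reps_eqI) auto
  qed
  moreover have "?s ` ?R \<subseteq> ?R"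
    using coset_rep(1) RG p by blast
  ultimately have "?s ` ?R = ?R" "inj_on ?s ?R"
    using endo_inj_surj[OF finite_coset_reps[OF assms(1)]] by auto
  then have "(\<Sum>r\<in>?R. F r) = (\<Sum>r\<in>?R. F (?s r))"
    by (metis (no_types, lifting) sum.reindex_cong)
  also have "\<dots> = (\<Sum>r\<in>?R. F (p r))"
    using RG p by (intro sum.cong refl F[symmetric] coset_rep) auto
  finally show ?thesis ..
qed

lemma sum_coset_reps_mult_left:
  assumes "GL_subgroup G" "h \<in> G"
    and "\<And>g g'. g \<in> G \<Longrightarrow> g' \<in> G \<Longrightarrow> mcong m g g' \<Longrightarrow> F g = F g'"
  shows "(\<Sum>r\<in>coset_reps m G. F (h ** r)) = (\<Sum>r\<in>coset_reps m G. F r)"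
proof (rule sum_coset_reps_reindex[where F = F])
  show G: "G \<subseteq> GL_int" "\<And>g. g \<in> G \<Longrightarrow> h ** g \<in> G"
    using assms(1,2) by (simp_all add: GL_subgroup_def)
  show "mcong m g g'" if "mcong m (h ** g) (h ** g')" for g g'
    using that G assms(2) by (simp add: mcong_mult_left_iff subset_iff)
qed (fact assms(3))

lemma sum_coset_reps_mult_right:
  assumes "GL_subgroup G" "h \<in> G"
    and "\<And>g g'. g \<in> G \<Longrightarrow> g' \<in> G \<Longrightarrow> mcong m g g' \<Longrightarrow> F g = F g'"
  shows "(\<Sum>r\<in>coset_reps m G. F (r ** h)) = (\<Sum>r\<in>coset_reps m G. F r)"
proof (rule sum_coset_reps_reindex[where F = F and p = "\<lambda>r. r ** h"])
  show G: "G \<subseteq> GL_int" "\<And>g. g \<in> G \<Longrightarrow> g ** h \<in> G"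
    using assms(1,2) by (simp_all add: GL_subgroup_def)
  show "mcong m g g'" if "mcong m (g ** h) (g' ** h)" for g g'
    using that G assms(2) by (simp add: mcong_mult_right_iff subset_iff)
qed (fact assms(3))


section \<open>The topology of the matrix group and the Haar integral\<close>

lemma vcong_dist_le:
  fixes x y :: "('a::nonarch_local_field, 'n::finite) vec"
  assumes "vcong m x y"
  shows "dist x y \<le> real CARD('n) * absv (unif::'a) ^ m"
proof -
  have "dist x y \<le> (\<Sum>i\<in>UNIV. dist (x $ i) (y $ i))"
    unfolding dist_vec_def by (rule L2_set_le_sum) simp
  also have "\<dots> \<le> (\<Sum>i\<in>(UNIV::'n set). absv (unif::'a) ^ m)"
    using assms by (intro sum_mono) (simp add: vcong_def dist_eq_absv)
  finally show ?thesis by simp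
qed

lemma mcong_dist_le:
  fixes k l :: "('a::nonarch_local_field, 'n::finite) sqmat"
  assumes "mcong m k l"
  shows "dist k l \<le> real CARD('n) * (real CARD('n) * absv (unif::'a) ^ m)"
proof -
  have "dist k l \<le> (\<Sum>i\<in>UNIV. dist (k $ i) (l $ i))"
    unfolding dist_vec_def[of k] by (rule L2_set_le_sum) simp
  also have "\<dots> \<le> (\<Sum>i\<in>(UNIV::'n set). real CARD('n) * absv (unif::'a) ^ m)"
    using assms by (intro sum_mono vcong_dist_le) (simp add: mcong_def)
  finally show ?thesis by simp
qed

lemma ex_mcong_dist_less:
  assumes "0 < e"
  shows "\<exists>m. \<forall>k l :: ('a::nonarch_local_field, 'n::finite) sqmat. mcong m k l \<longrightarrow> dist k l < e"
proof -
  let ?N = "real CARD('n) * real CARD('n)"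
  have "0 < ?N" by simp
  then obtain m where "absv (unif::'a) ^ m < e / ?N"
    using ex_absv_unif_power_less[of "e / ?N", where 'a='a] assms by (meson divide_pos_pos)
  then have "?N * absv (unif::'a) ^ m < e"
    using \<open>0 < ?N\<close> by (simp only: pos_less_divide_eq mult.commute)
  then have "dist k l < e" if "mcong m k l" for k l :: "('a, 'n) sqmat"
    using mcong_dist_le[OF that] by (simp add: mult.assoc)
  then show ?thesis by blast
qed

lemma dist_less_vcong:
  fixes x y :: "('a::nonarch_local_field, 'n::finite) vec"
  assumes "dist x y < absv (unif::'a) ^ m"
  shows "vcong m x y"
  unfolding vcong_def
proof
  fix i
  show "absv (x $ i - y $ i) \<le> absv (unif::'a) ^ m"
    using dist_vec_nth_le[of x i y] assms by (simp add: dist_eq_absv)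
qed

lemma dist_less_mcong:
  fixes k l :: "('a::nonarch_local_field, 'n::finite) sqmat"
  assumes "dist k l < absv (unif::'a) ^ m"
  shows "mcong m k l"
  unfolding mcong_def
proof
  fix i
  show "vcong m (k $ i) (l $ i)"
    using dist_vec_nth_le[of k i l] assms by (intro dist_less_vcong) simp
qed

text \<open>A ball of radius \<open>absv unif ^ m\<close> lies in one class. This supplies the
  measurability of the integrands.\<close>

lemma continuous_on_mcong_invariant:
  fixes F :: "('a::nonarch_local_field, 'n::finite) sqmat \<Rightarrow> 'b::metric_space"
  assumes "\<And>g h. g \<in> G \<Longrightarrow> h \<in> G \<Longrightarrow> mcong m g h \<Longrightarrow> F g = F h"
  shows "continuous_on G F"
  unfolding continuous_on_iff
proof (intro ballI allI impI)
  fix x e assume "x \<in> G" "0 < (e::real)"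
  then have "dist (F x') (F x) < e" if "x' \<in> G" "dist x' x < absv (unif::'a) ^ m" for x'
    using assms[OF that(1) \<open>x \<in> G\<close> dist_less_mcong[OF that(2)]] by simp
  then show "\<exists>d>0. \<forall>x'\<in>G. dist x' x < d \<longrightarrow> dist (F x') (F x) < e"
    by (intro exI[of _ "absv (unif::'a) ^ m"]) (simp add: unif_nonzero)
qed

lemma continuous_on_mult_right:
  fixes k :: "('a::nonarch_local_field, 'n::finite) sqmat" and G :: "('a, 'n) sqmat set"
  assumes "k \<in> GL_int"
  shows "continuous_on G (\<lambda>x. x ** k)"
  unfolding continuous_on_iff
proof (intro ballI allI impI)
  fix x :: "('a, 'n) sqmat" and e :: real assume "0 < e"
  then obtain m where m: "\<And>k l :: ('a, 'n) sqmat. mcong m k l \<Longrightarrow> dist k l < e"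
    using ex_mcong_dist_less by blast
  have "dist (x' ** k) (x ** k) < e" if "dist x' x < absv (unif::'a) ^ m" for x'
    by (intro m mcong_mult_right dist_less_mcong that assms)
  then show "\<exists>d>0. \<forall>x'\<in>G. dist x' x < d \<longrightarrow> dist (x' ** k) (x ** k) < e"
    by (intro exI[of _ "absv (unif::'a) ^ m"]) (simp add: unif_nonzero)
qed

text \<open>Averaging over right translates by the representatives leaves the integral unchanged but
  turns the integrand into a constant; the measure of a coset is never computed.\<close>

lemma haar_integral_coset_reps:
  fixes dk :: "('a::nonarch_local_field, 'n::finite) sqmat measure" and F :: "_ \<Rightarrow> complex"
  assumes dk: "haar_prob_measure dk"
    and F: "\<And>g h. g \<in> GL_int \<Longrightarrow> h \<in> GL_int \<Longrightarrow> mcong m g h \<Longrightarrow> F g = F h"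
  shows "of_nat (card (coset_reps m (GL_int :: ('a, 'n) sqmat set))) * (\<integral>k. F k \<partial>dk) = (\<Sum>r\<in>coset_reps m GL_int. F r)"
proof -
  interpret prob_space dk using dk by (simp add: haar_prob_measure_def)
  let ?R = "coset_reps m (GL_int :: ('a, 'n) sqmat set)"
  have sets: "sets dk = sets (restrict_space borel GL_int)"
    using dk by (simp add: haar_prob_measure_def)
  have space: "space dk = GL_int"
    using sets_eq_imp_space_eq[OF sets] by (simp add: space_restrict_space)
  have meas: "f \<in> borel_measurable dk"
    if "continuous_on GL_int f" for f :: "('a, 'n) sqmat \<Rightarrow> 'c::topological_space"
    using borel_measurable_continuous_on_restrict[OF that] measurable_cong_sets[OF sets refl] by blast
  have RG: "r \<in> GL_int" if "r \<in> ?R" for r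
    using that coset_reps_subset by blast
  have Fm: "F \<in> borel_measurable dk"
    using F by (intro meas continuous_on_mcong_invariant)
  have mult_meas: "(\<lambda>x. x ** r) \<in> measurable dk dk" if "r \<in> GL_int" for r
  proof -
    have "(\<lambda>x. x ** r) \<in> measurable dk (restrict_space borel GL_int)"
      using that by (intro measurable_restrict_space2 meas continuous_on_mult_right)
        (auto simp: space GL_int_mult)
    then show ?thesis
      using measurable_cong_sets[OF refl sets] by blast
  qed
  have int_eq: "(\<integral>x. F (x ** r) \<partial>dk) = (\<integral>x. F x \<partial>dk)" if "r \<in> GL_int" for r
  proof -
    have "(\<integral>x. F x \<partial>dk) = (\<integral>x. F x \<partial>distr dk dk (\<lambda>x. x ** r))"
      using dk that by (simp add: haar_prob_measure_def)
    also have "\<dots> = (\<integral>x. F (x ** r) \<partial>dk)"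
      by (rule integral_distr[OF mult_meas[OF that] Fm])
    finally show ?thesis ..
  qed
  have integrable: "integrable dk F"
  proof (rule integrable_const_bound[OF _ Fm])
    \<comment> \<open>F takes only the finitely many values at the representatives.\<close>
    have "norm (F x) \<le> (\<Sum>r\<in>?R. norm (F r))" if "x \<in> GL_int" for x
    proof -
      have "F x = F (coset_rep m GL_int x)"
        using that by (intro F coset_rep)
      then show ?thesis
        using member_le_sum[of "coset_rep m GL_int x" ?R "\<lambda>r. norm (F r)"] coset_rep(1)[OF that]
          finite_coset_reps[of GL_int m] by simp
    qed
    then show "AE x in dk. norm (F x) \<le> (\<Sum>r\<in>?R. norm (F r))"
      by (intro AE_I2) (simp add: space)
  qed
  have integrable_r: "integrable dk (\<lambda>x. F (x ** r))" if "r \<in> GL_int" for r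
  proof -
    have "integrable (distr dk dk (\<lambda>x. x ** r)) F"
      using dk that integrable by (simp add: haar_prob_measure_def)
    then show ?thesis
      by (rule integrable_distr[OF mult_meas[OF that]])
  qed
  have "of_nat (card ?R) * (\<integral>k. F k \<partial>dk) = (\<Sum>r\<in>?R. \<integral>x. F (x ** r) \<partial>dk)"
    using RG by (simp add: int_eq)
  also have "\<dots> = (\<integral>x. (\<Sum>r\<in>?R. F (x ** r)) \<partial>dk)"
    using RG by (intro Bochner_Integration.integral_sum[symmetric] integrable_r)
  \<comment> \<open>Left multiplication by a fixed x permutes the classes, so the inner sum does not
    depend on x.\<close>
  also have "\<dots> = (\<integral>x. (\<Sum>r\<in>?R. F r) \<partial>dk)"
    by (intro Bochner_Integration.integral_cong refl sum_coset_reps_mult_left F GL_subgroup_GL_int)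
      (simp add: space)
  also have "\<dots> = (\<Sum>r\<in>?R. F r)"
    by (simp add: prob_space)
  finally show ?thesis .
qed

section \<open>Functions of given level and central character\<close>

text \<open>By \<open>GL_cong_transitive\<close> the orbits of \<open>GL_cong m\<close> on the
  sphere are the congruence classes, so invariance becomes a condition on points, and it implies
  local constancy.\<close>

lemma smooth_fun_level_iff:
  fixes f :: "('a::nonarch_local_field, 'n::finite) vec \<Rightarrow> complex"
  shows "f \<in> smooth_fun_level \<psi> m \<longleftrightarrow> (\<forall>x. x \<notin> sphere_int \<longrightarrow> f x = 0) \<and>
    (\<forall>x\<in>sphere_int. \<forall>y\<in>sphere_int. vcong m x y \<longrightarrow> f x = f y) \<and>
    (\<forall>x\<in>sphere_int. \<forall>a. absv a = 1 \<longrightarrow> f (a *s x) = \<psi> a * f x)" (is "?L \<longleftrightarrow> ?R")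
proof
  assume L: ?L
  have "f x = f y" if "x \<in> sphere_int" "y \<in> sphere_int" "vcong m x y" for x y
    using GL_cong_transitive[OF that] L that(1) by (auto simp: smooth_fun_level_def)
  moreover have "\<forall>x. x \<notin> sphere_int \<longrightarrow> f x = 0"
    and "\<forall>x\<in>sphere_int. \<forall>a. absv a = 1 \<longrightarrow> f (a *s x) = \<psi> a * f x"
    using L by (simp_all add: smooth_fun_level_def smooth_fun_def int_units_iff)
  ultimately show ?R by blast
next
  assume R: ?R
  have "f (x v* k) = f x" if "x \<in> sphere_int" "k \<in> GL_cong m" for x k
  proof -
    have "vcong m (x v* k) (x v* mat 1)"
      using that by (intro vcong_vector_matrix_mult_right) (simp_all add: sphere_int_iff GL_cong_iff)
    then have "vcong m (x v* k) x" by simp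
    moreover have "x v* k \<in> sphere_int"
      using that by (simp add: GL_cong_iff sphere_int_mult)
    ultimately show ?thesis using R that(1) by blast
  qed
  moreover have "\<exists>U. open U \<and> x \<in> U \<and> (\<forall>y\<in>U \<inter> sphere_int. f y = f x)" if "x \<in> sphere_int" for x
  proof (intro exI[of _ "ball x (absv (unif::'a) ^ m)"] conjI ballI)
    fix y assume y: "y \<in> ball x (absv (unif::'a) ^ m) \<inter> sphere_int"
    then have "vcong m x y"
      by (intro dist_less_vcong) simp
    moreover have "y \<in> sphere_int" using y by simp
    ultimately show "f y = f x" using R that by metis
  qed (simp_all add: unif_nonzero)
  moreover have "\<forall>x. x \<notin> sphere_int \<longrightarrow> f x = 0"
    and "\<forall>x\<in>sphere_int. \<forall>a. absv a = 1 \<longrightarrow> f (a *s x) = \<psi> a * f x"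
    using R by blast+
  ultimately show ?L
    by (simp add: smooth_fun_level_def smooth_fun_def int_units_iff)
qed

lemma smooth_fun_level_outside: "f \<in> smooth_fun_level \<psi> m \<Longrightarrow> x \<notin> sphere_int \<Longrightarrow> f x = 0"
  unfolding smooth_fun_level_iff by blast

lemma smooth_fun_level_cong:
  "f \<in> smooth_fun_level \<psi> m \<Longrightarrow> x \<in> sphere_int \<Longrightarrow> y \<in> sphere_int \<Longrightarrow> vcong m x y \<Longrightarrow> f x = f y"
  unfolding smooth_fun_level_iff by blast

lemma smooth_fun_level_smult:
  "f \<in> smooth_fun_level \<psi> m \<Longrightarrow> x \<in> sphere_int \<Longrightarrow> absv a = 1 \<Longrightarrow> f (a *s x) = \<psi> a * f x"
  unfolding smooth_fun_level_iff by blast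

lemma smooth_fun_level_mono:
  "f \<in> smooth_fun_level \<psi> m \<Longrightarrow> m \<le> n \<Longrightarrow> f \<in> smooth_fun_level \<psi> n"
  unfolding smooth_fun_level_iff using vcong_mono by blast

lemma smooth_fun_level_translate:
  fixes f :: "('a::nonarch_local_field, 'n::finite) vec \<Rightarrow> complex"
  assumes "f \<in> smooth_fun_level \<psi> m" "k \<in> GL_int"
  shows "(\<lambda>x. f (x v* k)) \<in> smooth_fun_level \<psi> m"
proof -
  have "(a *s x) v* k = a *s (x v* k)" for a and x :: "('a, 'n) vec"
    by (simp add: vec_eq_iff vector_matrix_mult_def sum_distrib_left mult.assoc)
  then show ?thesis
    using assms unfolding smooth_fun_level_iff
    by (simp add: sphere_int_mult_iff vcong_vector_matrix_mult)
qed

lemma smooth_fun_level_sum: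
  assumes "\<And>i. i \<in> A \<Longrightarrow> f i \<in> smooth_fun_level \<psi> m"
  shows "(\<lambda>x. \<Sum>i\<in>A. f i x) \<in> smooth_fun_level \<psi> m"
  unfolding smooth_fun_level_iff
proof (intro conjI allI ballI impI)
  show "(\<Sum>i\<in>A. f i x) = 0" if "x \<notin> sphere_int" for x
    by (intro sum.neutral ballI smooth_fun_level_outside[OF assms] that)
  show "(\<Sum>i\<in>A. f i x) = (\<Sum>i\<in>A. f i y)" if "x \<in> sphere_int" "y \<in> sphere_int" "vcong m x y" for x y
    by (intro sum.cong refl smooth_fun_level_cong[OF assms] that)
  show "(\<Sum>i\<in>A. f i (a *s x)) = \<psi> a * (\<Sum>i\<in>A. f i x)" if "x \<in> sphere_int" "absv a = 1" for a x
    unfolding sum_distrib_left by (intro sum.cong refl smooth_fun_level_smult[OF assms] that)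
qed

lemma smooth_fun_level_scale:
  assumes "f \<in> smooth_fun_level \<psi> m"
  shows "(\<lambda>x. c * f x) \<in> smooth_fun_level \<psi> m"
  unfolding smooth_fun_level_iff
proof (intro conjI allI ballI impI)
  show "c * f x = 0" if "x \<notin> sphere_int" for x
    using smooth_fun_level_outside[OF assms that] by simp
  show "c * f x = c * f y" if "x \<in> sphere_int" "y \<in> sphere_int" "vcong m x y" for x y
    using smooth_fun_level_cong[OF assms that] by simp
  show "c * f (a *s x) = \<psi> a * (c * f x)" if "x \<in> sphere_int" "absv a = 1" for a x
    using smooth_fun_level_smult[OF assms that] by simp
qed

lemma smooth_fun_level_diff:
  assumes "f \<in> smooth_fun_level \<psi> m" "g \<in> smooth_fun_level \<psi> m"
  shows "(\<lambda>x. f x - g x) \<in> smooth_fun_level \<psi> m"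
proof -
  \<comment> \<open>The difference as a two-term sum indexed by \<open>bool\<close>.\<close>
  have "(\<lambda>x. \<Sum>b\<in>UNIV. if b then f x else - 1 * g x) \<in> smooth_fun_level \<psi> m"
  proof (rule smooth_fun_level_sum)
    fix b show "(\<lambda>x. if b then f x else - 1 * g x) \<in> smooth_fun_level \<psi> m"
      using smooth_fun_level_scale[OF assms(2), of "- 1"] assms(1) by (cases b) simp_all
  qed
  then show ?thesis
    by (simp add: UNIV_bool)
qed

lemma smooth_fun_level_mcong:
  fixes f :: "('a::nonarch_local_field, 'n::finite) vec \<Rightarrow> complex"
  assumes "f \<in> smooth_fun_level \<psi> m" "g \<in> GL_int" "h \<in> GL_int" "mcong m g h"
  shows "f (x v* g) = f (x v* h)"
proof (cases "x \<in> sphere_int")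
  case True
  then have "vcong m (x v* g) (x v* h)"
    by (intro vcong_vector_matrix_mult_right assms) (simp add: sphere_int_iff)
  then show ?thesis
    by (intro smooth_fun_level_cong[OF assms(1)] sphere_int_mult True assms)
next
  case False
  then show ?thesis
    using assms by (simp add: smooth_fun_level_outside sphere_int_mult_iff)
qed

lemma smooth_fun_level_invariant:
  assumes "f \<in> smooth_fun_level \<psi> m" "k \<in> GL_cong m"
  shows "f (x v* k) = f x"
  using smooth_fun_level_mcong[OF assms(1), of k "mat 1" x] assms(2) by (simp add: GL_cong_iff)

text \<open>The average over G up to the factor \<open>card (coset_reps m G)\<close>. For G inside
  \<open>GL_int\<close> and f of level m the choice of representatives does not matter.\<close>

definition coset_sum :: "nat \<Rightarrow> ('a::nonarch_local_field, 'n::finite) sqmat set \<Rightarrow>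
    (('a, 'n) vec \<Rightarrow> complex) \<Rightarrow> ('a, 'n) vec \<Rightarrow> complex" where
  "coset_sum m G f x = (\<Sum>r\<in>coset_reps m G. f (x v* r))"

lemma coset_sum_level:
  assumes "G \<subseteq> GL_int" "f \<in> smooth_fun_level \<psi> m"
  shows "coset_sum m G f \<in> smooth_fun_level \<psi> m"
proof -
  have "(\<lambda>x. \<Sum>r\<in>coset_reps m G. f (x v* r)) \<in> smooth_fun_level \<psi> m"
    using coset_reps_subset[of m G] assms
    by (intro smooth_fun_level_sum smooth_fun_level_translate) auto
  then show ?thesis
    by (simp add: coset_sum_def[abs_def])
qed

lemma coset_sum_invariant:
  assumes "GL_subgroup G" "f \<in> smooth_fun_level \<psi> m" "g \<in> G"
  shows "coset_sum m G f (x v* g) = coset_sum m G f x"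
proof -
  have "(\<Sum>r\<in>coset_reps m G. f (x v* (g ** r))) = (\<Sum>r\<in>coset_reps m G. f (x v* r))"
  proof (rule sum_coset_reps_mult_left[OF assms(1,3)])
    show "f (x v* g) = f (x v* g')" if "g \<in> G" "g' \<in> G" "mcong m g g'" for g g'
      using that assms(1) by (intro smooth_fun_level_mcong[OF assms(2)]) (auto simp: GL_subgroup_def)
  qed
  then show ?thesis
    by (simp add: coset_sum_def vector_matrix_mul_assoc)
qed

lemma coset_sum_of_invariant:
  assumes "\<And>g. g \<in> G \<Longrightarrow> f (x v* g) = f x"
  shows "coset_sum m G f x = of_nat (card (coset_reps m G)) * f x"
  using coset_reps_subset[of m G] assms unfolding coset_sum_def
  by (subst sum.cong[OF refl, of _ _ "\<lambda>_. f x"]) auto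

lemma coset_sum_translate:
  assumes "GL_subgroup G" "f \<in> smooth_fun_level \<psi> m" "k \<in> GL_int"
    and conj: "\<And>g. g \<in> G \<Longrightarrow> matrix_inv k ** g ** k \<in> G"
  shows "coset_sum m G (\<lambda>x. f (x v* k)) x = coset_sum m G f (x v* k)"
proof -
  have G: "G \<subseteq> GL_int" using assms(1) by (simp add: GL_subgroup_def)
  have "(\<Sum>r\<in>coset_reps m G. f (x v* (k ** (matrix_inv k ** r ** k)))) =
      (\<Sum>r\<in>coset_reps m G. f (x v* (k ** r)))"
  proof (rule sum_coset_reps_reindex[OF G conj, where F = "\<lambda>g. f (x v* (k ** g))"])
    show "mcong m g h" if "mcong m (matrix_inv k ** g ** k) (matrix_inv k ** h ** k)" for g h
      using that assms(3) by (simp add: mcong_mult_left_iff mcong_mult_right_iff GL_int_inverse)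
    show "f (x v* (k ** g)) = f (x v* (k ** h))" if "g \<in> G" "h \<in> G" "mcong m g h" for g h
      using that G assms(3)
      by (intro smooth_fun_level_mcong[OF assms(2)]) (auto simp: GL_int_mult mcong_mult_left)
  qed
  then show ?thesis
    using assms(3)
    by (simp add: coset_sum_def vector_matrix_mul_assoc GL_int_inverse_cancel GL_int_inverse matrix_mul_assoc)
qed

lemma coset_sum_scale: "coset_sum m G (\<lambda>x. c * f x) x = c * coset_sum m G f x"
  by (simp add: coset_sum_def sum_distrib_left)

lemma coset_sum_diff: "coset_sum m G (\<lambda>x. f x - g x) x = coset_sum m G f x - coset_sum m G g x"
  by (simp add: coset_sum_def sum_subtractf)

lemma coset_sum_GL_cong_level:
  fixes f :: "('a::nonarch_local_field, 'n::finite) vec \<Rightarrow> complex"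
  assumes "f \<in> smooth_fun_level \<psi> m"
  shows "coset_sum m (GL_cong n) f \<in> smooth_fun_level \<psi> n"
proof -
  have "coset_sum m (GL_cong n) f \<in> smooth_fun_level \<psi> m"
    using assms by (intro coset_sum_level) (auto simp: GL_cong_iff)
  then show ?thesis
    using coset_sum_invariant[OF GL_subgroup_GL_cong assms, of _ n]
    by (simp add: smooth_fun_level_def)
qed


section \<open>Harmonic spaces\<close>

text \<open>The inner product on functions of level m, up to the number of classes and with the
  measure removed.\<close>

abbreviation level_pairing :: "nat \<Rightarrow> (('a::nonarch_local_field, 'n::{finite,linorder}) vec \<Rightarrow> complex)
    \<Rightarrow> (('a, 'n) vec \<Rightarrow> complex) \<Rightarrow> complex" where
  "level_pairing m f g \<equiv> (\<Sum>r\<in>coset_reps m GL_int. f (e_last v* r) * cnj (g (e_last v* r)))"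

lemma smooth_fun_inner_eq_level_pairing:
  fixes dk :: "('a::nonarch_local_field, 'n::{finite,linorder}) sqmat measure"
  assumes "haar_prob_measure dk" "f \<in> smooth_fun_level \<psi> m" "g \<in> smooth_fun_level \<psi> m"
  shows "of_nat (card (coset_reps m (GL_int :: ('a, 'n) sqmat set))) * smooth_fun_inner dk f g = level_pairing m f g"
  unfolding smooth_fun_inner_def
proof (rule haar_integral_coset_reps[OF assms(1)])
  show "f (e_last v* k) * cnj (g (e_last v* k)) = f (e_last v* l) * cnj (g (e_last v* l))"
    if "k \<in> GL_int" "l \<in> GL_int" "mcong m k l" for k l
    using smooth_fun_level_mcong[OF assms(2) that] smooth_fun_level_mcong[OF assms(3) that] by simp
qed

text \<open>Averaging is self-adjoint up to its factor: a translation by k in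
  \<open>GL_cong n\<close> can be inserted into g, and then \<open>r ** k\<close> runs through the
  same classes as r, so every k contributes the same pairing.\<close>

lemma level_pairing_coset_sum:
  fixes f g :: "('a::nonarch_local_field, 'n::{finite,linorder}) vec \<Rightarrow> complex"
  assumes f: "f \<in> smooth_fun_level \<psi> m" and g: "g \<in> smooth_fun_level \<psi> n" and "n \<le> m"
  shows "level_pairing m (coset_sum m (GL_cong n) f) g =
    of_nat (card (coset_reps m (GL_cong n :: ('a, 'n) sqmat set))) * level_pairing m f g"
proof -
  let ?C = "coset_reps m (GL_cong n :: ('a, 'n) sqmat set)"
  have C: "k \<in> GL_cong n" "k \<in> GL_int" if "k \<in> ?C" for k
    using that coset_reps_subset[of m "GL_cong n"] by (auto simp: GL_cong_iff)
  have gm: "g \<in> smooth_fun_level \<psi> m"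
    using g \<open>n \<le> m\<close> by (rule smooth_fun_level_mono)
  have "level_pairing m (coset_sum m (GL_cong n) f) g =
      (\<Sum>k\<in>?C. \<Sum>r\<in>coset_reps m GL_int. f (e_last v* r v* k) * cnj (g (e_last v* r)))"
    by (subst sum.swap) (simp add: coset_sum_def sum_distrib_right)
  also have "\<dots> = (\<Sum>k\<in>?C. \<Sum>r\<in>coset_reps m GL_int. f (e_last v* (r ** k)) * cnj (g (e_last v* (r ** k))))"
  proof (intro sum.cong refl)
    fix k r assume "k \<in> ?C"
    then have "g (e_last v* r v* k) = g (e_last v* r)"
      by (intro smooth_fun_level_invariant[OF g] C)
    then show "f (e_last v* r v* k) * cnj (g (e_last v* r)) =
        f (e_last v* (r ** k)) * cnj (g (e_last v* (r ** k)))"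
      by (simp add: vector_matrix_mul_assoc)
  qed
  also have "\<dots> = (\<Sum>k\<in>?C. level_pairing m f g)"
  proof (rule sum.cong[OF refl])
    fix k assume "k \<in> ?C"
    have "f (e_last v* h) * cnj (g (e_last v* h)) = f (e_last v* l) * cnj (g (e_last v* l))"
      if "h \<in> GL_int" "l \<in> GL_int" "mcong m h l" for h l
      using smooth_fun_level_mcong[OF f that] smooth_fun_level_mcong[OF gm that] by simp
    then show "(\<Sum>r\<in>coset_reps m GL_int. f (e_last v* (r ** k)) * cnj (g (e_last v* (r ** k)))) =
        level_pairing m f g"
      by (rule sum_coset_reps_mult_right[OF GL_subgroup_GL_int C(2)[OF \<open>k \<in> ?C\<close>]])
  qed
  finally show ?thesis by simp
qed

text \<open>A vanishing sum of squared moduli kills f at all representatives; transitivity and the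
  level spread this over the sphere.\<close>

lemma level_pairing_self_eq_0:
  assumes f: "f \<in> smooth_fun_level \<psi> m" and "level_pairing m f f = 0"
  shows "f x = 0"
proof (cases "x \<in> sphere_int")
  case True
  have "(\<Sum>r\<in>coset_reps m GL_int. (cmod (f (e_last v* r)))\<^sup>2) = 0"
  proof -
    have "complex_of_real (\<Sum>r\<in>coset_reps m GL_int. (cmod (f (e_last v* r)))\<^sup>2) = 0"
      using assms(2) by (simp only: of_real_sum complex_norm_square)
    then show ?thesis by (simp only: of_real_eq_0_iff)
  qed
  then have z: "f (e_last v* r) = 0" if "r \<in> coset_reps m GL_int" for r
    using that by (subst (asm) sum_nonneg_eq_0_iff) (simp_all add: finite_coset_reps)
  obtain k where k: "k \<in> GL_int" "e_last v* k = x"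
    using sphere_int_transitive[OF e_last_sphere True] by blast
  have "f (e_last v* k) = f (e_last v* coset_rep m GL_int k)"
    using k by (intro smooth_fun_level_mcong[OF f] coset_rep)
  also have "\<dots> = 0"
    using k by (intro z coset_rep)
  finally show ?thesis using k by simp
qed (rule smooth_fun_level_outside[OF f])

text \<open>Averaging over \<open>GL_cong (m - 1)\<close> is the orthogonal projection onto the functions of level
  \<open>m - 1\<close>.\<close>

lemma harmonic_space_iff:
  fixes dk :: "('a::nonarch_local_field, 'n::{finite,linorder}) sqmat measure"
  assumes "haar_prob_measure dk"
  shows "f \<in> harmonic_space dk \<psi> m \<longleftrightarrow> f \<in> smooth_fun_level \<psi> m \<and>
    (m \<noteq> conductor_exp \<psi> \<longrightarrow> (\<forall>x. coset_sum m (GL_cong (m - 1)) f x = 0))"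
proof -
  let ?P = "coset_sum m (GL_cong (m - 1)) f"
  have "(\<forall>g\<in>smooth_fun_level \<psi> (m - 1). smooth_fun_inner dk f g = 0) \<longleftrightarrow> (\<forall>x. ?P x = 0)"
    if f: "f \<in> smooth_fun_level \<psi> m"
  proof -
    have inner: "smooth_fun_inner dk f g = 0 \<longleftrightarrow> level_pairing m ?P g = 0"
      if g: "g \<in> smooth_fun_level \<psi> (m - 1)" for g
    proof -
      have "g \<in> smooth_fun_level \<psi> m"
        using g by (rule smooth_fun_level_mono) simp
      then show ?thesis
        using smooth_fun_inner_eq_level_pairing[OF assms f, of g, symmetric] level_pairing_coset_sum[OF f g]
          card_coset_reps_pos[OF GL_subgroup_GL_int, of m, where 'a='a and 'b='n]
          card_coset_reps_pos[OF GL_subgroup_GL_cong, of m "m - 1", where 'a='a and 'b='n]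
        by simp
    qed
    have P: "?P \<in> smooth_fun_level \<psi> (m - 1)" "?P \<in> smooth_fun_level \<psi> m"
      using coset_sum_GL_cong_level[OF f] smooth_fun_level_mono[OF coset_sum_GL_cong_level[OF f], of "m - 1" m]
      by simp_all
    show ?thesis
    proof
      assume "\<forall>g\<in>smooth_fun_level \<psi> (m - 1). smooth_fun_inner dk f g = 0"
      \<comment> \<open>The average itself has level \<open>m - 1\<close>, so it is an admissible
        test function.\<close>
      then have "level_pairing m ?P ?P = 0"
        using inner P by blast
      then show "\<forall>x. ?P x = 0"
        using level_pairing_self_eq_0[OF P(2)] by blast
    next
      assume "\<forall>x. ?P x = 0"
      then show "\<forall>g\<in>smooth_fun_level \<psi> (m - 1). smooth_fun_inner dk f g = 0"
        by (simp add: inner)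
    qed
  qed
  then show ?thesis
    by (auto simp: harmonic_space_def)
qed

lemma harmonic_space_level:
  "haar_prob_measure dk \<Longrightarrow> f \<in> harmonic_space dk \<psi> m \<Longrightarrow> f \<in> smooth_fun_level \<psi> m"
  by (simp add: harmonic_space_iff)

lemma harmonic_space_scale:
  "haar_prob_measure dk \<Longrightarrow> f \<in> harmonic_space dk \<psi> m \<Longrightarrow> (\<lambda>x. c * f x) \<in> harmonic_space dk \<psi> m"
  by (simp add: harmonic_space_iff smooth_fun_level_scale coset_sum_scale)

lemma harmonic_space_diff:
  "haar_prob_measure dk \<Longrightarrow> f \<in> harmonic_space dk \<psi> m \<Longrightarrow> g \<in> harmonic_space dk \<psi> m \<Longrightarrow>
    (\<lambda>x. f x - g x) \<in> harmonic_space dk \<psi> m"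
  by (simp add: harmonic_space_iff smooth_fun_level_diff coset_sum_diff)

lemma harmonic_space_translate:
  assumes "haar_prob_measure dk" "f \<in> harmonic_space dk \<psi> m" "k \<in> GL_int"
  shows "(\<lambda>x. f (x v* k)) \<in> harmonic_space dk \<psi> m"
  using assms coset_sum_translate[OF GL_subgroup_GL_cong harmonic_space_level[OF assms(1,2)] assms(3), of "m - 1"]
  by (simp add: harmonic_space_iff smooth_fun_level_translate GL_cong_conj)

lemma harmonic_space_sum:
  assumes "haar_prob_measure dk" "\<And>i. i \<in> A \<Longrightarrow> f i \<in> harmonic_space dk \<psi> m"
  shows "(\<lambda>x. \<Sum>i\<in>A. f i x) \<in> harmonic_space dk \<psi> m"
proof -
  have "coset_sum m G (\<lambda>x. \<Sum>i\<in>A. f i x) x = (\<Sum>i\<in>A. coset_sum m G (f i) x)" for G x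
    unfolding coset_sum_def by (rule sum.swap)
  then show ?thesis
    using assms by (simp add: harmonic_space_iff smooth_fun_level_sum)
qed

section \<open>Characters of the unit group\<close>

lemma unit_character_mult:
  "unit_character \<psi> \<Longrightarrow> absv a = 1 \<Longrightarrow> absv b = 1 \<Longrightarrow> \<psi> (a * b) = \<psi> a * \<psi> b"
  by (simp add: unit_character_def int_units_iff)

lemma unit_character_nonzero: "unit_character \<psi> \<Longrightarrow> absv a = 1 \<Longrightarrow> \<psi> a \<noteq> 0"
  by (simp add: unit_character_def int_units_iff)

lemma unit_character_1: "unit_character \<psi> \<Longrightarrow> \<psi> 1 = 1"
  using unit_character_mult[of \<psi> 1 1] unit_character_nonzero[of \<psi> 1] by simp

lemma unit_character_power:
  assumes "unit_character \<psi>" "absv a = 1"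
  shows "\<psi> (a ^ n) = \<psi> a ^ n"
proof (induction n)
  case (Suc n)
  have "absv (a ^ n) = 1" by (simp add: absv_power assms(2))
  with Suc assms show ?case by (simp add: unit_character_mult)
qed (simp add: unit_character_1 assms)

text \<open>Merges both branches of \<open>conductor_exp\<close>: for \<open>m = 0\<close> the
  congruence holds for every unit, and for \<open>m > 0\<close> it forces a to be a unit.\<close>

definition trivial_on_level :: "('a::nonarch_local_field \<Rightarrow> complex) \<Rightarrow> nat \<Rightarrow> bool" where
  "trivial_on_level \<psi> m \<longleftrightarrow> (\<forall>a. absv a = 1 \<and> absv (a - 1) \<le> absv (unif::'a) ^ m \<longrightarrow> \<psi> a = 1)"

lemma conductor_exp_eq: "conductor_exp \<psi> = (LEAST m. trivial_on_level \<psi> m)"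
proof -
  have "(\<forall>a\<in>(if m = 0 then int_units else {1 + y |y. y \<in> max_ideal_pow m}). \<psi> a = 1)
      \<longleftrightarrow> trivial_on_level \<psi> m" for m
  proof -
    have "{a::'a. absv a = 1 \<and> absv (a - 1) \<le> absv (unif::'a) ^ m} =
        (if m = 0 then int_units else {1 + y |y. y \<in> max_ideal_pow m})"
    proof (cases "m = 0")
      case True
      then show ?thesis
        by (auto simp: int_units_iff intro: absv_diff_le)
    next
      case False
      then have "absv a = 1" if "absv (a - 1) \<le> absv (unif::'a) ^ m" for a :: 'a
        using absv_eq_of_diff_less[of a 1] order.strict_trans1[OF that absv_unif_power_less_1] by simp
      then have "{a::'a. absv a = 1 \<and> absv (a - 1) \<le> absv (unif::'a) ^ m} =
          {a. absv (a - 1) \<le> absv (unif::'a) ^ m}"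
        by blast
      moreover have "(\<exists>y. a = 1 + y \<and> y \<in> max_ideal_pow m) \<longleftrightarrow> absv (a - 1) \<le> absv (unif::'a) ^ m" for a :: 'a
        by (auto simp: mem_max_ideal_pow_iff intro!: exI[of _ "a - 1"])
      ultimately show ?thesis
        using False by simp
    qed
    then show ?thesis
      unfolding trivial_on_level_def by blast
  qed
  then show ?thesis
    by (simp add: conductor_exp_def)
qed

text \<open>The circle has no small subgroups.\<close>

lemma powers_close_to_1:
  fixes z :: complex
  assumes "\<And>n. cmod (z ^ n - 1) \<le> 1 / 2"
  shows "z = 1"
proof (rule ccontr)
  assume "z \<noteq> 1"
  \<comment> \<open>Squaring w multiplies the distance to 1 by \<open>cmod (w + 1)\<close>, which is
    at least \<open>2 - 1 / 2\<close> as long as w is within \<open>1 / 2\<close> of 1. Repeated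
    squaring would escape.\<close>
  have step: "(3 / 2) ^ k * cmod (z - 1) \<le> cmod (z ^ (2 ^ k) - 1)" for k
  proof (induction k)
    case (Suc k)
    let ?w = "z ^ (2 ^ k)"
    have "2 \<le> cmod (?w + 1) + cmod (?w - 1)"
      using norm_triangle_ineq4[of "?w + 1" "?w - 1"] by simp
    then have "3 / 2 \<le> cmod (?w + 1)"
      using assms[of "2 ^ k"] by linarith
    moreover have "z ^ (2 ^ Suc k) = ?w * ?w"
      by (simp add: mult_2 power_add)
    then have "z ^ (2 ^ Suc k) - 1 = (?w + 1) * (?w - 1)"
      by (simp add: algebra_simps)
    then have "cmod (z ^ (2 ^ Suc k) - 1) = cmod (?w + 1) * cmod (?w - 1)"
      by (simp only: norm_mult)
    ultimately have "3 / 2 * cmod (?w - 1) \<le> cmod (z ^ (2 ^ Suc k) - 1)"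
      by (simp only: mult_right_mono norm_ge_zero)
    with Suc show ?case by simp
  qed simp
  obtain k where "1 / cmod (z - 1) < (3 / 2 :: real) ^ k"
    using real_arch_pow[of "3 / 2"] by auto
  then have "1 < (3 / 2) ^ k * cmod (z - 1)"
    using \<open>z \<noteq> 1\<close> by (simp add: pos_divide_less_eq)
  with step[of k] assms[of "2 ^ k"] show False by linarith
qed

text \<open>Powers of a unit congruent to 1 stay congruent to 1, so continuity keeps all powers of
  \<open>\<psi> a\<close> within \<open>1 / 2\<close> of 1. It ensures that the \<open>LEAST\<close>
  in the conductor exponent is attained.\<close>

lemma ex_trivial_on_level:
  fixes \<psi> :: "'a::nonarch_local_field \<Rightarrow> complex"
  assumes "unit_character \<psi>"
  shows "\<exists>m. trivial_on_level \<psi> m"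
proof -
  have "continuous_on int_units \<psi>"
    using assms by (simp add: unit_character_def)
  then obtain d where d: "0 < d" "\<And>a. a \<in> int_units \<Longrightarrow> dist a 1 < d \<Longrightarrow> dist (\<psi> a) (\<psi> 1) < 1 / 2"
    unfolding continuous_on_iff by (metis absv_1 half_gt_zero int_units_iff zero_less_one)
  then obtain m where m: "absv (unif::'a) ^ m < d"
    using ex_absv_unif_power_less by blast
  have "\<psi> a = 1" if a: "absv a = 1" "absv (a - 1) \<le> absv (unif::'a) ^ m" for a
  proof (rule powers_close_to_1)
    fix n
    have "absv (a ^ n - 1) \<le> absv (unif::'a) ^ m"
    proof (induction n)
      case (Suc n)
      have "absv (a * (a ^ n - 1) + (a - 1)) \<le> absv (unif::'a) ^ m"
        using Suc a by (intro absv_add_le absv_mult_le) auto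
      then show ?case by (simp add: algebra_simps)
    qed simp
    then have "dist (\<psi> (a ^ n)) (\<psi> 1) < 1 / 2"
      using a m by (intro d) (simp_all add: int_units_iff absv_power dist_eq_absv)
    then show "cmod (\<psi> a ^ n - 1) \<le> 1 / 2"
      using unit_character_power[OF assms a(1)] unit_character_1[OF assms] by (simp add: dist_norm)
  qed
  then show ?thesis
    unfolding trivial_on_level_def by blast
qed

lemma trivial_on_level_mono: "trivial_on_level \<psi> m \<Longrightarrow> m \<le> n \<Longrightarrow> trivial_on_level \<psi> n"
  unfolding trivial_on_level_def using absv_unif_power_antimono order_trans by blast

lemma trivial_on_level_conductor_exp:
  assumes "unit_character \<psi>" "conductor_exp \<psi> \<le> m"
  shows "trivial_on_level \<psi> m"
proof -
  have "trivial_on_level \<psi> (conductor_exp \<psi>)"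
    unfolding conductor_exp_eq using ex_trivial_on_level[OF assms(1)] by (rule LeastI_ex)
  then show ?thesis
    using assms(2) by (rule trivial_on_level_mono)
qed

lemma conductor_exp_le: "trivial_on_level \<psi> m \<Longrightarrow> conductor_exp \<psi> \<le> m"
  unfolding conductor_exp_eq by (rule Least_le)

lemma trivial_on_level_eq:
  fixes a b :: "'a::nonarch_local_field"
  assumes "unit_character \<psi>" "trivial_on_level \<psi> m" "absv a = 1" "absv b = 1"
    and "absv (a - b) \<le> absv (unif::'a) ^ m"
  shows "\<psi> a = \<psi> b"
proof -
  have "b \<noteq> 0" using assms(4) by auto
  then have "a / b - 1 = (a - b) / b"
    by (simp add: diff_divide_distrib)
  then have "absv (a / b - 1) \<le> absv (unif::'a) ^ m" "absv (a / b) = 1"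
    using assms by (simp_all add: absv_divide)
  then have "\<psi> (a / b) = 1"
    using assms(2) by (simp add: trivial_on_level_def)
  moreover have "\<psi> (a / b * b) = \<psi> (a / b) * \<psi> b"
    using assms by (intro unit_character_mult) (simp_all add: absv_divide)
  ultimately show ?thesis
    using \<open>b \<noteq> 0\<close> by simp
qed


section \<open>Zonal functions\<close>

definition polar_cap :: "nat \<Rightarrow> ('a::nonarch_local_field, 'n::{finite,linorder}) vec set" where
  "polar_cap m = {x \<in> sphere_int. \<forall>i. i \<noteq> last_index \<longrightarrow> absv (x $ i) \<le> absv (unif::'a) ^ m}"

lemma polar_cap_iff:
  "x \<in> polar_cap m \<longleftrightarrow> x \<in> sphere_int \<and> vcong m x (x $ last_index *s e_last)"
  by (auto simp: polar_cap_def vcong_def e_last_def axis_def)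

lemma polar_cap_0: "polar_cap 0 = sphere_int"
  by (auto simp: polar_cap_def sphere_int_iff)

lemma polar_cap_last:
  fixes x :: "('a::nonarch_local_field, 'n::{finite,linorder}) vec"
  assumes "x \<in> polar_cap m" "0 < m"
  shows "absv (x $ last_index) = 1"
proof -
  obtain i where i: "absv (x $ i) = 1"
    using assms by (auto simp: polar_cap_def sphere_int_iff)
  have "i = last_index"
  proof (rule ccontr)
    assume "i \<noteq> last_index"
    then have "absv (x $ i) \<le> absv (unif::'a) ^ m"
      using assms(1) by (simp add: polar_cap_def)
    also have "\<dots> < 1" using assms(2) by (rule absv_unif_power_less_1)
    finally show False using i by simp
  qed
  with i show ?thesis by simp
qed

text \<open>A cap is one orbit of units and \<open>GL_cong m\<close>. The clause on the last
  coordinate ties the unit a to the value of \<open>cap_fun\<close>.\<close>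

lemma polar_cap_orbit:
  fixes x :: "('a::nonarch_local_field, 'n::{finite,linorder}) vec"
  assumes "x \<in> polar_cap m"
  shows "\<exists>a. absv a = 1 \<and> (0 < m \<longrightarrow> a = x $ last_index) \<and> (\<exists>k\<in>GL_cong m. x = (a *s e_last) v* k)"
proof -
  \<comment> \<open>At level 0 the last coordinate may be a nonunit; \<open>GL_cong 0\<close> is
    transitive, so 1 serves.\<close>
  define a where "a = (if m = 0 then 1 else x $ last_index)"
  have a: "absv a = 1"
    using polar_cap_last[OF assms] by (simp add: a_def)
  have x: "x \<in> sphere_int" using assms by (simp add: polar_cap_def)
  have "vcong m (a *s e_last) x"
  proof (cases "m = 0")
    case True
    have "absv ((a *s (e_last :: ('a, 'n) vec)) $ i) \<le> 1" for i
      using a by (simp add: e_last_def axis_def)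
    with True x show ?thesis
      unfolding vcong_def by (auto simp: sphere_int_iff intro!: absv_diff_le)
  next
    case False
    with assms show ?thesis by (simp add: a_def polar_cap_iff vcong_sym)
  qed
  then have "\<exists>k\<in>GL_cong m. (a *s e_last) v* k = x"
    using a x by (intro GL_cong_transitive) (simp_all add: sphere_int_smult_iff)
  moreover have "0 < m \<longrightarrow> a = x $ last_index" by (simp add: a_def)
  ultimately show ?thesis using a by blast
qed

text \<open>On the cap x is congruent to a multiple of \<open>e_last\<close>, which k fixes.\<close>

lemma polar_cap_mirabolic:
  fixes x :: "('a::nonarch_local_field, 'n::{finite,linorder}) vec"
  assumes "x \<in> polar_cap m" "k \<in> GL_mirabolic"
  shows "x v* k \<in> polar_cap m" "vcong m (x v* k) x"
proof -
  let ?y = "x $ last_index *s (e_last :: ('a, 'n) vec)"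
  have k: "k \<in> GL_int" "e_last v* k = e_last"
    using assms(2) by (simp_all add: GL_mirabolic_iff)
  have "?y v* k = x $ last_index *s (e_last v* k)"
    by (simp add: vec_eq_iff vector_matrix_mult_def sum_distrib_left mult.assoc)
  then have "?y v* k = ?y" by (simp add: k)
  moreover have "vcong m (x v* k) (?y v* k)"
    using assms(1) k by (intro vcong_vector_matrix_mult) (simp_all add: polar_cap_iff)
  ultimately have c: "vcong m (x v* k) ?y" by simp
  then show "vcong m (x v* k) x"
    using assms(1) by (auto simp: polar_cap_iff intro: vcong_trans vcong_sym)
  have "absv ((x v* k) $ i) \<le> absv (unif::'a) ^ m" if "i \<noteq> last_index" for i
  proof -
    have "?y $ i = 0" using that by (simp add: e_last_def axis_def)
    then show ?thesis using c unfolding vcong_def by (metis diff_zero)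
  qed
  then show "x v* k \<in> polar_cap m"
    using assms(1) k by (simp add: polar_cap_def sphere_int_mult)
qed

text \<open>The values of \<open>\<psi>\<close> outside the units are junk; the last coordinate on the cap can be
  a nonunit only for \<open>m = 0\<close>, where \<open>\<psi>\<close> is trivial.\<close>

definition cap_fun :: "('a::nonarch_local_field \<Rightarrow> complex) \<Rightarrow> nat \<Rightarrow> ('a, 'n::{finite,linorder}) vec \<Rightarrow> complex" where
  "cap_fun \<psi> m x = (if x \<in> polar_cap m then if m = 0 then 1 else \<psi> (x $ last_index) else 0)"

lemma cap_fun_level:
  fixes \<psi> :: "'a::nonarch_local_field \<Rightarrow> complex"
  assumes "unit_character \<psi>" "trivial_on_level \<psi> m"
  shows "(cap_fun \<psi> m :: ('a, 'n::{finite,linorder}) vec \<Rightarrow> complex) \<in> smooth_fun_level \<psi> m"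
  unfolding smooth_fun_level_iff
proof (intro conjI allI ballI impI)
  fix x :: "('a, 'n) vec"
  show "cap_fun \<psi> m x = 0" if "x \<notin> sphere_int"
    using that by (simp add: cap_fun_def polar_cap_def)
  show "cap_fun \<psi> m (a *s x) = \<psi> a * cap_fun \<psi> m x" if x: "x \<in> sphere_int" and a: "absv a = 1" for a
  proof (cases "m = 0")
    case True
    then have "\<psi> a = 1"
      using assms(2) a absv_diff_le[of a 1 1] by (simp add: trivial_on_level_def)
    with True x a show ?thesis
      by (simp add: cap_fun_def polar_cap_0 sphere_int_smult_iff)
  next
    case False
    have "a *s x \<in> polar_cap m \<longleftrightarrow> x \<in> polar_cap m"
      using a by (simp add: polar_cap_def sphere_int_smult_iff absv_mult)
    then show ?thesis
      using False a polar_cap_last[of x m] by (simp add: cap_fun_def unit_character_mult[OF assms(1)])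
  qed
  show "cap_fun \<psi> m x = cap_fun \<psi> m y" if x: "x \<in> sphere_int" and y: "y \<in> sphere_int" and xy: "vcong m x y" for y
  proof (cases "m = 0")
    case True
    with x y show ?thesis by (simp add: cap_fun_def polar_cap_0)
  next
    case False
    have *: "y \<in> polar_cap m" if "x \<in> polar_cap m" "y \<in> sphere_int" "vcong m x y" for x y :: "('a, 'n) vec"
    proof -
      have "absv (y $ i) \<le> absv (unif::'a) ^ m" if "i \<noteq> last_index" for i
        using \<open>x \<in> polar_cap m\<close> vcong_sym[OF \<open>vcong m x y\<close>] that
        by (intro absv_le_of_diff[of "y $ i" "x $ i"]) (simp_all add: polar_cap_def vcong_def)
      then show ?thesis using \<open>y \<in> sphere_int\<close> by (simp add: polar_cap_def)
    qed
    have "\<psi> (x $ last_index) = \<psi> (y $ last_index)" if "x \<in> polar_cap m" "y \<in> polar_cap m"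
      using xy False that
      by (intro trivial_on_level_eq[OF assms] polar_cap_last) (auto simp: vcong_def)
    then show ?thesis
      using *[of x y] *[of y x] x y xy vcong_sym[OF xy] False by (auto simp: cap_fun_def)
  qed
qed

lemma cap_fun_mirabolic:
  fixes \<psi> :: "'a::nonarch_local_field \<Rightarrow> complex" and x :: "('a, 'n::{finite,linorder}) vec"
  assumes "unit_character \<psi>" "trivial_on_level \<psi> m" "k \<in> GL_mirabolic"
  shows "cap_fun \<psi> m (x v* k) = cap_fun \<psi> m x"
proof (cases "x \<in> polar_cap m")
  case True
  then show ?thesis
    using polar_cap_mirabolic[OF True assms(3)]
    by (intro smooth_fun_level_cong[OF cap_fun_level[OF assms(1,2)]]) (auto simp: polar_cap_def)
next
  case False
  have "matrix_inv k \<in> GL_mirabolic" "k \<in> GL_int"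
    using assms(3) GL_subgroup_GL_mirabolic by (auto simp: GL_subgroup_def)
  then have "x v* k \<notin> polar_cap m"
    using polar_cap_mirabolic(1)[of "x v* k" m "matrix_inv k"] False
    by (auto simp: GL_int_vector_cancel)
  with False show ?thesis by (simp add: cap_fun_def)
qed

lemma cap_fun_e_last: "unit_character \<psi> \<Longrightarrow> cap_fun \<psi> m e_last = 1"
proof -
  have "(e_last :: ('a::nonarch_local_field, 'b::{finite,linorder}) vec) $ last_index = 1"
    and "i \<noteq> last_index \<Longrightarrow> (e_last :: ('a, 'b) vec) $ i = 0" for i
    by (simp_all add: e_last_def axis_def)
  then show "unit_character \<psi> \<Longrightarrow> cap_fun \<psi> m (e_last :: ('a, 'b) vec) = 1"
    by (simp add: cap_fun_def polar_cap_def unit_character_1)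
qed

lemma cap_value:
  assumes "f \<in> smooth_fun_level \<psi> m" "x \<in> polar_cap m"
  shows "\<exists>a. absv a = 1 \<and> f x = \<psi> a * f e_last"
proof -
  obtain a k where a: "absv a = 1" "k \<in> GL_cong m" "x = (a *s e_last) v* k"
    using polar_cap_orbit[OF assms(2)] by blast
  then have "f x = f (a *s e_last)"
    by (simp add: smooth_fun_level_invariant[OF assms(1)])
  also have "\<dots> = \<psi> a * f e_last"
    using a by (intro smooth_fun_level_smult[OF assms(1)]) simp_all
  finally show ?thesis using a by blast
qed

lemma not_polar_cap_max:
  fixes x :: "('a::nonarch_local_field, 'n::{finite,linorder}) vec"
  assumes "x \<in> sphere_int" "x \<notin> polar_cap m"
  shows "\<exists>i. i \<noteq> last_index \<and> absv (unif::'a) ^ m < absv (x $ i) \<and>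
    (\<forall>l. l \<noteq> last_index \<longrightarrow> absv (x $ l) \<le> absv (x $ i))"
proof -
  obtain j where j: "j \<noteq> last_index" "absv (unif::'a) ^ m < absv (x $ j)"
    using assms by (auto simp: polar_cap_def not_le)
  let ?A = "(\<lambda>i. absv (x $ i)) ` (- {last_index})"
  have "Max ?A \<in> ?A" using j by (intro Max_in) auto
  then obtain i where i: "Max ?A = absv (x $ i)" "i \<in> - {last_index}" by (rule imageE)
  then have "i \<noteq> last_index" "absv (x $ i) = Max ?A" by simp_all
  moreover from this have "absv (x $ l) \<le> absv (x $ i)" if "l \<noteq> last_index" for l
    using that by (simp only:) (rule Max_ge, auto)
  ultimately show ?thesis
    using j by (meson less_le_trans)
qed

text \<open>A mirabolic-invariant, \<open>\<psi>\<close>-equivariant function is determined by its values on the sets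
  \<open>max |x\<^sub>i| = t\<close> (\<open>i \<noteq> last_index\<close>).  Off the polar cap, such a value is killed by the
  nontriviality of \<open>\<psi>\<close> if \<open>m\<close> is the conductor exponent, and by the vanishing of the
  averages over \<open>GL_cong (m - 1)\<close> otherwise.\<close>

lemma zonal_harmonic_determined:
  fixes dk :: "('a::nonarch_local_field, 'n::{finite,linorder}) sqmat measure"
  assumes dk: "haar_prob_measure dk" and \<psi>: "unit_character \<psi>" and m: "conductor_exp \<psi> \<le> m"
    and f: "f \<in> harmonic_space dk \<psi> m"
    and inv: "\<And>x k. x \<in> sphere_int \<Longrightarrow> k \<in> GL_mirabolic \<Longrightarrow> f (x v* k) = f x"
    and "f e_last = 0"
  shows "f x = 0"
proof (rule ccontr)
  assume fx: "f x \<noteq> 0"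
  note level = harmonic_space_level[OF dk f]
  have cap: "f y = 0" if "y \<in> polar_cap m" for y
    using cap_value[OF level that] assms(6) by auto
  have x: "x \<in> sphere_int" "x \<notin> polar_cap m"
    using fx smooth_fun_level_outside[OF level] cap by auto
  obtain i where i: "i \<noteq> last_index" "absv (unif::'a) ^ m < absv (x $ i)"
      "\<And>l. l \<noteq> last_index \<Longrightarrow> absv (x $ l) \<le> absv (x $ i)"
    using not_polar_cap_max[OF x] by blast
  have pos: "0 < absv (x $ i)"
    using i(2) absv_unif_power_nonneg[of m, where 'a='a] by linarith
  have x1: "absv (x $ l) \<le> 1" for l using x by (simp add: sphere_int_iff)
  obtain n where n: "m = Suc n"
    using i(2) x1[of i] by (cases m) auto
  \<comment> \<open>By discreteness the radius t of an orbit off the cap is at least the power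
    \<open>n = m - 1\<close>; hence a change modulo that power never exceeds t.\<close>
  have t: "absv (unif::'a) ^ n \<le> absv (x $ i)"
    using i(2) unfolding n by (rule absv_unif_power_Suc_less_imp_le)
  have orbit: "f y = f x"
    if "j \<noteq> last_index" "absv (y $ j) = absv (x $ i)"
      "\<And>l. l \<noteq> last_index \<Longrightarrow> absv (y $ l) \<le> absv (x $ i)"
      "absv (x $ last_index - y $ last_index) \<le> absv (x $ i)" for y j
    using GL_mirabolic_transitive[OF pos i(1) refl that(1,2) i(3) that(3,4)] inv[OF x(1)] by blast
  show False
  proof (cases "m = conductor_exp \<psi>")
    case True
    then have "\<not> trivial_on_level \<psi> n"
      using conductor_exp_le[of \<psi> n] n by auto
    then obtain a where a: "absv a = 1" "absv (a - 1) \<le> absv (unif::'a) ^ n" "\<psi> a \<noteq> 1"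
      by (auto simp: trivial_on_level_def)
    \<comment> \<open>\<open>a *s x\<close> lies in the mirabolic orbit of x: a preserves the sizes
      of the other coordinates and moves the last one by at most the radius. Invariance then clashes
      with equivariance.\<close>
    have "x $ last_index - (a *s x) $ last_index = x $ last_index * (1 - a)"
      by (simp add: algebra_simps)
    moreover have "absv (x $ last_index * (1 - a)) \<le> absv (x $ i)"
      using x1 a(2) t by (intro absv_mult_le) (simp_all add: absv_minus_commute)
    ultimately have "f (a *s x) = f x"
      using i a(1) by (intro orbit[of i]) (simp_all add: absv_mult)
    moreover have "f (a *s x) = \<psi> a * f x"
      using x(1) a(1) by (rule smooth_fun_level_smult[OF level])
    ultimately show False using fx a(3) by simp
  next
    case False
    let ?C = "coset_reps m (GL_cong n :: ('a, 'n) sqmat set)"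
    have fin: "finite ?C"
      by (rule finite_coset_reps) (auto simp: GL_cong_iff)
    \<comment> \<open>Every translate stays in the orbit of x or falls into the cap, where f
      vanishes. The vanishing average is therefore a multiple of \<open>f x\<close>.\<close>
    have alt: "f (x v* k) = f x \<or> f (x v* k) = 0" if "k \<in> GL_cong n" for k
    proof -
      let ?y = "x v* k"
      have k: "k \<in> GL_int" "mcong n k (mat 1)" using that by (simp_all add: GL_cong_iff)
      have "vcong n ?y (x v* mat 1)"
        by (intro vcong_vector_matrix_mult_right k x1)
      then have yx: "absv (?y $ l - x $ l) \<le> absv (unif::'a) ^ n" for l
        by (simp add: vcong_def)
      have le: "absv (?y $ l) \<le> absv (x $ i)" if "l \<noteq> last_index" for l
        using absv_le_of_diff[of "?y $ l" "x $ l" "absv (x $ i)"] yx[of l] t i(3)[OF that] by simp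
      have last: "absv (x $ last_index - ?y $ last_index) \<le> absv (x $ i)"
        using yx[of last_index] t by (simp add: absv_minus_commute)
      show ?thesis
      proof (cases "\<exists>j. j \<noteq> last_index \<and> absv (?y $ j) = absv (x $ i)")
        case True
        then show ?thesis using orbit[OF _ _ le last] by blast
      next
        case False
        then have lt: "absv (?y $ j) < absv (x $ i)" if "j \<noteq> last_index" for j
          using le[OF that] that by (auto simp: less_le)
        \<comment> \<open>Otherwise coordinate i would keep its size under the perturbation. So the
          radius is exactly the n-th power, and coordinates strictly below it drop to the m-th power
          by discreteness.\<close>
        have "\<not> absv (unif::'a) ^ n < absv (x $ i)"
        proof
          assume "absv (unif::'a) ^ n < absv (x $ i)"
          then have "absv (?y $ i) = absv (x $ i)"
            using yx[of i] by (intro absv_eq_of_diff_less) linarith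
          with lt[OF i(1)] show False by simp
        qed
        then have "absv (?y $ j) \<le> absv (unif::'a) ^ m" if "j \<noteq> last_index" for j
          using lt[OF that] absv_unif_power_Suc_less_imp_le[of n "?y $ j"] n by force
        then have "?y \<in> polar_cap m"
          using sphere_int_mult[OF x(1) k(1)] by (simp add: polar_cap_def)
        then show ?thesis using cap by blast
      qed
    qed
    \<comment> \<open>The class of the identity contributes \<open>f x\<close>, so the multiple is
      not zero.\<close>
    obtain r where r: "r \<in> ?C" "f (x v* r) = f x"
    proof -
      have 1: "mat 1 \<in> (GL_cong n :: ('a, 'n) sqmat set)" by (simp add: GL_cong_iff)
      have "f (x v* mat 1) = f (x v* coset_rep m (GL_cong n) (mat 1))"
        using coset_rep[OF 1, of m] by (intro smooth_fun_level_mcong[OF level]) (auto simp: GL_cong_iff)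
      then have "f (x v* coset_rep m (GL_cong n) (mat 1)) = f x" by simp
      with coset_rep(1)[OF 1] show thesis by (rule that)
    qed
    have "0 = coset_sum m (GL_cong n) f x"
      using f False n by (simp add: harmonic_space_iff[OF dk])
    also have "\<dots> = (\<Sum>k\<in>?C. if f (x v* k) = f x then f x else 0)"
      unfolding coset_sum_def using alt coset_reps_subset[of m "GL_cong n"]
      by (intro sum.cong) auto
    also have "\<dots> = of_nat (card {k \<in> ?C. f (x v* k) = f x}) * f x"
      using fin by (simp add: sum.If_cases Int_def)
    finally have "card {k \<in> ?C. f (x v* k) = f x} = 0"
      using fx by simp
    then show False
      using fin r by auto
  qed
qed

text \<open>Up to a nonzero factor, the cap function minus its orthogonal projection onto level
  \<open>m - 1\<close>. At the conductor exponent nothing is subtracted, as the harmonic space is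
  the whole level.\<close>

definition zonal :: "('a::nonarch_local_field \<Rightarrow> complex) \<Rightarrow> nat \<Rightarrow> ('a, 'n::{finite,linorder}) vec \<Rightarrow> complex" where
  "zonal \<psi> m x = (if m = conductor_exp \<psi> then cap_fun \<psi> m x
     else of_nat (card (coset_reps m (GL_cong (m - 1) :: ('a, 'n) sqmat set))) * cap_fun \<psi> m x
       - coset_sum m (GL_cong (m - 1)) (cap_fun \<psi> m) x)"

lemma zonal_harmonic:
  fixes dk :: "('a::nonarch_local_field, 'n::{finite,linorder}) sqmat measure"
  assumes dk: "haar_prob_measure dk" and \<psi>: "unit_character \<psi>" and m: "conductor_exp \<psi> \<le> m"
  shows "zonal \<psi> m \<in> harmonic_space dk \<psi> m"
proof -
  let ?c = "cap_fun \<psi> m :: ('a, 'n) vec \<Rightarrow> complex"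
  let ?G = "GL_cong (m - 1) :: ('a, 'n) sqmat set" let ?N = "of_nat (card (coset_reps m ?G)) :: complex"
  have c: "?c \<in> smooth_fun_level \<psi> m"
    by (intro cap_fun_level \<psi> trivial_on_level_conductor_exp m)
  show ?thesis
  proof (cases "m = conductor_exp \<psi>")
    case True
    with c show ?thesis
      by (simp add: harmonic_space_iff[OF dk] zonal_def[abs_def])
  next
    case False
    have Pc: "coset_sum m ?G ?c \<in> smooth_fun_level \<psi> (m - 1)"
      by (rule coset_sum_GL_cong_level[OF c])
    \<comment> \<open>The undivided average is idempotent up to the factor N, which is exactly the
      coefficient in \<open>zonal\<close>.\<close>
    have "coset_sum m ?G (coset_sum m ?G ?c) x = ?N * coset_sum m ?G ?c x" for x
      by (intro coset_sum_of_invariant smooth_fun_level_invariant[OF Pc])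
    then show ?thesis
      using False c smooth_fun_level_mono[OF Pc, of m]
      by (simp add: harmonic_space_iff[OF dk] zonal_def[abs_def] smooth_fun_level_diff
          smooth_fun_level_scale coset_sum_diff coset_sum_scale)
  qed
qed

text \<open>\<open>GL_cong (m - 1)\<close> is normalised by k, so averaging preserves the invariance
  of the cap function.\<close>

lemma zonal_mirabolic:
  fixes \<psi> :: "'a::nonarch_local_field \<Rightarrow> complex" and x :: "('a, 'n::{finite,linorder}) vec"
  assumes \<psi>: "unit_character \<psi>" and m: "conductor_exp \<psi> \<le> m" and k: "k \<in> GL_mirabolic"
  shows "zonal \<psi> m (x v* k) = zonal \<psi> m x"
proof -
  note triv = trivial_on_level_conductor_exp[OF \<psi> m]
  have kG: "k \<in> GL_int" using k by (simp add: GL_mirabolic_iff)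
  have "coset_sum m (GL_cong (m - 1)) (cap_fun \<psi> m) (x v* k) =
      coset_sum m (GL_cong (m - 1)) (\<lambda>x. cap_fun \<psi> m (x v* k)) x"
    by (intro coset_sum_translate[symmetric, OF GL_subgroup_GL_cong cap_fun_level[OF \<psi> triv] kG]
        GL_cong_conj[OF kG])
  then show ?thesis
    unfolding zonal_def cap_fun_mirabolic[OF \<psi> triv k] by (simp only:)
qed

text \<open>At the conductor exponent the value at \<open>e_last\<close> is 1. Above it, vanishing
  would make the cap function invariant under \<open>GL_cong (m - 1)\<close>, which can push
  \<open>e_last\<close> out of the cap.\<close>

lemma zonal_nonzero:
  fixes \<psi> :: "'a::nonarch_local_field \<Rightarrow> complex"
  assumes \<psi>: "unit_character \<psi>" and m: "conductor_exp \<psi> \<le> m" and "CARD('n) \<ge> 2"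
  shows "\<exists>x. (zonal \<psi> m :: ('a, 'n::{finite,linorder}) vec \<Rightarrow> complex) x \<noteq> 0"
proof (rule ccontr)
  assume "\<nexists>x. (zonal \<psi> m :: ('a, 'n) vec \<Rightarrow> complex) x \<noteq> 0"
  then have z: "(zonal \<psi> m :: ('a, 'n) vec \<Rightarrow> complex) x = 0" for x by blast
  let ?c = "cap_fun \<psi> m :: ('a, 'n) vec \<Rightarrow> complex"
  let ?G = "GL_cong (m - 1) :: ('a, 'n) sqmat set" let ?N = "of_nat (card (coset_reps m ?G)) :: complex"
  have c: "?c \<in> smooth_fun_level \<psi> m"
    by (intro cap_fun_level \<psi> trivial_on_level_conductor_exp m)
  have ne: "m \<noteq> conductor_exp \<psi>"
    using z[of e_last] cap_fun_e_last[OF \<psi>, of m, where 'b='n] by (auto simp: zonal_def)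
  with m obtain n where n: "m = Suc n" by (cases m) auto
  have eq: "?N * ?c x = coset_sum m ?G ?c x" for x
    using z[of x] ne by (simp add: zonal_def)
  have N: "?N \<noteq> 0"
    using card_coset_reps_pos[OF GL_subgroup_GL_cong, of m "m - 1", where 'a='a and 'b='n] by simp
  have inv: "?c (x v* k) = ?c x" if "k \<in> ?G" for x k
  proof -
    have "?N * ?c (x v* k) = ?N * ?c x"
      unfolding eq by (rule coset_sum_invariant[OF GL_subgroup_GL_cong c that])
    with N show ?thesis by (simp only: mult_cancel_left) simp
  qed
  obtain i :: 'n where i: "i \<noteq> last_index"
  proof -
    have "UNIV \<noteq> {last_index :: 'n}"
      using assms(3) by (metis card.empty card.insert empty_iff finite.emptyI numeral_le_one_iff One_nat_def semiring_norm(69))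
    then show thesis using that by blast
  qed
  \<comment> \<open>Congruent to \<open>e_last\<close> modulo the n-th power but outside the cap of
    level \<open>m = n + 1\<close>: coordinate i is one power too large.\<close>
  define y :: "('a, 'n) vec" where "y = (\<chi> l. if l = last_index then 1 else if l = i then unif ^ n else 0)"
  have "absv (y $ l) \<le> 1" for l by (simp add: y_def absv_power)
  moreover have "absv (y $ last_index) = 1" by (simp add: y_def)
  ultimately have y: "y \<in> sphere_int" unfolding sphere_int_iff by blast
  have "vcong n e_last y"
    by (auto simp: vcong_def y_def e_last_def axis_def absv_power)
  then obtain k where "k \<in> GL_cong n" "e_last v* k = y"
    using GL_cong_transitive[OF e_last_sphere y] by blast
  then have "?c y = 1"
    using inv[of k e_last] n cap_fun_e_last[OF \<psi>, of m, where 'b='n] by simp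
  then have "y \<in> polar_cap m" by (auto simp: cap_fun_def split: if_splits)
  then have "absv (y $ i) \<le> absv (unif::'a) ^ m" using i by (simp add: polar_cap_def)
  then have "absv (unif::'a) ^ n \<le> absv (unif::'a) ^ Suc n"
    using i n by (simp add: y_def absv_power)
  moreover have "absv (unif::'a) ^ Suc n < absv (unif::'a) ^ n"
    by (rule power_strict_decreasing) (simp_all add: unif_nonzero)
  ultimately show False by linarith
qed

section \<open>The dimension of the invariants in a harmonic space\<close>

lemma has_dim_1I:
  assumes "vector_space s" "b \<noteq> 0" "W = range (\<lambda>c. s c b)"
  shows "has_dim s W 1"
proof -
  interpret vector_space s by (rule assms(1))
  have W: "span {b} = W" by (simp add: span_singleton assms(3))
  moreover have "dim (span {b}) = card {b}"
    by (rule dim_span_eq_card_independent) (simp add: assms(2))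
  ultimately show ?thesis
    unfolding has_dim_def by (intro conjI exI[of _ "{b}"]) simp_all
qed

lemma has_dim_0I:
  fixes s :: "complex \<Rightarrow> 'v::ab_group_add \<Rightarrow> 'v"
  assumes "vector_space s"
  shows "has_dim s {0} 0"
proof -
  interpret vector_space s by (rule assms)
  have "dim (span {}) = card ({} :: 'v set)"
    by (rule dim_span_eq_card_independent) (rule independent_empty)
  then show ?thesis
    unfolding has_dim_def by (intro conjI exI[of _ "{}"]) simp_all
qed

lemma mirabolic_harmonic_eq_range:
  fixes dk :: "('a::nonarch_local_field, 'n::{finite,linorder}) sqmat measure"
  assumes dk: "haar_prob_measure dk" and n: "CARD('n) \<ge> 2"
    and \<psi>: "unit_character \<psi>" and m: "conductor_exp \<psi> \<le> m"
  shows "{f \<in> harmonic_space dk \<psi> m. \<forall>x\<in>sphere_int. \<forall>k\<in>GL_mirabolic. f (x v* k) = f x}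
    = range (\<lambda>c. fun_scale (*) c (zonal \<psi> m))" (is "?W = _")
proof (intro equalityI subsetI)
  let ?z = "zonal \<psi> m :: ('a, 'n) vec \<Rightarrow> complex"
  have z: "?z \<in> harmonic_space dk \<psi> m" by (rule zonal_harmonic[OF dk \<psi> m])
  \<comment> \<open>The zonal function is itself subject to
    \<open>zonal_harmonic_determined\<close>: vanishing at \<open>e_last\<close> would make it
    zero.\<close>
  have z0: "?z e_last \<noteq> 0"
    using zonal_nonzero[OF \<psi> m n] zonal_harmonic_determined[OF dk \<psi> m z zonal_mirabolic[OF \<psi> m]] by blast
  fix f assume "f \<in> ?W"
  then have f: "f \<in> harmonic_space dk \<psi> m"
      "\<And>x k. x \<in> sphere_int \<Longrightarrow> k \<in> GL_mirabolic \<Longrightarrow> f (x v* k) = f x" by auto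
  define c where "c = f e_last / ?z e_last"
  have "(\<lambda>x. f x - c * ?z x) x = 0" for x
  proof (rule zonal_harmonic_determined[OF dk \<psi> m])
    show "(\<lambda>x. f x - c * ?z x) \<in> harmonic_space dk \<psi> m"
      by (intro harmonic_space_diff harmonic_space_scale dk f z)
  qed (simp_all add: f zonal_mirabolic[OF \<psi> m] c_def z0)
  then have "f = fun_scale (*) c ?z"
    by (simp add: fun_eq_iff fun_scale_def)
  then show "f \<in> range (\<lambda>c. fun_scale (*) c ?z)" by blast
next
  fix f assume "f \<in> range (\<lambda>c. fun_scale (*) c (zonal \<psi> m :: ('a, 'n) vec \<Rightarrow> complex))"
  then obtain c where "f = (\<lambda>x. c * zonal \<psi> m x)" by (auto simp: fun_scale_def)
  then show "f \<in> ?W"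
    by (simp add: harmonic_space_scale[OF dk] zonal_harmonic[OF dk \<psi> m] zonal_mirabolic[OF \<psi> m])
qed

lemma has_dim_mirabolic_harmonic:
  fixes dk :: "('a::nonarch_local_field, 'n::{finite,linorder}) sqmat measure"
  assumes dk: "haar_prob_measure dk" and n: "CARD('n) \<ge> 2"
    and \<psi>: "unit_character \<psi>" and m: "conductor_exp \<psi> \<le> m"
  shows "has_dim (fun_scale (*))
    {f \<in> harmonic_space dk \<psi> m. \<forall>x\<in>sphere_int. \<forall>k\<in>GL_mirabolic. f (x v* k) = f x} 1"
proof (rule has_dim_1I[OF vector_space_fun_scale[OF vector_space_complex] _ mirabolic_harmonic_eq_range[OF assms]])
  show "(zonal \<psi> m :: ('a, 'n) vec \<Rightarrow> complex) \<noteq> 0"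
    using zonal_nonzero[OF \<psi> m n] by (auto simp: fun_eq_iff)
qed

section \<open>Smooth irreducible representations\<close>

lemma mat_mult_vector: "x v* mat a = a *s (x :: ('a::nonarch_local_field, 'n::finite) vec)"
  by (simp add: vec_eq_iff vector_matrix_mult_def mat_def if_distrib cong: if_cong)

lemma mat_mult_mat: "mat a ** mat b = (mat (a * b) :: ('a::nonarch_local_field, 'n::finite) sqmat)"
  by (simp add: vec_eq_iff matrix_mult_row mat_mult_vector) (simp add: mat_def)

lemma mat_commute: "mat a ** g = g ** (mat a :: ('a::nonarch_local_field, 'n::finite) sqmat)"
  by (simp add: vec_eq_iff matrix_matrix_mult_def mat_def if_distrib if_distribR cong: if_cong)

lemma mat_GL_int:
  assumes "absv a = 1"
  shows "(mat a :: ('a::nonarch_local_field, 'n::finite) sqmat) \<in> GL_int"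
proof -
  have "a \<noteq> 0" using assms by auto
  have "\<forall>i j. (mat b :: ('a, 'n) sqmat) $ i $ j \<in> int_ring" if "absv b \<le> 1" for b
    using that by (simp add: mat_def int_ring_def)
  then show ?thesis
    using assms \<open>a \<noteq> 0\<close> unfolding GL_int_def
    by (intro CollectI conjI exI[of _ "mat (1 / a)"]) (simp_all add: mat_mult_mat absv_divide)
qed

lemma mat_mcong:
  fixes a b :: "'a::nonarch_local_field"
  assumes "absv (a - b) \<le> absv (unif::'a) ^ m"
  shows "mcong m (mat a) (mat b)"
  using assms by (simp add: mcong_def vcong_def mat_def)

text \<open>Pigeonhole: two powers of a share a residue, and their quotient is congruent to
  1.\<close>

lemma unit_finite_order:
  fixes a :: "'a::nonarch_local_field"
  assumes a: "absv a = 1"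
  shows "\<exists>N>0. absv (a ^ N - 1) \<le> absv (unif::'a) ^ m"
proof -
  obtain R :: "'a set" where R: "finite R" "\<And>x. absv x \<le> 1 \<Longrightarrow> \<exists>r\<in>R. absv (x - r) \<le> absv (unif::'a) ^ m"
    using ex_finite_residues[where 'a='a] by blast
  then obtain f where f: "\<And>x. absv x \<le> 1 \<Longrightarrow> f x \<in> R \<and> absv (x - f x) \<le> absv (unif::'a) ^ m"
    by metis
  have ai: "absv (a ^ i) = 1" for i by (simp add: absv_power a)
  then have "range (\<lambda>i. f (a ^ i)) \<subseteq> R" using f by auto
  then have "\<not> inj (\<lambda>i::nat. f (a ^ i))"
    using R(1) finite_subset range_inj_infinite by blast
  then obtain i j where ij: "i < j" "f (a ^ i) = f (a ^ j)"
    unfolding inj_def by (metis linorder_neqE_nat)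
  have "absv (a ^ j - f (a ^ j)) \<le> absv (unif::'a) ^ m" "absv (f (a ^ j) - a ^ i) \<le> absv (unif::'a) ^ m"
    using f[of "a ^ i"] f[of "a ^ j"] ai ij(2) by (simp_all add: absv_minus_commute)
  then have "absv (a ^ j - a ^ i) \<le> absv (unif::'a) ^ m"
    by (rule absv_diff_trans)
  moreover have "a ^ j - a ^ i = a ^ i * (a ^ (j - i) - 1)"
    using ij(1) by (simp add: right_diff_distrib flip: power_add)
  ultimately have "absv (a ^ (j - i) - 1) \<le> absv (unif::'a) ^ m"
    by (simp add: absv_mult ai)
  with ij(1) show ?thesis by (intro exI[of _ "j - i"]) simp
qed

text \<open>The eigenvectors are the discrete Fourier coefficients of the orbit.\<close>

lemma periodic_orbit_eigenvector:
  fixes s :: "complex \<Rightarrow> 'v::ab_group_add \<Rightarrow> 'v" and b :: "nat \<Rightarrow> 'v"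
  assumes "vector_space s" and "0 < N" "b N = b 0" "b 0 \<noteq> 0"
    and A: "\<And>c. A (\<Sum>i<N. s (c i) (b i)) = (\<Sum>i<N. s (c i) (b (Suc i)))"
  shows "\<exists>c z. (\<Sum>i<N. s (c i) (b i)) \<noteq> 0 \<and> A (\<Sum>i<N. s (c i) (b i)) = s z (\<Sum>i<N. s (c i) (b i))"
proof -
  interpret vector_space s by (rule assms(1))
  \<comment> \<open>A primitive N-th root of unity; N is a period of the orbit, perhaps not the
    least one.\<close>
  define w where "w = cis (2 * pi / real N)"
  have wi: "w ^ i = cis (2 * pi * real i / real N)" for i
  proof -
    have "w ^ i = cis (real i * (2 * pi / real N))"
      by (simp only: w_def Complex.DeMoivre)
    also have "real i * (2 * pi / real N) = 2 * pi * real i / real N"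
      by simp
    finally show ?thesis .
  qed
  have w1: "w ^ i \<noteq> 1" if "0 < i" "i < N" for i
  proof
    assume "w ^ i = 1"
    then have eq: "cis (2 * pi * real i / real N) = cis (2 * pi * real 0 / real N)"
      by (simp add: wi)
    have "inj_on (\<lambda>k. cis (2 * pi * real k / real N)) {..<N}"
      by (rule bij_betw_imp_inj_on[OF Complex.bij_betw_roots_unity[OF assms(2)]])
    from inj_onD[OF this, of i 0] have "i = 0"
      using eq that by simp
    with that show False by simp
  qed
  have wN: "w ^ N = 1" using assms(2) by (simp add: wi)
  have w0: "w \<noteq> 0" by (simp add: w_def)
  define e where "e j = (\<Sum>i<N. s (w ^ (i * j)) (b i))" for j
  \<comment> \<open>A shifts the index by one, and by periodicity the shifted sum is the same
    coefficient up to \<open>w ^ j\<close>.\<close>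
  have Ae: "A (e j) = s (inverse (w ^ j)) (e j)" for j
  proof -
    let ?g = "\<lambda>i. s (w ^ (i * j)) (b i)"
    have "?g N = ?g 0"
      using wN assms(3) by (simp add: power_mult)
    then have "(\<Sum>i<N. ?g (Suc i)) = e j"
      using sum.lessThan_Suc_shift[of ?g N] by (simp add: e_def add.commute)
    moreover have "s (w ^ j) (A (e j)) = (\<Sum>i<N. ?g (Suc i))"
      unfolding e_def A by (simp add: scale_sum_right power_add)
    ultimately have "s (inverse (w ^ j)) (s (w ^ j) (A (e j))) = s (inverse (w ^ j)) (e j)"
      by simp
    then show ?thesis using w0 by simp
  qed
  \<comment> \<open>Fourier inversion at index 0: the coefficients add up to N times
    \<open>b 0\<close>.\<close>
  have "\<exists>j. e j \<noteq> 0"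
  proof (rule ccontr)
    assume "\<nexists>j. e j \<noteq> 0"
    then have "0 = (\<Sum>j<N. e j)" by simp
    also have "\<dots> = (\<Sum>i<N. s (\<Sum>j<N. (w ^ i) ^ j) (b i))"
      unfolding e_def by (subst sum.swap) (simp add: scale_sum_left power_mult)
    also have "\<dots> = (\<Sum>i<N. if i = 0 then s (of_nat N) (b 0) else 0)"
    proof (rule sum.cong[OF refl])
      fix i assume "i \<in> {..<N}"
      then have "(\<Sum>j<N. (w ^ i) ^ j) = 0" if "i \<noteq> 0"
        using w1[of i] that wN by (simp add: geometric_sum) (metis power_mult mult.commute power_one)
      then show "s (\<Sum>j<N. (w ^ i) ^ j) (b i) = (if i = 0 then s (of_nat N) (b 0) else 0)"
        by simp
    qed
    also have "\<dots> = s (of_nat N) (b 0)" using assms(2) by simp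
    finally show False using assms(2,4) by simp
  qed
  then obtain j where "e j \<noteq> 0" by blast
  with Ae[of j] show ?thesis
    unfolding e_def by (intro exI[of _ "\<lambda>i. w ^ (i * j)"] exI[of _ "inverse (w ^ j)"]) simp
qed

section \<open>Level and central character of an irreducible smooth representation\<close>

locale smooth_irrep =
  fixes \<tau> :: "(('a::nonarch_local_field, 'n::{finite,linorder}) sqmat, 'v::ab_group_add) rep"
  assumes smooth: "smooth_rep GL_int \<tau>" and irreducible: "irreducible_rep GL_int \<tau>"
begin

abbreviation "V \<equiv> rspace \<tau>"
abbreviation "act \<equiv> ract \<tau>"
abbreviation scl (infixr \<open>\<cdot>\<close> 75) where "scl \<equiv> rscale \<tau>"

lemma is_rep: "is_rep GL_int \<tau>"
  using smooth by (simp add: smooth_rep_def)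

sublocale vs: vector_space "rscale \<tau>"
  using is_rep by (simp add: is_rep_def)

lemma subspace_V: "vs.subspace V"
  using is_rep by (simp add: is_rep_def)

lemma act_closed: "g \<in> GL_int \<Longrightarrow> v \<in> V \<Longrightarrow> act g v \<in> V"
  and act_add: "g \<in> GL_int \<Longrightarrow> v \<in> V \<Longrightarrow> w \<in> V \<Longrightarrow> act g (v + w) = act g v + act g w"
  and act_scale: "g \<in> GL_int \<Longrightarrow> v \<in> V \<Longrightarrow> act g (c \<cdot> v) = c \<cdot> act g v"
  and act_1: "v \<in> V \<Longrightarrow> act (mat 1) v = v"
  and act_mult: "g \<in> GL_int \<Longrightarrow> h \<in> GL_int \<Longrightarrow> v \<in> V \<Longrightarrow> act (g ** h) v = act g (act h v)"
  using is_rep by (simp_all add: is_rep_def)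

lemmas V_0 = vs.subspace_0[OF subspace_V]
  and V_add = vs.subspace_add[OF subspace_V]
  and V_scale = vs.subspace_scale[OF subspace_V]
  and V_sum = vs.subspace_sum[OF subspace_V]

lemma act_0: "g \<in> GL_int \<Longrightarrow> act g 0 = 0"
  using act_scale[of g 0 0] V_0 by simp

lemma act_sum:
  assumes "g \<in> GL_int" "\<And>i. i \<in> A \<Longrightarrow> f i \<in> V"
  shows "act g (\<Sum>i\<in>A. f i) = (\<Sum>i\<in>A. act g (f i))"
  using assms(2)
  by (induction A rule: infinite_finite_induct) (simp_all add: act_0 act_add assms(1) V_sum)

lemma act_inverse:
  assumes "g \<in> GL_int" "v \<in> V"
  shows "act (matrix_inv g) (act g v) = v" "act g (act (matrix_inv g) v) = v"
  using act_mult[of "matrix_inv g" g v] act_mult[of g "matrix_inv g" v] assms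
  by (simp_all add: GL_int_inverse act_1)

lemma stable_subspace_eq_V:
  assumes "vs.subspace W" "W \<subseteq> V" "\<And>g w. g \<in> GL_int \<Longrightarrow> w \<in> W \<Longrightarrow> act g w \<in> W" "w \<in> W" "w \<noteq> 0"
  shows "W = V"
  using irreducible assms unfolding irreducible_rep_def by blast

lemma ex_nonzero: "\<exists>v\<in>V. v \<noteq> 0"
  using irreducible V_0 unfolding irreducible_rep_def by blast

text \<open>By normality the vectors fixed by \<open>GL_cong m\<close> form a stable subspace, and w
  shows that it is not zero.\<close>

lemma GL_cong_trivial:
  assumes "w \<in> V" "w \<noteq> 0" "\<And>k. k \<in> GL_cong m \<Longrightarrow> act k w = w" and "k \<in> GL_cong m" "v \<in> V"
  shows "act k v = v"
proof -
  let ?W = "{u \<in> V. \<forall>k\<in>GL_cong m. act k u = u}"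
  have GL: "k \<in> GL_int" if "k \<in> GL_cong m" for k :: "('a, 'n) sqmat"
    using that by (simp add: GL_cong_iff)
  have "?W = V"
  proof (rule stable_subspace_eq_V)
    show "vs.subspace ?W"
      using V_0 V_add V_scale by (intro vs.subspaceI) (auto simp: act_0 act_add act_scale GL)
    show "w \<in> ?W" using assms by simp
    show "act g u \<in> ?W" if g: "g \<in> GL_int" and u: "u \<in> ?W" for g u
    proof -
      have "act k (act g u) = act g u" if k: "k \<in> GL_cong m" for k
      proof -
        have "act (g ** (matrix_inv g ** k ** g)) u = act g (act (matrix_inv g ** k ** g) u)"
          using g k u by (intro act_mult) (auto simp: GL_int_mult GL_int_inverse GL)
        also have "\<dots> = act g u"
          using u GL_cong_conj[OF g k] by simp
        also have "g ** (matrix_inv g ** k ** g) = k ** g"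
          using g by (simp add: matrix_mul_assoc GL_int_inverse)
        finally show ?thesis
          using g k u by (simp add: act_mult GL)
      qed
      then show ?thesis using g u by (simp add: act_closed)
    qed
  qed (use assms in auto)
  then show ?thesis using assms(4,5) by blast
qed

text \<open>The open stabiliser of a single nonzero vector contains some \<open>GL_cong m\<close>;
  irreducibility does the rest.\<close>

lemma ex_trivial_level: "\<exists>m. \<forall>k\<in>GL_cong m. \<forall>v\<in>V. act k v = v"
proof -
  obtain w where w: "w \<in> V" "w \<noteq> 0" using ex_nonzero by blast
  then have "openin (top_of_set GL_int) {g \<in> GL_int. act g w = w}"
    using smooth by (simp add: smooth_rep_def)
  then obtain U where U: "open U" "{g \<in> GL_int. act g w = w} = GL_int \<inter> U"
    by (auto simp: openin_open)
  moreover have "mat 1 \<in> {g \<in> GL_int. act g w = w}" using w by (simp add: act_1)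
  ultimately have "mat 1 \<in> U" by blast
  then obtain e where e: "0 < e" "\<And>y. dist y (mat 1) < e \<Longrightarrow> y \<in> U"
    using U(1) unfolding open_dist by blast
  then obtain m where m: "\<And>k l :: ('a, 'n) sqmat. mcong m k l \<Longrightarrow> dist k l < e"
    using ex_mcong_dist_less by blast
  have "act k w = w" if "k \<in> GL_cong m" for k
    using that e(2)[OF m[of k "mat 1"]] U(2) by (auto simp: GL_cong_iff)
  then show ?thesis
    using GL_cong_trivial[OF w] by blast
qed

definition level :: nat where
  "level = (LEAST m. \<forall>k\<in>GL_cong m. \<forall>v\<in>V. act k v = v)"

lemma act_level: "k \<in> GL_cong level \<Longrightarrow> v \<in> V \<Longrightarrow> act k v = v"
  using LeastI_ex[OF ex_trivial_level] by (simp add: level_def)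

text \<open>A nonzero w would make \<open>GL_cong m\<close> act trivially on the whole space, below
  the least such level.\<close>

lemma level_minimal:
  assumes "m < level" "w \<in> V" "\<And>k. k \<in> GL_cong m \<Longrightarrow> act k w = w"
  shows "w = 0"
  using not_less_Least[OF assms(1)[unfolded level_def]] GL_cong_trivial[OF assms(2) _ assms(3)] by blast

lemma act_mcong:
  assumes "g \<in> GL_int" "h \<in> GL_int" "mcong level g h" "v \<in> V"
  shows "act g v = act h v"
proof -
  have k: "matrix_inv g ** h \<in> GL_cong level"
    using assms by (simp add: mcong_iff_GL_cong)
  have "act h v = act (g ** (matrix_inv g ** h)) v"
    using assms by (simp add: GL_int_inverse_cancel)
  also have "\<dots> = act g (act (matrix_inv g ** h) v)"
    using assms k by (intro act_mult) (simp_all add: GL_cong_iff)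
  finally show ?thesis
    using k assms by (simp add: act_level)
qed

text \<open>Schur's lemma with the eigenvalue built by hand: a power of a is congruent to 1, so the
  orbit of v is periodic and yields an eigenvector; the eigenspace is stable because scalar matrices
  are central.\<close>

lemma ex_central_scalar:
  assumes a: "absv a = 1"
  shows "\<exists>z. \<forall>v\<in>V. act (mat a) v = z \<cdot> v"
proof -
  obtain v where v: "v \<in> V" "v \<noteq> 0" using ex_nonzero by blast
  obtain N where N: "0 < N" "absv (a ^ N - 1) \<le> absv (unif::'a) ^ level"
    using unit_finite_order[OF a] by blast
  have GL: "(mat (a ^ i) :: ('a, 'n) sqmat) \<in> GL_int" for i by (intro mat_GL_int) (simp add: absv_power a)
  have GL1: "(mat a :: ('a, 'n) sqmat) \<in> GL_int" by (intro mat_GL_int a)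
  define b where "b i = act (mat (a ^ i)) v" for i
  have bV: "b i \<in> V" for i using v GL by (simp add: b_def act_closed)
  have b0: "b 0 = v" using v by (simp add: b_def act_1)
  have "act (mat (a ^ N)) v = act (mat 1) v"
    using N v by (intro act_mcong mat_mcong GL) simp_all
  then have bN: "b N = b 0" by (simp add: b_def)
  have bS: "act (mat a) (b i) = b (Suc i)" for i
    using act_mult[OF GL1 GL[of i] v(1)] by (simp add: b_def mat_mult_mat)
  have A: "act (mat a) (\<Sum>i<N. c i \<cdot> b i) = (\<Sum>i<N. c i \<cdot> b (Suc i))" for c
    using GL1 bV by (subst act_sum) (simp_all add: V_scale act_scale bS)
  obtain c z where cz: "(\<Sum>i<N. c i \<cdot> b i) \<noteq> 0"
      "act (mat a) (\<Sum>i<N. c i \<cdot> b i) = z \<cdot> (\<Sum>i<N. c i \<cdot> b i)"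
    using periodic_orbit_eigenvector[OF vs.vector_space_axioms N(1) bN _ A] v b0 by auto
  let ?W = "{u \<in> V. act (mat a) u = z \<cdot> u}"
  have "?W = V"
  proof (rule stable_subspace_eq_V[OF _ _ _ _ cz(1)])
    show "vs.subspace ?W"
      using V_0 V_add V_scale GL1
      by (intro vs.subspaceI) (auto simp: act_0 act_add act_scale vs.scale_right_distrib mult.commute)
    show "(\<Sum>i<N. c i \<cdot> b i) \<in> ?W" using cz(2) bV by (simp add: V_sum V_scale)
    show "act g u \<in> ?W" if g: "g \<in> GL_int" and u: "u \<in> ?W" for g u
    proof -
      have "act (mat a) (act g u) = act g (act (mat a) u)"
        using act_mult[OF GL1 g, of u] act_mult[OF g GL1, of u] u by (simp add: mat_commute)
      then show ?thesis using g u by (simp add: act_closed act_scale)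
    qed
  qed auto
  then show ?thesis by blast
qed

definition central_char :: "'a \<Rightarrow> complex" where
  "central_char a = (SOME z. \<forall>v\<in>V. act (mat a) v = z \<cdot> v)"

lemma act_mat: "absv a = 1 \<Longrightarrow> v \<in> V \<Longrightarrow> act (mat a) v = central_char a \<cdot> v"
  using someI_ex[OF ex_central_scalar[of a]] unfolding central_char_def by blast

lemma central_char_eqI:
  assumes "\<And>v. v \<in> V \<Longrightarrow> act (mat a) v = z \<cdot> v" "absv a = 1"
  shows "central_char a = z"
proof -
  obtain v where v: "v \<in> V" "v \<noteq> 0" using ex_nonzero by blast
  then have "central_char a \<cdot> v = z \<cdot> v"
    using assms by (simp flip: act_mat)
  with v show ?thesis by simp
qed

text \<open>Scalar matrices congruent to 1 lie in \<open>GL_cong level\<close>. This bounds the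
  conductor exponent by the level.\<close>

lemma trivial_on_level_central_char: "trivial_on_level central_char level"
  unfolding trivial_on_level_def
proof (intro allI impI)
  fix a :: 'a assume a: "absv a = 1 \<and> absv (a - 1) \<le> absv (unif::'a) ^ level"
  show "central_char a = 1"
  proof (rule central_char_eqI)
    fix v assume v: "v \<in> V"
    have "act (mat a) v = act (mat 1) v"
      using a v by (intro act_mcong mat_mcong mat_GL_int) simp_all
    then show "act (mat a) v = 1 \<cdot> v" using v by (simp add: act_1)
  qed (use a in simp)
qed

lemma unit_character_central_char: "unit_character central_char"
proof -
  have mult: "central_char (a * b) = central_char a * central_char b" if "absv a = 1" "absv b = 1" for a b
  proof (rule central_char_eqI)
    fix v assume v: "v \<in> V"
    have "act (mat (a * b)) v = act (mat a) (act (mat b) v)"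
      using act_mult[OF mat_GL_int mat_GL_int, of a b v] that v by (simp add: mat_mult_mat)
    then show "act (mat (a * b)) v = (central_char a * central_char b) \<cdot> v"
      using that v by (simp add: act_mat V_scale)
  qed (use that in \<open>simp add: absv_mult\<close>)
  have 1: "central_char 1 = 1"
    by (rule central_char_eqI) (simp_all add: act_1)
  have nz: "central_char a \<noteq> 0" if "absv a = 1" for a
  proof -
    have "a \<noteq> 0" using that by auto
    then have "central_char a * central_char (1 / a) = 1"
      using mult[of a "1 / a"] that 1 by (simp add: absv_divide)
    then show ?thesis by auto
  qed
  have cong: "central_char a = central_char b"
    if "absv a = 1" "absv b = 1" "dist a b < absv (unif::'a) ^ level" for a b
  proof (rule central_char_eqI[OF _ that(1)])
    fix v assume v: "v \<in> V"
    have "act (mat a) v = act (mat b) v"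
      using that v by (intro act_mcong mat_mcong mat_GL_int) (simp_all add: dist_eq_absv)
    then show "act (mat a) v = central_char b \<cdot> v"
      using that v by (simp add: act_mat)
  qed
  have "continuous_on int_units central_char"
    unfolding continuous_on_iff
  proof (intro ballI allI impI)
    fix x :: 'a and e :: real assume "x \<in> int_units" "0 < e"
    then have "dist (central_char x') (central_char x) < e"
      if "x' \<in> int_units" "dist x' x < absv (unif::'a) ^ level" for x'
      using cong[of x' x] that by (simp add: int_units_iff)
    then show "\<exists>d>0. \<forall>x'\<in>int_units. dist x' x < d \<longrightarrow> dist (central_char x') (central_char x) < e"
      by (intro exI[of _ "absv (unif::'a) ^ level"]) (simp add: unif_nonzero)
  qed
  then show ?thesis
    using mult nz by (simp add: unit_character_def int_units_iff)
qed

lemma conductor_exp_central_char: "conductor_exp central_char \<le> level"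
  by (rule conductor_exp_le[OF trivial_on_level_central_char])

section \<open>Fixed vectors and homomorphisms from the trivial representation\<close>

abbreviation "mirabolic_fixed \<equiv> {v \<in> V. \<forall>k\<in>GL_mirabolic. act k v = v}"

text \<open>The image of 1 determines a homomorphism and can be any fixed vector.\<close>

lemma rep_Hom_trivial_eq:
  "rep_Hom GL_mirabolic trivial_rep \<tau> = (\<lambda>v z. z \<cdot> v) ` mirabolic_fixed"
proof (intro equalityI subsetI)
  have GL: "k \<in> GL_int" if "k \<in> GL_mirabolic" for k :: "('a, 'n) sqmat"
    using that by (simp add: GL_mirabolic_iff)
  fix T
  {
    assume "T \<in> rep_Hom GL_mirabolic trivial_rep \<tau>"
    then have T: "T z \<in> V" "T (c * z) = c \<cdot> T z" "k \<in> GL_mirabolic \<Longrightarrow> T z = act k (T z)" for z c k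
      by (simp_all add: rep_Hom_def trivial_rep_def)
    have "T z = z \<cdot> T 1" for z
      using T(2)[where z = 1 and c = z] by simp
    then have "T = (\<lambda>z. z \<cdot> T 1)" by (rule ext)
    moreover have "T 1 \<in> mirabolic_fixed" using T(1)[of 1] T(3)[of _ 1] by simp
    ultimately show "T \<in> (\<lambda>v z. z \<cdot> v) ` mirabolic_fixed" by (rule image_eqI)
  next
    assume "T \<in> (\<lambda>v z. z \<cdot> v) ` mirabolic_fixed"
    then obtain v where v: "T = (\<lambda>z. z \<cdot> v)" "v \<in> V" "\<And>k. k \<in> GL_mirabolic \<Longrightarrow> act k v = v" by blast
    then show "T \<in> rep_Hom GL_mirabolic trivial_rep \<tau>"
      by (simp add: rep_Hom_def trivial_rep_def V_scale vs.scale_left_distrib act_scale GL)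
  }
qed

lemma has_dim_rep_Hom_0:
  assumes "\<And>v. v \<in> V \<Longrightarrow> (\<And>k. k \<in> GL_mirabolic \<Longrightarrow> act k v = v) \<Longrightarrow> v = 0"
  shows "has_dim (fun_scale scl) (rep_Hom GL_mirabolic trivial_rep \<tau>) 0"
proof -
  have "mirabolic_fixed = {0}"
    using assms V_0 by (auto simp: GL_mirabolic_iff act_0)
  then have "rep_Hom GL_mirabolic trivial_rep \<tau> = {0}"
    by (simp add: rep_Hom_trivial_eq fun_eq_iff)
  then show ?thesis
    using has_dim_0I[OF vector_space_fun_scale[OF vs.vector_space_axioms]] by simp
qed

lemma has_dim_rep_Hom_1:
  assumes "mirabolic_fixed = range (\<lambda>c. c \<cdot> b)" "b \<noteq> 0"
  shows "has_dim (fun_scale scl) (rep_Hom GL_mirabolic trivial_rep \<tau>) 1"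
proof (rule has_dim_1I[OF vector_space_fun_scale[OF vs.vector_space_axioms], of "\<lambda>z. z \<cdot> b"])
  show "(\<lambda>z. z \<cdot> b) \<noteq> 0"
    using assms(2) by (metis vs.scale_one zero_fun_def)
  show "rep_Hom GL_mirabolic trivial_rep \<tau> = range (\<lambda>c. fun_scale scl c (\<lambda>z. z \<cdot> b))"
    unfolding rep_Hom_trivial_eq assms(1) by (simp add: image_image fun_scale_def mult.commute)
qed

text \<open>The equivalence matches fixed vectors with invariant harmonic functions; b is the
  preimage of the zonal function.\<close>

lemma rep_equiv_harmonic_imp_fixed:
  assumes dk: "haar_prob_measure dk" and n: "CARD('n) \<ge> 2"
    and \<psi>: "unit_character \<psi>" and m: "conductor_exp \<psi> \<le> m"
    and equiv: "rep_equiv GL_int \<tau> (harmonic_rep dk \<psi> m)"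
  shows "\<exists>b. b \<noteq> 0 \<and> mirabolic_fixed = range (\<lambda>c. c \<cdot> b)"
proof -
  let ?H = "harmonic_space dk \<psi> m" and ?z = "zonal \<psi> m :: ('a, 'n) vec \<Rightarrow> complex"
  obtain \<Phi> where \<Phi>: "\<Phi> \<in> rep_Hom GL_int \<tau> (harmonic_rep dk \<psi> m)" "bij_betw \<Phi> V ?H"
    using equiv by (auto simp: rep_equiv_def harmonic_rep_def)
  have scale: "\<Phi> (c \<cdot> v) = fun_scale (*) c (\<Phi> v)" if "v \<in> V" for c v
    using \<Phi>(1) that by (simp add: rep_Hom_def harmonic_rep_def)
  have equivariant: "\<Phi> (act g v) = (\<lambda>x. \<Phi> v (x v* g))" if "g \<in> GL_int" "v \<in> V" for g v
    using \<Phi>(1) that by (simp add: rep_Hom_def harmonic_rep_def)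
  have inj: "u = v" if "u \<in> V" "v \<in> V" "\<Phi> u = \<Phi> v" for u v
    using bij_betw_imp_inj_on[OF \<Phi>(2)] that by (auto dest: inj_onD)
  have GL: "k \<in> GL_int" if "k \<in> GL_mirabolic" for k :: "('a, 'n) sqmat"
    using that by (simp add: GL_mirabolic_iff)
  have "?z \<in> \<Phi> ` V"
    using zonal_harmonic[OF dk \<psi> m] bij_betw_imp_surj_on[OF \<Phi>(2)] by simp
  then obtain b where b: "b \<in> V" "\<Phi> b = ?z" by auto
  have "b \<noteq> 0"
  proof
    assume "b = 0"
    then have "?z = fun_scale (*) 0 ?z" using scale[of b 0] b by simp
    then show False
      using zonal_nonzero[OF \<psi> m n] by (simp add: fun_scale_def fun_eq_iff)
  qed
  have bfix: "act k b = b" if "k \<in> GL_mirabolic" for k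
    using that b zonal_mirabolic[OF \<psi> m that]
    by (intro inj) (simp_all add: act_closed GL equivariant)
  have "mirabolic_fixed = range (\<lambda>c. c \<cdot> b)"
  proof (intro equalityI subsetI)
    fix v assume "v \<in> mirabolic_fixed"
    then have v: "v \<in> V" "\<And>k. k \<in> GL_mirabolic \<Longrightarrow> act k v = v" by auto
    have "\<Phi> v (x v* k) = \<Phi> v x" if "k \<in> GL_mirabolic" for x k
      using equivariant[of k v] v that GL[OF that] by (simp add: fun_eq_iff)
    moreover have "\<Phi> v \<in> ?H" using \<Phi>(2) v(1) by (rule bij_betw_apply)
    ultimately have "\<Phi> v \<in> range (\<lambda>c. fun_scale (*) c ?z)"
      unfolding mirabolic_harmonic_eq_range[OF dk n \<psi> m, symmetric] by blast
    then obtain c where "\<Phi> v = \<Phi> (c \<cdot> b)" using b scale by auto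
    then have "v = c \<cdot> b" using v b by (intro inj V_scale)
    then show "v \<in> range (\<lambda>c. c \<cdot> b)" by blast
  next
    fix v assume "v \<in> range (\<lambda>c. c \<cdot> b)"
    then show "v \<in> mirabolic_fixed" using b bfix by (auto simp: V_scale act_scale GL)
  qed
  with \<open>b \<noteq> 0\<close> show ?thesis by blast
qed

end

section \<open>Frobenius reciprocity and the equivalence with a harmonic space\<close>

context smooth_irrep
begin

text \<open>Frobenius reciprocity: if \<open>u\<close> is fixed by the mirabolic group, then
  \<open>act (matrix_inv k) u\<close> depends only on the point \<open>e_last v* k\<close> of the sphere.\<close>

definition intertwiner :: "'v \<Rightarrow> (('a, 'n) vec \<Rightarrow> complex) \<Rightarrow> 'v" where
  "intertwiner u f = (\<Sum>r\<in>coset_reps level GL_int. f (e_last v* r) \<cdot> act (matrix_inv r) u)"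

lemma coset_reps_GL: "r \<in> coset_reps m G \<Longrightarrow> G \<subseteq> GL_int \<Longrightarrow> r \<in> GL_int"
  using coset_reps_subset by blast

lemma intertwiner_closed: "u \<in> V \<Longrightarrow> intertwiner u f \<in> V"
  unfolding intertwiner_def by (intro V_sum V_scale act_closed GL_int_inverse coset_reps_GL[of _ level GL_int]) auto

lemma intertwiner_add: "intertwiner u (\<lambda>x. f x + g x) = intertwiner u f + intertwiner u g"
  by (simp add: intertwiner_def vs.scale_left_distrib sum.distrib)

lemma intertwiner_diff: "intertwiner u (\<lambda>x. f x - g x) = intertwiner u f - intertwiner u g"
  by (simp add: intertwiner_def vs.scale_left_diff_distrib sum_subtractf)

lemma intertwiner_scale: "intertwiner u (\<lambda>x. c * f x) = c \<cdot> intertwiner u f"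
  by (simp add: intertwiner_def vs.scale_sum_right)

lemma intertwiner_sum: "intertwiner u (\<lambda>x. \<Sum>i\<in>A. f i x) = (\<Sum>i\<in>A. intertwiner u (f i))"
  unfolding intertwiner_def vs.scale_sum_left by (rule sum.swap)

text \<open>Reindexing by \<open>r ** k\<close>: the inverse of \<open>r ** k\<close> absorbs the k
  that acts on the sum.\<close>

lemma intertwiner_translate:
  assumes "u \<in> V" and f: "f \<in> smooth_fun_level \<psi> level" and k: "k \<in> GL_int"
  shows "intertwiner u (\<lambda>x. f (x v* k)) = act k (intertwiner u f)"
proof -
  let ?F = "\<lambda>g. f (e_last v* g) \<cdot> act (k ** matrix_inv g) u"
  let ?R = "coset_reps level (GL_int :: ('a, 'n) sqmat set)"
  have R: "r \<in> GL_int" "matrix_inv r \<in> GL_int" if "r \<in> ?R" for r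
    using coset_reps_GL[OF that] by (auto simp: GL_int_inverse)
  have "act k (intertwiner u f) = (\<Sum>r\<in>?R. ?F r)"
    unfolding intertwiner_def using k assms(1) R
    by (subst act_sum) (simp_all add: V_scale act_closed act_scale act_mult)
  also have "\<dots> = (\<Sum>r\<in>?R. ?F (r ** k))"
  proof (rule sum_coset_reps_mult_right[OF GL_subgroup_GL_int k, symmetric])
    fix g h :: "('a, 'n) sqmat" assume gh: "g \<in> GL_int" "h \<in> GL_int" "mcong level g h"
    \<comment> \<open>Congruence passes to inverses, so both factors of a summand depend only on the
      class of g.\<close>
    have "mcong level (matrix_inv g ** h) (mat 1)"
      using gh by (simp add: mcong_iff_GL_cong GL_cong_iff)
    then have "mcong level (matrix_inv g ** h ** matrix_inv h) (mat 1 ** matrix_inv h)"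
      using gh by (intro mcong_mult_right GL_int_inverse)
    then have "mcong level (matrix_inv g) (matrix_inv h)"
      using gh by (simp add: GL_int_inverse_cancel)
    then have "act (k ** matrix_inv g) u = act (k ** matrix_inv h) u"
      using gh k assms(1) by (intro act_mcong mcong_mult_left GL_int_mult GL_int_inverse)
    moreover have "f (e_last v* g) = f (e_last v* h)"
      by (rule smooth_fun_level_mcong[OF f gh])
    ultimately show "?F g = ?F h" by simp
  qed
  also have "\<dots> = intertwiner u (\<lambda>x. f (x v* k))"
    unfolding intertwiner_def
    by (intro sum.cong refl)
      (simp add: matrix_inv_mult[OF R(1) k] vector_matrix_mul_assoc matrix_mul_assoc GL_int_inverse k)
  finally show ?thesis ..
qed

text \<open>The image is fixed by \<open>GL_cong m\<close>, hence zero by minimality of the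
  level.\<close>

lemma intertwiner_lower_level:
  assumes u: "u \<in> V" and f: "f \<in> smooth_fun_level \<psi> m" and "m < level"
  shows "intertwiner u f = 0"
proof (rule level_minimal[OF assms(3) intertwiner_closed[OF u]])
  fix k :: "('a, 'n) sqmat" assume k: "k \<in> GL_cong m"
  have "act k (intertwiner u f) = intertwiner u (\<lambda>x. f (x v* k))"
    using k assms by (intro intertwiner_translate[symmetric, OF u smooth_fun_level_mono[OF f]])
      (simp_all add: GL_cong_iff)
  also have "(\<lambda>x. f (x v* k)) = f"
    using smooth_fun_level_invariant[OF f k] by (rule ext)
  finally show "act k (intertwiner u f) = intertwiner u f" .
qed

text \<open>Each representative sending \<open>e_last\<close> into the cap contributes exactly u, so
  no cancellation can occur. It factors as a mirabolic matrix, a scalar a and an element of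
  \<open>GL_cong level\<close>; the scalar acts through the character, cancelling the value of the
  cap function.\<close>

lemma intertwiner_cap_fun:
  assumes u: "u \<in> V" "u \<noteq> 0" and fixed: "\<And>k. k \<in> GL_mirabolic \<Longrightarrow> act k u = u"
  shows "intertwiner u (cap_fun central_char level) \<noteq> 0"
proof -
  let ?R = "coset_reps level (GL_int :: ('a, 'n) sqmat set)"
  let ?A = "{r \<in> ?R. e_last v* r \<in> polar_cap level}"
  let ?c = "cap_fun central_char level :: ('a, 'n) vec \<Rightarrow> complex"
  have fin: "finite ?R" by (simp add: finite_coset_reps)
  have cap: "?c (e_last v* r) \<cdot> act (matrix_inv r) u = u"
    if r: "r \<in> GL_int" "e_last v* r \<in> polar_cap level" for r
  proof -
    obtain a k where a: "absv a = 1" "0 < level \<longrightarrow> a = (e_last v* r) $ last_index"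
      and k: "k \<in> GL_cong level" "e_last v* r = (a *s e_last) v* k"
      using polar_cap_orbit[OF r(2)] by (elim exE conjE bexE) (rule that)
    let ?g = "mat a ** k"
    have kG: "k \<in> GL_int" using k(1) by (simp add: GL_cong_iff)
    have aG: "(mat a :: ('a, 'n) sqmat) \<in> GL_int" by (rule mat_GL_int[OF a(1)])
    have g: "?g \<in> GL_int" by (rule GL_int_mult[OF aG kG])
    have eg: "e_last v* ?g = e_last v* r"
      using k(2) by (simp add: mat_mult_vector flip: vector_matrix_mul_assoc)
    have ch: "?c (e_last v* r) = central_char a"
    proof (cases "level = 0")
      case True
      have "absv (a - 1) \<le> 1" using a(1) by (intro absv_diff_le) simp_all
      then have "central_char a = 1"
        using trivial_on_level_central_char True a(1) by (simp add: trivial_on_level_def)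
      then show ?thesis using True r(2) by (simp add: cap_fun_def)
    next
      case False
      with a(2) r(2) show ?thesis by (simp add: cap_fun_def)
    qed
    have "e_last v* (r ** matrix_inv ?g) = e_last v* ?g v* matrix_inv ?g"
      unfolding eg by (rule vector_matrix_mul_assoc[symmetric])
    also have "\<dots> = e_last"
      by (rule GL_int_vector_cancel(1)[OF g])
    finally have "r ** matrix_inv ?g \<in> GL_mirabolic"
      using r(1) g by (simp add: GL_mirabolic_iff GL_int_mult GL_int_inverse)
    then have "act r (act (matrix_inv ?g) u) = u"
      using fixed act_mult[OF r(1) GL_int_inverse(1)[OF g] u(1)] by simp
    then have "act (matrix_inv r) u = act (matrix_inv r) (act r (act (matrix_inv ?g) u))"
      by simp
    also have "\<dots> = act (matrix_inv ?g) u"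
      using r(1) g u(1) by (intro act_inverse act_closed GL_int_inverse)
    finally have "central_char a \<cdot> act (matrix_inv r) u = act (matrix_inv ?g) (central_char a \<cdot> u)"
      using g u(1) by (simp add: act_scale GL_int_inverse)
    also have "central_char a \<cdot> u = act ?g u"
      using act_mult[OF aG kG u(1)] act_mat[OF a(1) u(1)] act_level[OF k(1) u(1)] by simp
    also have "act (matrix_inv ?g) (act ?g u) = u"
      by (rule act_inverse[OF g u(1)])
    finally show ?thesis by (simp add: ch)
  qed
  have "intertwiner u ?c = (\<Sum>r\<in>?R. if e_last v* r \<in> polar_cap level then u else 0)"
    unfolding intertwiner_def
  proof (rule sum.cong[OF refl])
    fix r assume "r \<in> ?R"
    then have "r \<in> GL_int" by (rule coset_reps_GL) simp
    then show "?c (e_last v* r) \<cdot> act (matrix_inv r) u = (if e_last v* r \<in> polar_cap level then u else 0)"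
      using cap by (simp add: cap_fun_def)
  qed
  also have "\<dots> = (\<Sum>r\<in>?A. 1 \<cdot> u)"
    using fin by (simp add: sum.inter_filter)
  also have "\<dots> = of_nat (card ?A) \<cdot> u"
    unfolding vs.scale_sum_left[symmetric] by simp
  finally have eq: "intertwiner u ?c = of_nat (card ?A) \<cdot> u" .
  \<comment> \<open>The class of the identity keeps \<open>e_last\<close> in the cap, so the number
    of contributions is positive.\<close>
  let ?r = "coset_rep level GL_int (mat 1) :: ('a, 'n) sqmat"
  have r: "?r \<in> ?R" "?r \<in> GL_int" "mcong level (mat 1) ?r"
    using coset_rep[OF mat_1_GL_int, of level, where 'a='a and 'b='n] by auto
  have "?c (e_last v* mat 1) = ?c (e_last v* ?r)"
    by (rule smooth_fun_level_mcong[OF cap_fun_level[OF unit_character_central_char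
            trivial_on_level_central_char] mat_1_GL_int r(2,3)])
  then have "?c (e_last v* ?r) \<noteq> 0"
    using cap_fun_e_last[OF unit_character_central_char, of level, where 'b='n] by simp
  then have "e_last v* ?r \<in> polar_cap level"
    by (rule contrapos_np) (simp add: cap_fun_def)
  then have "?r \<in> ?A" using r(1) by simp
  then have "card ?A \<noteq> 0" using fin by auto
  then show ?thesis using eq u(2) by simp
qed

text \<open>The average subtracted in \<open>zonal\<close> has lower level and is killed, which
  leaves a nonzero multiple of the image of the cap function.\<close>

lemma intertwiner_zonal:
  assumes u: "u \<in> V" "u \<noteq> 0" and fixed: "\<And>k. k \<in> GL_mirabolic \<Longrightarrow> act k u = u"
  shows "intertwiner u (zonal central_char level) \<noteq> 0"
proof (cases "level = conductor_exp central_char")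
  case True
  then show ?thesis
    using intertwiner_cap_fun[OF assms] by (simp add: zonal_def[abs_def])
next
  case False
  let ?c = "cap_fun central_char level :: ('a, 'n) vec \<Rightarrow> complex"
  let ?G = "GL_cong (level - 1) :: ('a, 'n) sqmat set"
  \<comment> \<open>Natural subtraction is genuine here: the level exceeds the conductor exponent
    and is positive.\<close>
  have "level - 1 < level"
    using False conductor_exp_central_char by simp
  moreover have "coset_sum level ?G ?c \<in> smooth_fun_level central_char (level - 1)"
    by (intro coset_sum_GL_cong_level cap_fun_level unit_character_central_char trivial_on_level_central_char)
  ultimately have "intertwiner u (coset_sum level ?G ?c) = 0"
    using u(1) by (intro intertwiner_lower_level)
  then have "intertwiner u (zonal central_char level) =
      of_nat (card (coset_reps level ?G)) \<cdot> intertwiner u ?c"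
    using False by (simp add: zonal_def[abs_def] intertwiner_diff intertwiner_scale)
  moreover have "0 < card (coset_reps level ?G)"
    by (rule card_coset_reps_pos[OF GL_subgroup_GL_cong])
  ultimately show ?thesis
    using intertwiner_cap_fun[OF assms] by simp
qed

lemma rep_equiv_harmonic:
  assumes dk: "haar_prob_measure dk" and n: "CARD('n) \<ge> 2"
    and u: "u \<in> V" "u \<noteq> 0" and fixed: "\<And>k. k \<in> GL_mirabolic \<Longrightarrow> act k u = u"
  shows "rep_equiv GL_int \<tau> (harmonic_rep dk central_char level)"
proof -
  let ?H = "harmonic_space dk central_char level" and ?T = "intertwiner u"
  let ?z = "zonal central_char level :: ('a, 'n) vec \<Rightarrow> complex"
  note \<psi> = unit_character_central_char and m = conductor_exp_central_char
  have H_level: "f \<in> smooth_fun_level central_char level" if "f \<in> ?H" for f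
    by (rule harmonic_space_level[OF dk that])
  have z: "?z \<in> ?H" by (rule zonal_harmonic[OF dk \<psi> m])
  have Tz: "?T ?z \<noteq> 0" by (rule intertwiner_zonal[OF u fixed])
  have H_translate: "(\<lambda>x. f (x v* k)) \<in> ?H" if "f \<in> ?H" "k \<in> GL_int" for f k
    by (rule harmonic_space_translate[OF dk that])
  have H_scale: "(\<lambda>x. c * f x) \<in> ?H" if "f \<in> ?H" for c f
    by (rule harmonic_space_scale[OF dk that])
  have H_diff: "(\<lambda>x. f x - g x) \<in> ?H" if "f \<in> ?H" "g \<in> ?H" for f g
    by (rule harmonic_space_diff[OF dk that])
  have H_add: "(\<lambda>x. f x + g x) \<in> ?H" if "f \<in> ?H" "g \<in> ?H" for f g
    using H_diff[OF that(1) H_scale[OF that(2), of "- 1"]] by simp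
  have kernel: "f x = 0" if f: "f \<in> ?H" and Tf: "?T f = 0" for f x
  proof (rule ccontr)
    assume fx: "f x \<noteq> 0"
    then have "x \<in> sphere_int"
      using smooth_fun_level_outside[OF H_level[OF f]] by blast
    then obtain k where k: "k \<in> GL_int" "e_last v* k = x"
      using sphere_int_transitive[OF e_last_sphere] by blast
    let ?M = "GL_mirabolic :: ('a, 'n) sqmat set"
    \<comment> \<open>Translation moves the nonzero value to \<open>e_last\<close>, where mirabolic
      averaging preserves it up to a positive factor because \<open>e_last\<close> is fixed. The
      average F is a multiple of the zonal function yet lies in the kernel, so it must vanish, which
      contradicts its value there.\<close>
    define f' where "f' = (\<lambda>y. f (y v* k))"
    have f': "f' \<in> ?H" unfolding f'_def by (rule H_translate[OF f k(1)])
    have "?T f' = 0"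
      unfolding f'_def using Tf k(1) u(1) by (simp add: intertwiner_translate[OF _ H_level[OF f]] act_0)
    define F where "F = coset_sum level ?M f'"
    have M: "r \<in> GL_int" if "r \<in> coset_reps level ?M" for r
      using that by (rule coset_reps_GL) (auto simp: GL_mirabolic_iff)
    have F_eq: "F = (\<lambda>x. \<Sum>r\<in>coset_reps level ?M. f' (x v* r))"
      by (simp add: F_def coset_sum_def[abs_def])
    have "F \<in> ?H"
      unfolding F_eq by (intro harmonic_space_sum[OF dk] H_translate[OF f'] M)
    moreover have "F (x v* g) = F x" if "g \<in> ?M" for x g
      unfolding F_def by (rule coset_sum_invariant[OF GL_subgroup_GL_mirabolic H_level[OF f'] that])
    ultimately have "F \<in> range (\<lambda>c. fun_scale (*) c ?z)"
      unfolding mirabolic_harmonic_eq_range[OF dk n \<psi> m, symmetric] by simp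
    then obtain c where c: "F = (\<lambda>x. c * ?z x)" by (auto simp: fun_scale_def)
    have "?T F = (\<Sum>r\<in>coset_reps level ?M. act r (?T f'))"
      unfolding F_eq intertwiner_sum
      by (intro sum.cong refl intertwiner_translate[OF u(1) H_level[OF f']] M)
    also have "\<dots> = 0"
      using \<open>?T f' = 0\<close> M by (simp add: act_0)
    finally have "c = 0"
      using Tz by (simp add: c intertwiner_scale)
    moreover have "F e_last = of_nat (card (coset_reps level ?M)) * f' e_last"
      unfolding F_def by (rule coset_sum_of_invariant) (simp add: GL_mirabolic_iff)
    moreover have "0 < card (coset_reps level ?M)"
      by (rule card_coset_reps_pos[OF GL_subgroup_GL_mirabolic])
    ultimately show False
      using fx k(2) by (simp add: c f'_def)
  qed
  have inj: "inj_on ?T ?H"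
  proof (rule inj_onI)
    fix f g assume fg: "f \<in> ?H" "g \<in> ?H" "?T f = ?T g"
    then have "f x - g x = 0" for x
      using kernel[OF H_diff[OF fg(1,2)], of x] by (simp add: intertwiner_diff)
    then show "f = g" by (simp add: fun_eq_iff)
  qed
  have surj: "?T ` ?H = V"
  proof (rule stable_subspace_eq_V)
    show "vs.subspace (?T ` ?H)"
    proof (rule vs.subspaceI)
      have "?T (\<lambda>x. 0 * ?z x) = 0" by (simp only: intertwiner_scale) simp
      then show "0 \<in> ?T ` ?H" using H_scale[OF z, of 0] by (metis imageI)
    next
      fix v w assume "v \<in> ?T ` ?H" "w \<in> ?T ` ?H"
      then obtain f g where fg: "f \<in> ?H" "g \<in> ?H" "v = ?T f" "w = ?T g" by blast
      then have "v + w = ?T (\<lambda>x. f x + g x)" by (simp add: intertwiner_add)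
      then show "v + w \<in> ?T ` ?H" using H_add[OF fg(1,2)] by blast
    next
      fix c v assume "v \<in> ?T ` ?H"
      then obtain f where f: "f \<in> ?H" "v = ?T f" by blast
      then have "c \<cdot> v = ?T (\<lambda>x. c * f x)" by (simp add: intertwiner_scale)
      then show "c \<cdot> v \<in> ?T ` ?H" using H_scale[OF f(1)] by blast
    qed
    show "?T ` ?H \<subseteq> V" using intertwiner_closed[OF u(1)] by blast
    show "act g w \<in> ?T ` ?H" if g: "g \<in> GL_int" and w: "w \<in> ?T ` ?H" for g w
    proof -
      obtain f where f: "f \<in> ?H" "w = ?T f" using w by blast
      then have "act g w = ?T (\<lambda>x. f (x v* g))"
        by (simp add: intertwiner_translate[OF u(1) H_level[OF f(1)] g])
      then show ?thesis using H_translate[OF f(1) g] by blast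
    qed
    show "?T ?z \<in> ?T ` ?H" using z by (rule imageI)
  qed (fact Tz)
  \<comment> \<open>An equivalence has to start at \<open>\<tau>\<close>, so the inverse of the
    intertwiner is taken, with the value zero off the space that \<open>rep_Hom\<close>
    prescribes.\<close>
  define S where "S v = (if v \<in> V then inv_into ?H ?T v else 0)" for v
  have S: "S v \<in> ?H" "?T (S v) = v" if "v \<in> V" for v
    using that surj by (simp_all add: S_def inv_into_into f_inv_into_f)
  have S_eqI: "S v = f" if "f \<in> ?H" "?T f = v" for v f
    using that intertwiner_closed[OF u(1), of f] inj by (auto simp: S_def)
  have "S \<in> rep_Hom GL_int \<tau> (harmonic_rep dk central_char level)"
    unfolding rep_Hom_def
  proof (intro CollectI conjI ballI allI impI)
    fix v w c g
    show "S v = 0" if "v \<notin> V" using that by (simp add: S_def)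
    assume v: "v \<in> V"
    show "S v \<in> rspace (harmonic_rep dk central_char level)"
      using S(1)[OF v] by (simp add: harmonic_rep_def)
    show "S (v + w) = S v + S w" if "w \<in> V"
      using H_add[OF S(1)[OF v] S(1)[OF that]] S(2)[OF v] S(2)[OF that]
      by (intro S_eqI) (simp_all add: intertwiner_add plus_fun_def)
    show "S (c \<cdot> v) = rscale (harmonic_rep dk central_char level) c (S v)"
      using H_scale[OF S(1)[OF v]] S(2)[OF v]
      by (intro S_eqI) (simp_all add: intertwiner_scale harmonic_rep_def fun_scale_def)
    show "S (act g v) = ract (harmonic_rep dk central_char level) g (S v)" if "g \<in> GL_int"
      using H_translate[OF S(1)[OF v] that] S(2)[OF v]
      by (intro S_eqI) (simp_all add: harmonic_rep_def intertwiner_translate[OF u(1) H_level[OF S(1)[OF v]] that])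
  qed
  moreover have "bij_betw S V ?H"
  proof (rule bij_betw_imageI)
    show "inj_on S V" by (rule inj_onI) (metis S(2))
    show "S ` V = ?H"
    proof (intro equalityI subsetI)
      fix f assume f: "f \<in> ?H"
      have "f = S (?T f)" using S_eqI[OF f refl] by simp
      then show "f \<in> S ` V" using intertwiner_closed[OF u(1), of f] by (rule image_eqI)
    qed (use S(1) in auto)
  qed
  ultimately show ?thesis
    by (auto simp: rep_equiv_def harmonic_rep_def)
qed

end

theorem corollary2p19:
  fixes dk :: "('a::nonarch_local_field, 'n::{finite,linorder}) sqmat measure"
  assumes "CARD('n) \<ge> 2" and "haar_prob_measure dk"
  shows "(\<forall>\<tau> :: (('a, 'n) sqmat, 'v::ab_group_add) rep.
            smooth_rep GL_int \<tau> \<and> irreducible_rep GL_int \<tau> \<longrightarrow>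
            has_dim (fun_scale (rscale \<tau>)) (rep_Hom GL_mirabolic trivial_rep \<tau>)
              (if \<exists>\<psi> m. unit_character \<psi> \<and> conductor_exp \<psi> \<le> m \<and>
                    rep_equiv GL_int \<tau> (harmonic_rep dk \<psi> m)
               then 1 else 0)) \<and>
         (\<forall>\<psi> m. unit_character \<psi> \<and> conductor_exp \<psi> \<le> m \<longrightarrow>
            has_dim (fun_scale (*))
              {f \<in> harmonic_space dk \<psi> m.
                 \<forall>x\<in>sphere_int. \<forall>k\<in>GL_mirabolic. f (x v* k) = f x} 1)"
proof (intro conjI allI impI)
  fix \<tau> :: "(('a, 'n) sqmat, 'v) rep"
  assume "smooth_rep GL_int \<tau> \<and> irreducible_rep GL_int \<tau>"
  then interpret smooth_irrep \<tau> by unfold_locales simp_all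
  let ?equiv = "\<exists>\<psi> m. unit_character \<psi> \<and> conductor_exp \<psi> \<le> m \<and> rep_equiv GL_int \<tau> (harmonic_rep dk \<psi> m)"
  show "has_dim (fun_scale (rscale \<tau>)) (rep_Hom GL_mirabolic trivial_rep \<tau>) (if ?equiv then 1 else 0)"
  proof (cases ?equiv)
    case True
    then obtain \<psi> m where "unit_character \<psi>" "conductor_exp \<psi> \<le> m"
      "rep_equiv GL_int \<tau> (harmonic_rep dk \<psi> m)" by blast
    from rep_equiv_harmonic_imp_fixed[OF assms(2,1) this]
    obtain b where "b \<noteq> 0" "mirabolic_fixed = range (\<lambda>c. rscale \<tau> c b)" by blast
    then have "has_dim (fun_scale (rscale \<tau>)) (rep_Hom GL_mirabolic trivial_rep \<tau>) 1"
      by (intro has_dim_rep_Hom_1)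
    with True show ?thesis by (simp only: if_True)
  next
    case False
    have "has_dim (fun_scale (rscale \<tau>)) (rep_Hom GL_mirabolic trivial_rep \<tau>) 0"
    proof (rule has_dim_rep_Hom_0, rule ccontr)
      fix u assume "u \<in> rspace \<tau>" "\<And>k. k \<in> GL_mirabolic \<Longrightarrow> ract \<tau> k u = u" "u \<noteq> 0"
      then have "rep_equiv GL_int \<tau> (harmonic_rep dk central_char level)"
        by (intro rep_equiv_harmonic[OF assms(2,1)])
      with False unit_character_central_char conductor_exp_central_char show False by blast
    qed
    with False show ?thesis by (simp only: if_False)
  qed
next
  fix \<psi> :: "'a \<Rightarrow> complex" and m
  assume "unit_character \<psi> \<and> conductor_exp \<psi> \<le> m"
  then show "has_dim (fun_scale (*))
      {f \<in> harmonic_space dk \<psi> m. \<forall>x\<in>sphere_int. \<forall>k\<in>GL_mirabolic. f (x v* k) = f x} 1"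
    by (intro has_dim_mirabolic_harmonic[OF assms(2,1)]) simp_all
qed

end
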